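(* Let $\mathcal T$ be a self-similar tiling in $\mathbb R^d$ with (single) generator $G$ of inradius $g$, and suppose a Steiner-like representation $V(G,\varepsilon)=\sum_{k=0}^d\kappa_k(G,\varepsilon)\varepsilon^{d-k}$ ($0<\varepsilon\le g$) for $G$ has been chosen. Let $S$ be a screen such that $S(0)<0$ (so that all integer dimensions are visible) and let $W$ be the associated window. Then for all $\varepsilon>0$, $$V(\mathcal T,\varepsilon)=\sum_{\omega\in\mathcal D_{\mathcal T}(W)}\operatorname{Res}_{s=\omega}\zeta_{\mathcal T}(\varepsilon,s)+\lambda_d(G)\,\zeta_{\mathcal L}(d)+\mathcal R(\varepsilon),$$ where $$\mathcal R(\varepsilon)=\frac1{2\pi i}\int_S\frac{\varepsilon^{d-s}\zeta_{\mathcal L}(s)}{d-s}\left(\sum_{k=0}^{d-1}\frac{g^{s-k}}{s-k}(d-k)\kappa_k(G)\right)ds$$ satisfies $\mathcal R(\varepsilon)=O(\varepsilon^{d-\sup S})$ as $\varepsilon\to0^+$. Moreover, if $G$ is monophase (with its constant-coefficient representation chosen), then the same conclusion holds without the assumption $S(0)<0$, as long as $S$ avoids the set $\{0,1,\dots,d\}$; in this case one also has $\mathcal R(\varepsilon)=\frac1{2\pi i}\int_S\zeta_{\mathcal T}(\varepsilon,s)\,ds$.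
   Context: Self-similar tilings. Let $\{\Phi_1,\dots,\Phi_N\}$, $N\ge2$, be contractive similarities of $\mathbb R^d$ with scaling ratios $r_n\in(0,1)$, $\Phi(A):=\bigcup_n\Phi_n(A)$, and $F$ the attractor (the unique nonempty compact set with $F=\Phi(F)$). A feasible open set is a nonempty open $O\subseteq\mathbb R^d$ (bounded here) with $\Phi_n(O)\subseteq O$ for all $n$ and $\Phi_n(O)\cap\Phi_m(O)=\emptyset$ for $n\ne m$; the open set condition says that one exists. The nontriviality condition says that $O\not\subseteq\Phi(\overline O)$ for some feasible $O$ (this does not depend on the choice of $O$). Both conditions are always assumed. The self-similar tiling associated with $\{\Phi_n\}$ and $O$ is $\mathcal T=\{\Phi_w(G_q)\}$, where the $G_q$ are the connected components of $O\setminus\Phi(\overline O)$ and $w=w_1\cdots w_n$ runs over all finite words (including the empty word) in $\{1,\dots,N\}$, with $\Phi_w=\Phi_{w_1}\circ\cdots\circ\Phi_{w_n}$, $r_w=r_{w_1}\cdots r_{w_n}$ ($\Phi_w=\mathrm{Id}$, $r_w=1$ for the empty word). Here there is a single component $G$ (the generator). The words are ordered as $w^{(1)},w^{(2)},\dots$ so that $\ell_j:=r_{w^{(j)}}$ is nonincreasing; $\mathcal L=\{\ell_j\}$ is the associated fractal string ($\ell_1=1$), and the tiles are $G^j=\Phi_{w^{(j)}}(G)$. Inner parallel volumes. $\lambda_d$ is Lebesgue measure. For bounded open $A\subseteq\mathbb R^d$ and $\varepsilon>0$, $A_{-\varepsilon}:=\{x\in A:\operatorname{dist}(x,A^c)\le\varepsilon\}$,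 $V(A,\varepsilon):=\lambda_d(A_{-\varepsilon})$, and $V(\mathcal T,\varepsilon):=\lambda_d(T_{-\varepsilon})=\sum_jV(G^j,\varepsilon)$ with $T=\bigcup_jG^j$. The inradius $g$ of $G$ is the radius of the largest open ball contained in $G$. Steiner-like representation. This is an expression $V(G,\varepsilon)=\sum_{k=0}^d\kappa_k(G,\varepsilon)\varepsilon^{d-k}$ for $0<\varepsilon\le g$, where each $\kappa_k(G,\cdot)$ is a real-valued function on $(0,g]$ bounded on $[\varepsilon_0,g]$ for every $\varepsilon_0\in(0,g]$. Put $\kappa_k(G):=\kappa_k(G,g)$ and extend by $\kappa_k(G,\varepsilon):=\kappa_k(G)$ for $\varepsilon\ge g$. $G$ is monophase if it has such a representation with constant coefficient functions $\kappa_k(G,\varepsilon)=\kappa_k(G)$; this representation is then always the one used. Zeta functions. $\zeta_{\mathcal L}(s)=\sum_j\ell_j^s$ for $\Re s>D$ ($D$ the abscissa of convergence, the unique real root of $\sum_nr_n^s=1$), with meromorphic continuation $\zeta_{\mathcal L}(s)=1/(1-\sum_{n=1}^Nr_n^s)$ to $\mathbb C$. The tubular zeta function is (the meromorphic extension in $s$ to $\mathbb C$ of) $$\zeta_{\mathcal T}(\varepsilon,s)=\varepsilon^{d-s}\sum_{j=1}^\infty\ell_j^s\left(\sum_{k=0}^d\frac{g^{s-k}}{s-k}\kappa_k(G,\ell_j^{-1}\varepsilon)-\frac{g^{s-d}}{s-d}\lambda_d(G)\right).$$ Screens. A screen is the contour $S=\{S(t)+it:t\in\mathbb R\}$, where $S:\mathbb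 R\to(-\infty,D]$ is a bounded Lipschitz function, chosen so that no pole of $\zeta_{\mathcal L}$ lies on $S$; $\sup S:=\sup_tS(t)$. The window is $W=\{z:\Re z\ge S(\Im z)\}$. $\int_S$ is taken upwards: $\int_Sf(s)\,ds=\int_{\mathbb R}f(S(t)+it)(S'(t)+i)\,dt$. $\mathcal D_{\mathcal L}(W)$ is the set of poles of $\zeta_{\mathcal L}$ in $W$ and $\mathcal D_{\mathcal T}(W):=\mathcal D_{\mathcal L}(W)\cup(\{0,1,\dots,d\}\cap W)$. Convention. An infinite sum over complex dimensions is understood as $\lim_{n\to\infty}$ of the sums over those $\omega$ with $T_{-n}<\Im\omega<T_n$, where $\{T_n\}_{n\in\mathbb Z}$ is a real sequence with $T_{-n}<0<T_n$ ($n\ge1$), $T_n\to\infty$, $T_{-n}\to-\infty$, $T_n/|T_{-n}|\to1$, along which $\zeta_{\mathcal L}$ is languid of order $0$: for some $c>0$, $|\zeta_{\mathcal L}(\alpha+iT_n)|\le c$ for all $n$ and all $\alpha\in\mathbb R$ (such sequences exist for self-similar strings).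
   Formalization: The screen S is additionally assumed to be such that the integral over S defining R(ε) converges absolutely for every ε > 0; a Lipschitz screen may approach infinitely many poles so fast that this integral diverges. *)

theory Defs
  imports "HOL-Complex_Analysis.Complex_Analysis" "HOL-Library.Landau_Symbols"
begin

definition contractive_similarity :: "real \<Rightarrow> ('a::euclidean_space \<Rightarrow> 'a) \<Rightarrow> bool" where
  "contractive_similarity \<rho> f \<longleftrightarrow> 0 < \<rho> \<and> \<rho> < 1 \<and> (\<forall>x y. dist (f x) (f y) = \<rho> * dist x y)"

definition ifs_image :: "nat \<Rightarrow> (nat \<Rightarrow> 'a \<Rightarrow> 'a::euclidean_space) \<Rightarrow> 'a set \<Rightarrow> 'a set" where
  "ifs_image N \<Phi> A = (\<Union>n\<in>{1..N}. \<Phi> n ` A)"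

definition feasible_open_set :: "nat \<Rightarrow> (nat \<Rightarrow> 'a \<Rightarrow> 'a::euclidean_space) \<Rightarrow> 'a set \<Rightarrow> bool" where
  "feasible_open_set N \<Phi> U \<longleftrightarrow>
     open U \<and> bounded U \<and> U \<noteq> {} \<and> (\<forall>n\<in>{1..N}. \<Phi> n ` U \<subseteq> U) \<and>
     (\<forall>n\<in>{1..N}. \<forall>m\<in>{1..N}. n \<noteq> m \<longrightarrow> \<Phi> n ` U \<inter> \<Phi> m ` U = {})"

definition nontriviality_condition :: "nat \<Rightarrow> (nat \<Rightarrow> 'a \<Rightarrow> 'a::euclidean_space) \<Rightarrow> bool" where
  "nontriviality_condition N \<Phi> \<longleftrightarrow>
     (\<exists>U. feasible_open_set N \<Phi> U \<and> \<not> U \<subseteq> ifs_image N \<Phi> (closure U))"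

text \<open>Words are lists; for \<open>w = [w\<^sub>1, \<dots>, w\<^sub>n]\<close> the map below is
  \<open>\<Phi> w\<^sub>1 \<circ> \<dots> \<circ> \<Phi> w\<^sub>n\<close>.\<close>

definition word_map :: "(nat \<Rightarrow> 'a \<Rightarrow> 'a) \<Rightarrow> nat list \<Rightarrow> 'a \<Rightarrow> 'a" where
  "word_map \<Phi> w = foldr (\<lambda>n f. \<Phi> n \<circ> f) w id"

definition word_ratio :: "(nat \<Rightarrow> real) \<Rightarrow> nat list \<Rightarrow> real" where
  "word_ratio r w = prod_list (map r w)"

text \<open>Enumerations are indexed from 0, so \<open>w 0\<close> is the first word (the empty one).\<close>

definition word_ordering :: "nat \<Rightarrow> (nat \<Rightarrow> real) \<Rightarrow> (nat \<Rightarrow> nat list) \<Rightarrow> bool" where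
  "word_ordering N r w \<longleftrightarrow>
     bij_betw w UNIV (lists {1..N}) \<and> decseq (\<lambda>j. word_ratio r (w j))"

definition fractal_string :: "(nat \<Rightarrow> real) \<Rightarrow> (nat \<Rightarrow> nat list) \<Rightarrow> nat \<Rightarrow> real" where
  "fractal_string r w j = word_ratio r (w j)"

definition tile :: "(nat \<Rightarrow> 'a \<Rightarrow> 'a) \<Rightarrow> (nat \<Rightarrow> nat list) \<Rightarrow> 'a set \<Rightarrow> nat \<Rightarrow> 'a set" where
  "tile \<Phi> w G j = word_map \<Phi> (w j) ` G"


definition inner_parallel :: "'a::euclidean_space set \<Rightarrow> real \<Rightarrow> 'a set" where
  "inner_parallel A \<epsilon> = {x \<in> A. infdist x (- A) \<le> \<epsilon>}"

definition inner_volume :: "'a::euclidean_space set \<Rightarrow> real \<Rightarrow> real" where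
  "inner_volume A \<epsilon> = measure lborel (inner_parallel A \<epsilon>)"

definition tiling_volume ::
  "(nat \<Rightarrow> 'a \<Rightarrow> 'a::euclidean_space) \<Rightarrow> (nat \<Rightarrow> nat list) \<Rightarrow> 'a set \<Rightarrow> real \<Rightarrow> real" where
  "tiling_volume \<Phi> w G \<epsilon> = inner_volume (\<Union>j. tile \<Phi> w G j) \<epsilon>"

definition inradius :: "'a::euclidean_space set \<Rightarrow> real" where
  "inradius A = Sup {\<rho>. 0 < \<rho> \<and> (\<exists>x. ball x \<rho> \<subseteq> A)}"

text \<open>Only the values \<open>\<kappa> k \<epsilon>\<close> with \<open>k \<le> d\<close> and \<open>0 < \<epsilon> \<le> g\<close> matter.\<close>

definition steiner_like :: "'a::euclidean_space set \<Rightarrow> (nat \<Rightarrow> real \<Rightarrow> real) \<Rightarrow> bool" where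
  "steiner_like G \<kappa> \<longleftrightarrow>
     (\<forall>\<epsilon>\<in>{0<..inradius G}. inner_volume G \<epsilon> = (\<Sum>k\<le>DIM('a). \<kappa> k \<epsilon> * \<epsilon> ^ (DIM('a) - k))) \<and>
     (\<forall>k\<le>DIM('a). \<forall>\<epsilon>0\<in>{0<..inradius G}. bounded (\<kappa> k ` {\<epsilon>0..inradius G}))"

definition monophase :: "'a::euclidean_space set \<Rightarrow> bool" where
  "monophase G \<longleftrightarrow> (\<exists>c. steiner_like G (\<lambda>k \<epsilon>. c k))"

definition constant_coefficients :: "'a::euclidean_space set \<Rightarrow> (nat \<Rightarrow> real \<Rightarrow> real) \<Rightarrow> bool" where
  "constant_coefficients G \<kappa> \<longleftrightarrow>
     (\<forall>k\<le>DIM('a). \<forall>\<epsilon>\<in>{0<..inradius G}. \<kappa> k \<epsilon> = \<kappa> k (inradius G))"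

definition extended_coefficient ::
  "'a::euclidean_space set \<Rightarrow> (nat \<Rightarrow> real \<Rightarrow> real) \<Rightarrow> nat \<Rightarrow> real \<Rightarrow> real" where
  "extended_coefficient G \<kappa> k \<epsilon> = (if \<epsilon> \<le> inradius G then \<kappa> k \<epsilon> else \<kappa> k (inradius G))"


text \<open>The library predicate \<open>nicely_meromorphic_on\<close> prescribes the value 0 at poles and
  excludes removable singularities, which makes the extension unique as a total function.\<close>

definition meromorphic_extension :: "(complex \<Rightarrow> complex) \<Rightarrow> complex set \<Rightarrow> complex \<Rightarrow> complex" where
  "meromorphic_extension f A =
     (THE h. h nicely_meromorphic_on UNIV \<and> (\<forall>s\<in>A. h s = f s))"

definition convergence_abscissa :: "(nat \<Rightarrow> real) \<Rightarrow> real" where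
  "convergence_abscissa l = Inf {\<sigma>::real. summable (\<lambda>j. l j powr \<sigma>)}"

definition geometric_zeta :: "(nat \<Rightarrow> real) \<Rightarrow> complex \<Rightarrow> complex" where
  "geometric_zeta l =
     meromorphic_extension (\<lambda>s. \<Sum>j. of_real (l j) powr s) {s. Re s > convergence_abscissa l}"

text \<open>The points \<open>0, \<dots>, d\<close> are left out of the region on which the extension has to agree with
  the series, since there the terms involve division by zero.\<close>

definition tubular_zeta ::
  "'a::euclidean_space set \<Rightarrow> (nat \<Rightarrow> real \<Rightarrow> real) \<Rightarrow> (nat \<Rightarrow> real) \<Rightarrow> real \<Rightarrow> complex \<Rightarrow> complex"
where
  "tubular_zeta G \<kappa> l \<epsilon> =
     (let d = DIM('a); g = complex_of_real (inradius G) in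
      meromorphic_extension
        (\<lambda>s. of_real \<epsilon> powr (of_nat d - s) *
          (\<Sum>j. of_real (l j) powr s *
            ((\<Sum>k\<le>d. g powr (s - of_nat k) / (s - of_nat k) *
                of_real (extended_coefficient G \<kappa> k (\<epsilon> / l j)))
             - g powr (s - of_nat d) / (s - of_nat d) * of_real (measure lborel G))))
        {s. Re s > convergence_abscissa l \<and> s \<notin> of_nat ` {..d}})"


definition screen :: "(nat \<Rightarrow> real) \<Rightarrow> (real \<Rightarrow> real) \<Rightarrow> bool" where
  "screen l S \<longleftrightarrow>
     bounded (range S) \<and> (\<exists>L. L-lipschitz_on UNIV S) \<and> (\<forall>t. S t \<le> convergence_abscissa l) \<and>
     (\<forall>t. \<not> is_pole (geometric_zeta l) (Complex (S t) t))"

definition window :: "(real \<Rightarrow> real) \<Rightarrow> complex set" where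
  "window S = {z. Re z \<ge> S (Im z)}"

text \<open>A Lipschitz function is differentiable almost everywhere, so the arbitrary value of
  \<open>deriv S t\<close> at the remaining points does not matter.\<close>

definition screen_integrand :: "(real \<Rightarrow> real) \<Rightarrow> (complex \<Rightarrow> complex) \<Rightarrow> real \<Rightarrow> complex" where
  "screen_integrand S f t = f (Complex (S t) t) * (of_real (deriv S t) + \<i>)"

text \<open>Absolute convergence of the screen integral does not follow from \<open>screen\<close>: a Lipschitz screen
  may approach infinitely many poles so fast that the integral diverges. It holds whenever the
  zeta function is bounded on the screen and \<open>f\<close> is the error integrand below.\<close>

definition screen_integrable :: "(real \<Rightarrow> real) \<Rightarrow> (complex \<Rightarrow> complex) \<Rightarrow> bool" where
  "screen_integrable S f \<longleftrightarrow> integrable lebesgue (screen_integrand S f)"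

definition screen_integral :: "(real \<Rightarrow> real) \<Rightarrow> (complex \<Rightarrow> complex) \<Rightarrow> complex" where
  "screen_integral S f = integral\<^sup>L lebesgue (screen_integrand S f)"

definition string_dimensions :: "(nat \<Rightarrow> real) \<Rightarrow> complex set \<Rightarrow> complex set" where
  "string_dimensions l W = {\<omega> \<in> W. is_pole (geometric_zeta l) \<omega>}"

definition tiling_dimensions :: "nat \<Rightarrow> (nat \<Rightarrow> real) \<Rightarrow> complex set \<Rightarrow> complex set" where
  "tiling_dimensions d l W = string_dimensions l W \<union> (of_nat ` {0..d} \<inter> W)"

definition languid_heights :: "(complex \<Rightarrow> complex) \<Rightarrow> (int \<Rightarrow> real) \<Rightarrow> bool" where
  "languid_heights Z T \<longleftrightarrow>
     (\<forall>n\<ge>1. T (- n) < 0 \<and> 0 < T n) \<and>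
     filterlim (\<lambda>n. T (int n)) at_top sequentially \<and>
     filterlim (\<lambda>n. T (- int n)) at_bot sequentially \<and>
     (\<lambda>n. T (int n) / \<bar>T (- int n)\<bar>) \<longlonglongrightarrow> 1 \<and>
     (\<exists>c>0. \<forall>n \<alpha>. norm (Z (Complex \<alpha> (T n))) \<le> c)"

text \<open>Summation over an infinite set of complex dimensions, truncated along the heights \<open>T\<close>.\<close>

definition dimension_sums ::
  "(int \<Rightarrow> real) \<Rightarrow> complex set \<Rightarrow> (complex \<Rightarrow> complex) \<Rightarrow> complex \<Rightarrow> bool" where
  "dimension_sums T D f v \<longleftrightarrow>
     (\<lambda>n. \<Sum>\<omega>\<in>{\<omega> \<in> D. T (- int n) < Im \<omega> \<and> Im \<omega> < T (int n)}. f \<omega>) \<longlonglongrightarrow> v"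


definition error_integrand ::
  "'a::euclidean_space set \<Rightarrow> (nat \<Rightarrow> real \<Rightarrow> real) \<Rightarrow> (nat \<Rightarrow> real) \<Rightarrow> real \<Rightarrow> complex \<Rightarrow> complex"
where
  "error_integrand G \<kappa> l \<epsilon> s =
     (let d = DIM('a); g = complex_of_real (inradius G) in
      of_real \<epsilon> powr (of_nat d - s) * geometric_zeta l s / (of_nat d - s) *
      (\<Sum>k<d. g powr (s - of_nat k) / (s - of_nat k) * of_nat (d - k) *
         of_real (\<kappa> k (inradius G))))"

definition error_term ::
  "'a::euclidean_space set \<Rightarrow> (nat \<Rightarrow> real \<Rightarrow> real) \<Rightarrow> (nat \<Rightarrow> real) \<Rightarrow> (real \<Rightarrow> real) \<Rightarrow> real \<Rightarrow> complex"
where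
  "error_term G \<kappa> l S \<epsilon> =
     1 / (2 * of_real pi * \<i>) * screen_integral S (error_integrand G \<kappa> l \<epsilon>)"

end

theory Submission
  imports Defs
begin

text \<open>
  Write \<open>\<zeta>\<close> for the zeta function of the string, \<open>g\<close> for the inradius and \<open>d\<close> for the dimension.
  Since the tiles are disjoint similar copies of \<open>G\<close>, the tube volume is the sum of
  \<open>l j ^ d * V(G, \<epsilon> / l j)\<close>. Up to the multiple \<open>l j ^ d * measure G\<close> and a finite correction
  that comes from the tiles of inradius at least \<open>\<epsilon>\<close> (where the coefficients differ from their
  value at \<open>g\<close>), each summand is an inverse Mellin transform, by Perron's integral for
  \<open>y powr s / ((s - k) * (s - d))\<close>. Summing over \<open>j\<close> yields the integral of the error integrand
  along a vertical line to the right of all its poles. Moving that line to the screen collects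
  the residues; the horizontal edges vanish along the languid heights because the error integrand
  is \<open>O(1 / (Im s)\<^sup>2)\<close> there. The correction is what the tubular zeta function has in addition
  to the error integrand, and its residues at \<open>0, \<dots>, d\<close> account for the finite correction.
\<close>

subsection \<open>Lipschitz functions on the line\<close>

text \<open>Two facts shape the proof. The Steiner formula at \<open>g\<close> returns the full
  volume of \<open>G\<close>, so \<open>measure lborel G\<close> is itself a combination of the
  numbers \<open>\<kappa> k g\<close>. This cancels the term with \<open>k = d\<close> and turns the
  others into multiples of \<open>1 / ((s - k) * (s - d))\<close>, whose quadratic decay makes the
  line integral absolutely convergent and lets sum and integral be exchanged. The correction need
  not decay like this; it is never integrated, and only its residues enter, computed directly. The
  second fact is that a screen is merely Lipschitz. Its part of the contour is handled through
  almost everywhere differentiability and a fundamental theorem of calculus for Lipschitz functions.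
  The winding numbers of the closed contour come from two branches of the logarithm on planes slit
  along horizontal rays; such slits suit the screen because it is a graph over the imaginary
  axis.\<close>

lemma lipschitz_real_absolutely_continuous:
  fixes S :: "real \<Rightarrow> real"
  assumes L: "L > 0" and lip: "L-lipschitz_on UNIV S"
  defines "F \<equiv> (\<lambda>x. L * x + S x)"
  shows "absolutely_continuous lborel (interval_measure F)"
    and "\<And>x y. x \<le> y \<Longrightarrow> F x \<le> F y" and "continuous_on UNIV F"
proof -
  \<comment> \<open>Both \<open>F\<close> and its mirror image \<open>H\<close> are nondecreasing,
    and their Stieltjes measures add up to \<open>2 * L\<close> times Lebesgue measure. Hence a
    Lebesgue null set is null for each of them, which is how the Lipschitz bound yields absolute
    continuity.\<close>
  define H where "H = (\<lambda>x. L * x - S x)"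
  have diff: "\<bar>S y - S x\<bar> \<le> L * (y - x)" if "x \<le> y" for x y
    using lipschitz_onD[OF lip, of y x] that by (simp add: dist_real_def)
  have S: "continuous_on UNIV S"
    using lip by (rule lipschitz_on_continuous_on)
  show F_mono: "F x \<le> F y" if "x \<le> y" for x y
    using diff[OF that] by (simp add: F_def algebra_simps)
  have H_mono: "H x \<le> H y" if "x \<le> y" for x y
    using diff[OF that] by (simp add: H_def algebra_simps)
  show F_cont: "continuous_on UNIV F"
    unfolding F_def by (intro continuous_intros S)
  have H_cont: "continuous_on UNIV H"
    unfolding H_def by (intro continuous_intros S)
  \<comment> \<open>Lebesgue measure is characterised below by its values on open boxes, whereas
    Stieltjes measures are given on half-open intervals; continuity makes the extra endpoint
    null.\<close>
  have Ioo: "emeasure (interval_measure f) {a<..<b} = ennreal (f b - f a)"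
    if mono: "\<And>x y. x \<le> y \<Longrightarrow> f x \<le> f y" and "continuous_on UNIV f" and "a \<le> b"
    for f :: "real \<Rightarrow> real" and a b
  proof (cases "a = b")
    case False
    have "emeasure (interval_measure f) ({a<..<b} \<union> {b..b})
        = emeasure (interval_measure f) {a<..<b} + emeasure (interval_measure f) {b..b}"
      by (rule plus_emeasure[symmetric]) auto
    moreover have "emeasure (interval_measure f) {b..b} = 0"
      using emeasure_interval_measure_Icc[of b b f] that
      by (simp add: continuous_on_eq_continuous_at) 
    moreover have "{a<..<b} \<union> {b..b} = {a<..b}" using False that(3) by auto
    moreover have "emeasure (interval_measure f) {a<..b} = ennreal (f b - f a)"
      using that by (intro emeasure_interval_measure_Ioc)
        (auto intro: continuous_within_subset simp: continuous_on_eq_continuous_at continuous_at_imp_continuous_at_within)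
    ultimately show ?thesis by simp
  qed auto
  define Q where "Q = measure_of UNIV (sets borel)
     (\<lambda>A. ennreal (1 / (2 * L)) * (emeasure (interval_measure F) A + emeasure (interval_measure H) A))"
  have Q: "emeasure Q A = ennreal (1 / (2 * L)) *
      (emeasure (interval_measure F) A + emeasure (interval_measure H) A)" if "A \<in> sets borel" for A
    unfolding Q_def
  proof (rule emeasure_measure_of_sigma)
    show "sigma_algebra UNIV (sets (borel::real measure))"
      by (metis sets.sigma_algebra_axioms space_borel)
    show "countably_additive (sets borel)
       (\<lambda>A. ennreal (1 / (2 * L)) * (emeasure (interval_measure F) A + emeasure (interval_measure H) A))"
    proof (rule countably_additiveI)
      fix A :: "nat \<Rightarrow> real set"
      assume A: "range A \<subseteq> sets borel" "disjoint_family A"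
      have "(\<Sum>i. emeasure (interval_measure f) (A i)) = emeasure (interval_measure f) (\<Union> (range A))" for f
        using A by (intro suminf_emeasure) auto
      then show "(\<Sum>i. ennreal (1 / (2 * L)) * (emeasure (interval_measure F) (A i) + emeasure (interval_measure H) (A i)))
       = ennreal (1 / (2 * L)) * (emeasure (interval_measure F) (\<Union> (range A)) + emeasure (interval_measure H) (\<Union> (range A)))"
        by (subst ennreal_suminf_cmult, subst suminf_add[symmetric]) auto
    qed
  qed (use that in \<open>auto simp: positive_def\<close>)
  have "lborel = Q"
  proof (rule lborel_eqI)
    fix l u :: real assume "\<And>b. b \<in> Basis \<Longrightarrow> l \<bullet> b \<le> u \<bullet> b"
    then have lu: "l \<le> u" by simp
    have "emeasure Q {l<..<u} = ennreal (1 / (2 * L)) * (ennreal (F u - F l) + ennreal (H u - H l))"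
      using lu by (simp add: Q Ioo[OF F_mono F_cont] Ioo[OF H_mono H_cont])
    also have "\<dots> = ennreal (1 / (2 * L)) * ennreal (2 * L * (u - l))"
      using F_mono[OF lu] H_mono[OF lu]
      by (subst ennreal_plus[symmetric]) (auto simp: F_def H_def algebra_simps)
    also have "\<dots> = ennreal (u - l)"
      using L lu by (subst ennreal_mult[symmetric]) auto
    finally show "emeasure Q (box l u) = ennreal (\<Prod>b\<in>Basis. (u - l) \<bullet> b)" by simp
  qed (simp add: Q_def sets.sigma_sets_eq[of borel, simplified])
  then have lb: "emeasure lborel A = ennreal (1 / (2 * L)) *
      (emeasure (interval_measure F) A + emeasure (interval_measure H) A)" if "A \<in> sets borel" for A
    using Q[OF that] by simp
  show "absolutely_continuous lborel (interval_measure F)"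
    unfolding absolutely_continuous_def
    using lb L by (auto simp: null_sets_def ennreal_zero_less_divide add_eq_0_iff_both_eq_0)
qed

text \<open>The function \<open>\<psi>\<close> is the Radon-Nikodym density of the Stieltjes measure
  of \<open>K * x + S x\<close>, minus \<open>K\<close>. The constant is \<open>L + 1\<close>
  because \<open>L\<close> may be 0 and a positive slope is required.\<close>

lemma lipschitz_real_integral:
  fixes S :: "real \<Rightarrow> real"
  assumes lip: "L-lipschitz_on UNIV S"
  obtains \<psi> where "\<And>a b. a \<le> b \<Longrightarrow> (\<psi> has_integral (S b - S a)) {a..b}"
proof -
  define K where "K = L + 1"
  have K: "K > 0" using lipschitz_on_nonneg[OF lip] by (simp add: K_def)
  have lipK: "K-lipschitz_on UNIV S" by (rule lipschitz_on_le[OF lip]) (simp add: K_def)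
  define F where "F = (\<lambda>x. K * x + S x)"
  have F: "absolutely_continuous lborel (interval_measure F)"
    unfolding F_def by (rule lipschitz_real_absolutely_continuous(1)[OF K lipK])
  have F_mono: "F x \<le> F y" if "x \<le> y" for x y
    unfolding F_def by (rule lipschitz_real_absolutely_continuous(2)[OF K lipK that])
  have F_cont: "continuous_on UNIV F"
    unfolding F_def by (rule lipschitz_real_absolutely_continuous(3)[OF K lipK])
  obtain f where f: "f \<in> borel_measurable lborel" "density lborel f = interval_measure F"
    using sigma_finite_measure.Radon_Nikodym[OF lborel.sigma_finite_measure_axioms F] by auto
  have nn: "(\<integral>\<^sup>+ x. f x * indicator {a..b} x \<partial>lborel) = ennreal (F b - F a)" if "a \<le> b" for a b
  proof -
    have "emeasure (interval_measure F) {a..b} = ennreal (F b - F a)"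
      using that F_cont by (intro emeasure_interval_measure_Icc F_mono) (auto intro: continuous_on_subset)
    then have "emeasure (density lborel f) {a..b} = ennreal (F b - F a)"
      by (simp only: f(2))
    then show ?thesis using f(1) by (simp add: emeasure_density)
  qed
  have int: "((\<lambda>x. enn2real (f x)) has_integral (F b - F a)) {a..b}" if ab: "a \<le> b" for a b
  proof -
    have "AE x in lborel. f x * indicator {a..b} x \<noteq> \<infinity>"
      using nn[OF ab] f(1) by (intro nn_integral_PInf_AE) auto
    then have "(\<integral>\<^sup>+ x. ennreal (enn2real (f x) * indicator {a..b} x) \<partial>lborel)
          = (\<integral>\<^sup>+ x. f x * indicator {a..b} x \<partial>lborel)"
      by (intro nn_integral_cong_AE) (auto simp: indicator_def top.not_eq_extremum)
    then have "((\<lambda>x. enn2real (f x) * indicator {a..b} x) has_integral (F b - F a)) UNIV"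
      using nn[OF ab] F_mono[OF ab] f(1) by (intro nn_integral_has_integral) auto
    moreover have "(\<lambda>x. enn2real (f x) * indicator {a..b} x) = (\<lambda>x. if x \<in> {a..b} then enn2real (f x) else 0)"
      by auto
    ultimately show ?thesis by (simp only: has_integral_restrict_UNIV)
  qed
  show ?thesis
  proof (rule that)
    fix a b :: real assume ab: "a \<le> b"
    have "((\<lambda>x. enn2real (f x) - K) has_integral (F b - F a) - K * (b - a)) {a..b}"
      using has_integral_diff[OF int[OF ab] has_integral_const_real[of K a b]] ab by (simp add: mult.commute)
    then show "((\<lambda>x. enn2real (f x) - K) has_integral (S b - S a)) {a..b}"
      by (simp add: F_def algebra_simps)
  qed
qed

text \<open>Lebesgue differentiation along the intervals from \<open>x\<close> to
  \<open>x + h\<close>. Only \<open>h > 0\<close> is covered; the left derivative is obtained later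
  by applying this to the reflected function \<open>- S (- x)\<close>.\<close>

lemma integral_AE_right_derivative:
  fixes S \<psi> :: "real \<Rightarrow> real"
  assumes "\<And>a b. a \<le> b \<Longrightarrow> (\<psi> has_integral (S b - S a)) {a..b}"
  obtains N where "negligible N"
    "\<And>x. x \<notin> N \<Longrightarrow> ((\<lambda>h. (S (x + h) - S x) / h) \<longlongrightarrow> \<psi> x) (at_right 0)"
proof -
  have "\<psi> integrable_on cbox a b" for a b
    using assms[of a b] by (cases "a \<le> b") (auto simp: integrable_on_def)
  then obtain N where N: "negligible N"
     "\<And>x e. \<lbrakk>x \<notin> N; 0 < e\<rbrakk> \<Longrightarrow> \<exists>d>0. \<forall>h. 0 < h \<and> h < d \<longrightarrow>
          norm (integral (cbox x (x + h *\<^sub>R One)) \<psi> /\<^sub>R h ^ DIM(real) - \<psi> x) < e"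
    using integrable_ccontinuous_explicit[of \<psi>] by metis
  show ?thesis
  proof (rule that[OF N(1)])
    fix x assume x: "x \<notin> N"
    show "((\<lambda>h. (S (x + h) - S x) / h) \<longlongrightarrow> \<psi> x) (at_right 0)"
      unfolding tendsto_iff
    proof safe
      fix e :: real assume "e > 0"
      from N(2)[OF x this] obtain d where d: "d > 0" 
        "\<And>h. 0 < h \<Longrightarrow> h < d \<Longrightarrow> norm (integral (cbox x (x + h *\<^sub>R One)) \<psi> /\<^sub>R h ^ DIM(real) - \<psi> x) < e"
        by blast
      have "integral (cbox x (x + h *\<^sub>R One)) \<psi> = S (x + h) - S x" if "h > 0" for h
        using assms[of x "x + h"] that by (auto intro!: integral_unique)
      with d show "\<forall>\<^sub>F h in at_right 0. dist ((S (x + h) - S x) / h) (\<psi> x) < e"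
        unfolding eventually_at_right_field
        by (intro exI[of _ d]) (auto simp: dist_real_def divide_inverse mult.commute)
    qed
  qed
qed

text \<open>Rademacher's theorem on the line, with the derivative identified as the density whose
  integrals are the increments of \<open>S\<close>. Off a null set, both one-sided difference
  quotients tend to \<open>\<psi> x\<close>, the left one by reflection.\<close>

theorem lipschitz_real_AE_derivative:
  fixes S :: "real \<Rightarrow> real"
  assumes lip: "L-lipschitz_on UNIV S"
  obtains \<psi> N where "\<And>a b. a \<le> b \<Longrightarrow> (\<psi> has_integral (S b - S a)) {a..b}"
    "negligible N" "\<And>x. x \<notin> N \<Longrightarrow> (S has_real_derivative \<psi> x) (at x)"
proof -
  obtain \<psi> where \<psi>: "\<And>a b. a \<le> b \<Longrightarrow> (\<psi> has_integral (S b - S a)) {a..b}"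
    using lipschitz_real_integral[OF lip] by blast
  obtain N1 where N1: "negligible N1"
    "\<And>x. x \<notin> N1 \<Longrightarrow> ((\<lambda>h. (S (x + h) - S x) / h) \<longlongrightarrow> \<psi> x) (at_right 0)"
    using integral_AE_right_derivative[OF \<psi>] by blast
  have \<psi>': "((\<lambda>x. \<psi> (- x)) has_integral ((\<lambda>x. - S (- x)) b - (\<lambda>x. - S (- x)) a)) {a..b}" if "a \<le> b" for a b
    using \<psi>[of "-b" "-a"] that by (subst has_integral_reflect_real[symmetric]) simp_all
  obtain N2 where N2: "negligible N2"
    "\<And>x. x \<notin> N2 \<Longrightarrow> ((\<lambda>h. (- S (- (x + h)) - - S (- x)) / h) \<longlongrightarrow> \<psi> (- x)) (at_right 0)"
    using integral_AE_right_derivative[OF \<psi>'] by blast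
  have "negligible (uminus ` N2)"
    using N2(1) by (intro negligible_differentiable_image_negligible) (auto intro!: derivative_intros)
  then have N: "negligible (N1 \<union> uminus ` N2)" using N1(1) by simp
  show ?thesis
  proof (rule that[OF \<psi> N])
    fix x assume x: "x \<notin> N1 \<union> uminus ` N2"
    then have "- x \<notin> N2" by force
    have "(- S (- (- x + h)) - - S (- (- x))) / h = (S (x + - h) - S x) / - h" for h
      by (cases "h = 0") (simp_all add: divide_simps)
    with N2(2)[OF \<open>- x \<notin> N2\<close>] have "((\<lambda>h. (S (x + - h) - S x) / - h) \<longlongrightarrow> \<psi> x) (at_right 0)"
      by (simp only: minus_minus)
    then have "((\<lambda>h. (S (x + h) - S x) / h) \<longlongrightarrow> \<psi> x) (at_left 0)"
      by (simp add: filterlim_at_left_to_right)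
    with N1(2) x have "((\<lambda>h. (S (x + h) - S x) / h) \<longlongrightarrow> \<psi> x) (at 0)"
      by (intro filterlim_split_at) auto
    then show "(S has_real_derivative \<psi> x) (at x)" by (simp add: DERIV_def)
  qed
qed

lemma lipschitz_real_FTC:
  fixes f :: "real \<Rightarrow> real"
  assumes ab: "a \<le> b" and lip: "L-lipschitz_on {a..b} f" and N: "negligible N"
    and f': "\<And>x. x \<in> {a<..<b} - N \<Longrightarrow> (f has_real_derivative f' x) (at x)"
  shows "(f' has_integral (f b - f a)) {a..b}"
proof -
  \<comment> \<open>Clamping the argument extends \<open>f\<close> from the interval to a Lipschitz
    function on the line without changing it inside. There the given derivative and the density
    found for the extension agree off a null set, since derivatives are unique.\<close>
  define c where "c = (\<lambda>x. max a (min b x))"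
  have c: "1-lipschitz_on UNIV c" by (rule lipschitz_onI) (auto simp: c_def dist_real_def)
  have c_in: "c ` UNIV \<subseteq> {a..b}" using ab by (auto simp: c_def)
  have "(L*1)-lipschitz_on UNIV (f \<circ> c)"
    by (rule lipschitz_on_compose[OF c lipschitz_on_subset[OF lip c_in]])
  then obtain \<psi> M where \<psi>: "\<And>a b. a \<le> b \<Longrightarrow> (\<psi> has_integral ((f \<circ> c) b - (f \<circ> c) a)) {a..b}"
    "negligible M" "\<And>x. x \<notin> M \<Longrightarrow> ((f \<circ> c) has_real_derivative \<psi> x) (at x)"
    by (rule lipschitz_real_AE_derivative) blast
  have "negligible (N \<union> M \<union> {a, b})" using N \<psi>(2) by simp
  moreover have "f' x = \<psi> x" if x: "x \<in> {a..b} - (N \<union> M \<union> {a,b})" for x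
  proof -
    have "(f has_real_derivative \<psi> x) (at x)"
    proof (rule has_field_derivative_transform_within_open[OF \<psi>(3)])
      show "open {a<..<b}" "x \<in> {a<..<b}" using x by auto
    qed (use x in \<open>auto simp: c_def\<close>)
    with f'[of x] x show ?thesis by (auto intro: DERIV_unique)
  qed
  ultimately have "(f' has_integral ((f \<circ> c) b - (f \<circ> c) a)) {a..b}"
    by (rule has_integral_spike[OF _ _ \<psi>(1)[OF ab]])
  then show ?thesis using ab by (simp add: c_def)
qed

lemma lipschitz_complex_FTC:
  fixes f :: "real \<Rightarrow> complex"
  assumes ab: "a \<le> b" and lip: "L-lipschitz_on {a..b} f" and N: "negligible N"
    and f': "\<And>x. x \<in> {a<..<b} - N \<Longrightarrow> (f has_vector_derivative f' x) (at x)"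
  shows "(f' has_integral (f b - f a)) {a..b}"
proof -
  have "L-lipschitz_on {a..b} (\<lambda>x. Re (f x))" "L-lipschitz_on {a..b} (\<lambda>x. Im (f x))"
    using lip unfolding lipschitz_on_def dist_norm
    by (auto simp flip: minus_complex.sel intro: order_trans[OF abs_Re_le_cmod] order_trans[OF abs_Im_le_cmod])
  then have "((\<lambda>x. Re (f' x)) has_integral (Re (f b) - Re (f a))) {a..b}"
    "((\<lambda>x. Im (f' x)) has_integral (Im (f b) - Im (f a))) {a..b}"
    by (auto intro!: lipschitz_real_FTC[OF ab _ N] bounded_linear.has_vector_derivative[OF bounded_linear_Re] bounded_linear.has_vector_derivative[OF bounded_linear_Im] f'
        simp: has_real_derivative_iff_has_vector_derivative)
  then have "((\<lambda>x. complex_of_real (Re (f' x)) + \<i> * complex_of_real (Im (f' x))) has_integral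
      complex_of_real (Re (f b) - Re (f a)) + \<i> * complex_of_real (Im (f b) - Im (f a))) {a..b}"
    by (intro has_integral_add has_integral_mult_right has_integral_of_real)
  moreover have "complex_of_real (Re z - Re w) + \<i> * complex_of_real (Im z - Im w) = z - w" for z w
    by (simp add: complex_eq_iff)
  ultimately show ?thesis by (simp flip: complex_eq)
qed

subsection \<open>Residues and Lipschitz contours\<close>

lemma lipschitz_on_graph:
  assumes "L-lipschitz_on UNIV S"
  shows "(L + 1)-lipschitz_on X (\<lambda>t. Complex (S t) t)"
proof (rule lipschitz_onI)
  fix s t
  have "dist (Complex (S s) s) (Complex (S t) t) \<le> \<bar>S s - S t\<bar> + \<bar>s - t\<bar>"
    unfolding dist_norm using cmod_le[of "Complex (S s) s - Complex (S t) t"] by simp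
  also have "\<dots> \<le> L * \<bar>s - t\<bar> + \<bar>s - t\<bar>"
    using lipschitz_onD[OF assms, of s t] by (simp add: dist_real_def)
  finally show "dist (Complex (S s) s) (Complex (S t) t) \<le> (L + 1) * dist s t"
    by (simp add: dist_real_def algebra_simps)
qed (use lipschitz_on_nonneg[OF assms] in simp)

text \<open>On a convex open set \<open>f\<close> has a primitive, and the primitive along the
  screen is again Lipschitz. The fundamental theorem for Lipschitz functions then evaluates the
  screen integral to the same difference of endpoint values as the integral along the chord.\<close>

lemma screen_integrand_has_integral_convex:
  assumes lip: "L-lipschitz_on UNIV S" and ab: "a \<le> b"
    and B: "open B" "convex B" and f: "f holomorphic_on B"
    and in_B: "\<And>t. t \<in> {a..b} \<Longrightarrow> Complex (S t) t \<in> B"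
  shows "(screen_integrand S f has_integral
      contour_integral (linepath (Complex (S a) a) (Complex (S b) b)) f) {a..b}"
proof -
  define \<gamma> where "\<gamma> = (\<lambda>t. Complex (S t) t)"
  have lip\<gamma>: "(L + 1)-lipschitz_on X \<gamma>" for X
    unfolding \<gamma>_def by (rule lipschitz_on_graph[OF lip])
  obtain F where F: "\<And>x. x \<in> B \<Longrightarrow> (F has_field_derivative f x) (at x)"
    using holomorphic_convex_primitive'[OF B(2,1) f] B(1) by (metis at_within_open)
  \<comment> \<open>Compactness bounds \<open>f\<close> on the hull, and convexity turns this bound
    on the derivative into a Lipschitz constant for the primitive.\<close>
  define K where "K = convex hull (\<gamma> ` {a..b})"
  have K: "compact K" "convex K"
    using lipschitz_on_continuous_on[OF lip\<gamma>] unfolding K_def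
    by (auto intro!: compact_convex_hull compact_continuous_image)
  have "K \<subseteq> B"
    unfolding K_def using in_B B(2) by (intro hull_minimal) (auto simp: \<gamma>_def)
  note K = K this
  have "bounded (f ` K)"
    using K by (intro compact_imp_bounded compact_continuous_image holomorphic_on_imp_continuous_on
        holomorphic_on_subset[OF f])
  then obtain M where M: "M > 0" "\<And>z. z \<in> K \<Longrightarrow> norm (f z) \<le> M"
    by (auto simp: bounded_pos)
  have "M-lipschitz_on K F"
  proof (rule lipschitz_onI)
    fix x y assume "x \<in> K" "y \<in> K"
    then show "dist (F x) (F y) \<le> M * dist x y" unfolding dist_norm
      using K M by (intro field_differentiable_bound[OF K(2), of F f])
        (auto intro: DERIV_subset[OF F])
  qed (use M in simp)
  then have lipF: "(M * (L + 1))-lipschitz_on {a..b} (F \<circ> \<gamma>)"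
    by (rule lipschitz_on_compose[OF lip\<gamma> lipschitz_on_subset]) (simp add: K_def hull_subset)
  obtain \<psi> N where N: "negligible N" "\<And>x. x \<notin> N \<Longrightarrow> (S has_real_derivative \<psi> x) (at x)"
    by (rule lipschitz_real_AE_derivative[OF lip]) blast
  have "(screen_integrand S f has_integral ((F \<circ> \<gamma>) b - (F \<circ> \<gamma>) a)) {a..b}"
  proof (rule lipschitz_complex_FTC[OF ab lipF N(1)])
    fix x assume x: "x \<in> {a<..<b} - N"
    then have "(S has_real_derivative deriv S x) (at x)"
      using N(2)[of x] DERIV_imp_deriv[OF N(2)[of x]] by simp
    then have "((\<lambda>t. complex_of_real (S t)) has_vector_derivative of_real (deriv S x)) (at x)"
      by (rule has_vector_derivative_of_real)
    moreover have "((\<lambda>t. complex_of_real t) has_vector_derivative of_real 1) (at x)"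
      by (rule has_vector_derivative_of_real) (rule DERIV_ident)
    ultimately have "((\<lambda>t. of_real (S t) + of_real t * \<i>) has_vector_derivative of_real (deriv S x) + of_real 1 * \<i>) (at x)"
      by (intro has_vector_derivative_add has_vector_derivative_mult_left)
    then have "(\<gamma> has_vector_derivative of_real (deriv S x) + \<i>) (at x)"
      by (simp add: \<gamma>_def Complex_eq mult.commute)
    moreover have "(F has_field_derivative f (\<gamma> x)) (at (\<gamma> x))"
      using x by (intro F) (auto simp: \<gamma>_def in_B)
    ultimately show "((F \<circ> \<gamma>) has_vector_derivative screen_integrand S f x) (at x)"
      unfolding screen_integrand_def \<gamma>_def[symmetric]
      by (subst mult.commute) (simp only: field_vector_diff_chain_at \<gamma>_def)
  qed
  moreover have "contour_integral (linepath (\<gamma> a) (\<gamma> b)) f = F (\<gamma> b) - F (\<gamma> a)"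
  proof -
    have "closed_segment (\<gamma> a) (\<gamma> b) \<subseteq> B"
      using in_B[of a] in_B[of b] ab B(2) by (intro closed_segment_subset) (auto simp: \<gamma>_def)
    then have "(f has_contour_integral F (pathfinish (linepath (\<gamma> a) (\<gamma> b))) - F (pathstart (linepath (\<gamma> a) (\<gamma> b))))
       (linepath (\<gamma> a) (\<gamma> b))"
      by (intro contour_integral_primitive[where S = B])
         (simp_all add: F has_field_derivative_at_within)
    then show ?thesis by (simp add: contour_integral_unique)
  qed
  ultimately show ?thesis by (simp add: \<gamma>_def)
qed

text \<open>The library integrates only over piecewise differentiable paths, so a stretch of the screen is
  replaced by a polygon over which every holomorphic function has the same integral.\<close>

lemma screen_polygon:
  assumes lip: "L-lipschitz_on UNIV S" and "a \<le> b" and X: "open X"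
    and "\<And>t. t \<in> {a..b} \<Longrightarrow> Complex (S t) t \<in> X"
  obtains p where "valid_path p" "path_image p \<subseteq> X"
    "pathstart p = Complex (S a) a" "pathfinish p = Complex (S b) b"
    "\<And>f. f holomorphic_on X \<Longrightarrow> (screen_integrand S f has_integral contour_integral p f) {a..b}"
proof -
  define \<gamma> where "\<gamma> = (\<lambda>t. Complex (S t) t)"
  define good where "good = (\<lambda>a b p. valid_path p \<and> path_image p \<subseteq> X \<and> pathstart p = \<gamma> a \<and> pathfinish p = \<gamma> b \<and>
     (\<forall>f. f holomorphic_on X \<longrightarrow> (screen_integrand S f has_integral contour_integral p f) {a..b}))"
  have "\<gamma> ` {a..b} \<subseteq> X \<longrightarrow> a \<le> b \<longrightarrow> (\<exists>p. good a b p)"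
    using \<open>a \<le> b\<close>
  \<comment> \<open>A property that passes to unions of adjacent intervals and holds on all short
    intervals around each point holds on the whole interval. Near a point a single chord inside a
    ball contained in \<open>X\<close> suffices; adjacent intervals concatenate their paths.\<close>
  proof (induction rule: Bolzano)
    case (trans a b c)
    show ?case
    proof (intro impI)
      assume "\<gamma> ` {a..c} \<subseteq> X" "a \<le> c"
      then obtain p q where p: "good a b p" and q: "good b c q"
        using trans by (meson atLeastatMost_subset_iff image_mono order_refl order_trans)
      have "good a c (p +++ q)"
        unfolding good_def
      proof (intro conjI allI impI)
        fix f assume f: "f holomorphic_on X"
        have "f contour_integrable_on p" "f contour_integrable_on q"
          using p q f X unfolding good_def by (auto intro!: contour_integrable_holomorphic_simple)
        then have "contour_integral (p +++ q) f = contour_integral p f + contour_integral q f"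
          using p q unfolding good_def by (intro contour_integral_join) auto
        then show "(screen_integrand S f has_integral contour_integral (p +++ q) f) {a..c}"
          using p q f trans(3,4) unfolding good_def by (auto intro!: has_integral_combine)
      qed (use p q in \<open>auto simp: good_def path_image_join\<close>)
      then show "\<exists>p. good a c p" by blast
    qed
  next
    case (local x)
    have "\<gamma> x \<in> X" using assms(4)[of x] local by (simp add: \<gamma>_def)
    then obtain e where e: "e > 0" "ball (\<gamma> x) e \<subseteq> X" using X open_contains_ball by blast
    have "isCont \<gamma> x"
      using lipschitz_on_continuous_on[OF lipschitz_on_graph[OF lip, of UNIV]]
      by (simp add: \<gamma>_def continuous_on_eq_continuous_at)
    then obtain d where d: "d > 0" "\<And>t. dist t x < d \<Longrightarrow> dist (\<gamma> t) (\<gamma> x) < e"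
      using e(1) unfolding continuous_at_eps_delta by blast
    show ?case
    proof (intro exI[of _ d] conjI allI impI d(1))
      fix a b assume *: "a \<le> x \<and> x \<le> b \<and> b - a < d" and "a \<le> b"
      have in_ball: "\<gamma> t \<in> ball (\<gamma> x) e" if "t \<in> {a..b}" for t
        using d(2)[of t] that * by (auto simp: dist_real_def dist_commute)
      have "good a b (linepath (\<gamma> a) (\<gamma> b))"
        unfolding good_def
      proof (intro conjI allI impI)
        show "path_image (linepath (\<gamma> a) (\<gamma> b)) \<subseteq> X"
          using in_ball[of a] in_ball[of b] \<open>a \<le> b\<close> e(2) closed_segment_subset[OF _ _ convex_ball]
          by (metis atLeastAtMost_iff order_refl order_trans path_image_linepath)
      next
        fix f assume "f holomorphic_on X"
        then show "(screen_integrand S f has_integral contour_integral (linepath (\<gamma> a) (\<gamma> b)) f) {a..b}"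
          unfolding \<gamma>_def using in_ball e(2) \<open>a \<le> b\<close>
          by (intro screen_integrand_has_integral_convex[OF lip, where B = "ball (\<gamma> x) e"])
             (auto intro: holomorphic_on_subset simp: \<gamma>_def)
      qed auto
      then show "\<exists>p. good a b p" by blast
    qed
  qed
  then show ?thesis
    using that assms(2,4) unfolding good_def \<gamma>_def by blast
qed

section \<open>Logarithms on slit planes and winding numbers\<close>

lemma open_Compl_horizontal_ray:
  "open {z. \<not> (Im z = Im p \<and> Re z \<le> Re p)}" "open {z. \<not> (Im z = Im p \<and> Re z \<ge> Re p)}"
proof -
  have "closed {z. Im z = Im p \<and> Re z \<le> Re p}" "closed {z. Im z = Im p \<and> Re z \<ge> Re p}"
    by (intro closed_Collect_conj closed_Collect_eq closed_Collect_le continuous_intros)+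
  then show "open {z. \<not> (Im z = Im p \<and> Re z \<le> Re p)}" "open {z. \<not> (Im z = Im p \<and> Re z \<ge> Re p)}"
    using Collect_neg_eq[of "\<lambda>z. Im z = Im p \<and> Re z \<le> Re p"]
      Collect_neg_eq[of "\<lambda>z. Im z = Im p \<and> Re z \<ge> Re p"] by (metis open_Compl)+
qed

text \<open>\<open>Ln (z - p)\<close> is a primitive off the ray that leaves \<open>p\<close> to the
  left; the companion result uses \<open>Ln (p - z)\<close> off the opposite ray. The two branches
  together give the winding numbers of the contour below.\<close>

lemma has_contour_integral_inverse_left_slit:
  assumes "valid_path q" and "\<And>z. z \<in> path_image q \<Longrightarrow> \<not> (Im z = Im p \<and> Re z \<le> Re p)"
  shows "((\<lambda>z. 1 / (z - p)) has_contour_integral (Ln (pathfinish q - p) - Ln (pathstart q - p))) q"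
proof (rule contour_integral_primitive[where S = "path_image q"])
  fix z assume "z \<in> path_image q"
  then have "z - p \<notin> \<real>\<^sub>\<le>\<^sub>0" using assms(2)[of z] by (auto simp: complex_nonpos_Reals_iff)
  then show "((\<lambda>z. Ln (z - p)) has_field_derivative 1 / (z - p)) (at z within path_image q)"
    by (auto intro!: derivative_eq_intros simp: divide_inverse)
qed (use assms in auto)

lemma has_contour_integral_inverse_right_slit:
  assumes "valid_path q" and "\<And>z. z \<in> path_image q \<Longrightarrow> \<not> (Im z = Im p \<and> Re z \<ge> Re p)"
  shows "((\<lambda>z. 1 / (z - p)) has_contour_integral (Ln (p - pathfinish q) - Ln (p - pathstart q))) q"
proof (rule contour_integral_primitive[where S = "path_image q"])
  fix z assume "z \<in> path_image q"
  then have "p - z \<notin> \<real>\<^sub>\<le>\<^sub>0" "z \<noteq> p" using assms(2)[of z] by (auto simp: complex_nonpos_Reals_iff)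
  then show "((\<lambda>z. Ln (p - z)) has_field_derivative 1 / (z - p)) (at z within path_image q)"
    by (auto intro!: derivative_eq_intros simp: field_simps)
qed (use assms in auto)

text \<open>The contour goes up the line \<open>Re = c\<close>, along height \<open>b\<close> to the
  screen, down the screen, and back along height \<open>a\<close>. The screen is replaced by a
  polygon inside an open set that avoids one horizontal ray per singularity, so that the winding
  numbers follow from logarithms without any Jordan curve argument.\<close>

theorem screen_residue_theorem:
  assumes lip: "L-lipschitz_on UNIV S" and ab: "a < b"
    and R: "open R" "convex R" and Q: "finite Q" and f: "f holomorphic_on R - Q"
    and S_R: "\<And>t. t \<in> {a..b} \<Longrightarrow> Complex (S t) t \<in> R"
    and c_R: "Complex c a \<in> R" "Complex c b \<in> R"
    and sing: "\<And>p. p \<in> Q \<Longrightarrow> Re p < c \<and> Re p \<noteq> S (Im p) \<and> Im p \<noteq> a \<and> Im p \<noteq> b"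
  shows "(screen_integrand S f has_integral
     (contour_integral (linepath (Complex c a) (Complex c b)) f
      + contour_integral (linepath (Complex c b) (Complex (S b) b)) f
      - contour_integral (linepath (Complex c a) (Complex (S a) a)) f
      - 2 * pi * \<i> * (\<Sum>p\<in>{p \<in> Q. a < Im p \<and> Im p < b \<and> S (Im p) < Re p}. residue f p))) {a..b}"
proof -
  define inner where "inner = {p \<in> Q. a < Im p \<and> Im p < b \<and> S (Im p) < Re p}"
  \<comment> \<open>Singularities to the right of the screen, at heights strictly between
    \<open>a\<close> and \<open>b\<close>, exclude their rightward ray, all others their leftward
    ray. Since the screen has one point at each height, its stretch over \<open>{a..b}\<close> meets
    none of these rays.\<close>
  define H where "H = (\<lambda>p. if p \<in> inner then {z. \<not> (Im z = Im p \<and> Re z \<ge> Re p)}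
      else {z. \<not> (Im z = Im p \<and> Re z \<le> Re p)})"
  define X where "X = R \<inter> (\<Inter>p\<in>Q. H p)"
  have X_iff: "z \<in> X \<longleftrightarrow> z \<in> R \<and> (\<forall>p\<in>Q. z \<in> H p)" for z
    by (simp add: X_def)
  have "open (H p)" for p
    using open_Compl_horizontal_ray[of p] unfolding H_def by (cases "p \<in> inner") simp_all
  then have "open X"
    unfolding X_def using Q R(1) by (intro open_Int open_INT) auto
  have "p \<notin> H p" for p
    by (simp add: H_def)
  then have X_sub: "X \<subseteq> R - Q"
    using X_iff by blast
  have X_inner: "\<not> (Im z = Im p \<and> Re z \<ge> Re p)" if "z \<in> X" "p \<in> Q" "p \<in> inner" for z p
    using that(1)[unfolded X_iff] that(2,3) by (auto simp: H_def)
  have X_outer: "\<not> (Im z = Im p \<and> Re z \<le> Re p)" if "z \<in> X" "p \<in> Q" "p \<notin> inner" for z p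
    using that(1)[unfolded X_iff] that(2,3) by (auto simp: H_def)
  have S_X: "Complex (S t) t \<in> X" if t: "t \<in> {a..b}" for t
    unfolding X_iff
  proof (intro conjI ballI S_R[OF t])
    fix p assume p: "p \<in> Q"
    show "Complex (S t) t \<in> H p"
      using t p sing[OF p] by (cases "t = Im p") (auto simp: H_def inner_def)
  qed
  obtain P where P: "valid_path P" "path_image P \<subseteq> X"
    "pathstart P = Complex (S a) a" "pathfinish P = Complex (S b) b"
    "\<And>f. f holomorphic_on X \<Longrightarrow> (screen_integrand S f has_integral contour_integral P f) {a..b}"
    using screen_polygon[OF lip _ \<open>open X\<close> S_X] ab by (metis less_imp_le)
  define E1 where "E1 = linepath (Complex c a) (Complex c b)"
  define E2 where "E2 = linepath (Complex c b) (Complex (S b) b)"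
  define E4 where "E4 = linepath (Complex (S a) a) (Complex c a)"
  define q where "q = E2 +++ reversepath P +++ E4"
  have seg: "Im z = Im u" if "z \<in> closed_segment u v" "Im u = Im v" for z u v
  proof -
    obtain t where "z = (1 - t) *\<^sub>R u + t *\<^sub>R v" using \<open>z \<in> closed_segment u v\<close> by (auto simp: in_segment)
    then show ?thesis using \<open>Im u = Im v\<close> by (simp add: left_diff_distrib)
  qed
  have E1_img: "path_image E1 \<subseteq> {z. Re z = c}"
  proof
    fix z assume "z \<in> path_image E1"
    then obtain t where "z = (1 - t) *\<^sub>R Complex c a + t *\<^sub>R Complex c b"
      by (auto simp: E1_def in_segment)
    then show "z \<in> {z. Re z = c}" by (simp add: left_diff_distrib)
  qed
  have E2_img: "path_image E2 \<subseteq> {z. Im z = b}" and E4_img: "path_image E4 \<subseteq> {z. Im z = a}"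
    by (auto simp: E2_def E4_def dest: seg)
  have E_R: "path_image E1 \<subseteq> R" "path_image E2 \<subseteq> R" "path_image E4 \<subseteq> R"
    unfolding E1_def E2_def E4_def path_image_linepath
    using c_R S_R[of a] S_R[of b] ab R(2) by (simp_all add: closed_segment_subset)
  have E_Q: "path_image E1 \<inter> Q = {}" "path_image E2 \<inter> Q = {}" "path_image E4 \<inter> Q = {}"
    using E1_img E2_img E4_img sing by fastforce+
  have q: "valid_path q" "pathstart q = Complex c b" "pathfinish q = Complex c a"
    using P by (auto simp: q_def E2_def E4_def)
  have q_img: "path_image q = path_image E2 \<union> path_image P \<union> path_image E4"
    using P by (subst q_def, subst path_image_join) (auto simp: E2_def E4_def path_image_join)
  have E1: "valid_path E1" "pathstart E1 = Complex c a" "pathfinish E1 = Complex c b"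
    by (auto simp: E1_def)
  have loop_img: "path_image (E1 +++ q) = path_image E1 \<union> path_image q"
    using E1 q by (intro path_image_join) auto
  have loop_sub: "path_image (E1 +++ q) \<subseteq> R - Q"
    unfolding loop_img q_img using E_R E_Q P(2) X_sub by auto
  have valid: "valid_path (E1 +++ q)" and loop: "pathfinish (E1 +++ q) = pathstart (E1 +++ q)"
    using E1 q by auto
  \<comment> \<open>Outside \<open>inner\<close> the whole loop avoids the leftward ray of
    \<open>p\<close>, so a single branch of the logarithm gives 0. For \<open>p\<close> in
    \<open>inner\<close> no single branch serves: \<open>E1\<close> avoids the leftward ray and
    \<open>q\<close> the rightward one, and the change of branch at each of the two corners on
    \<open>Re = c\<close> contributes \<open>pi * \<i>\<close>.\<close>
  have wind: "winding_number (E1 +++ q) p = (if p \<in> inner then 1 else 0)" if p: "p \<in> Q" for p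
  proof (cases "p \<in> inner")
    case False
    have "\<not> (Im z = Im p \<and> Re z \<le> Re p)" if "z \<in> path_image (E1 +++ q)" for z
    proof -
      from that consider "Re z = c" | "Im z = a" | "Im z = b" | "z \<in> X"
        unfolding loop_img q_img using E1_img E2_img E4_img P(2) by blast
      then show ?thesis
        using sing[OF p] X_outer[OF _ p False] by cases auto
    qed
    from has_contour_integral_inverse_left_slit[OF valid this]
    have "contour_integral (E1 +++ q) (\<lambda>z. 1 / (z - p)) = 0"
      using loop by (simp add: contour_integral_unique)
    then show ?thesis
      using False loop_sub p by (subst winding_number_valid_path[OF valid]) auto
  next
    case True
    have "\<not> (Im z = Im p \<and> Re z \<ge> Re p)" if "z \<in> path_image q" for z
    proof -
      from that consider "Im z = a" | "Im z = b" | "z \<in> X"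
        unfolding q_img using E2_img E4_img P(2) by blast
      then show ?thesis
        using sing[OF p] X_inner[OF _ p True] by cases auto
    qed
    from has_contour_integral_inverse_right_slit[OF q(1) this]
    have iq: "((\<lambda>z. 1 / (z - p)) has_contour_integral (Ln (p - Complex c a) - Ln (p - Complex c b))) q"
      by (simp add: q)
    have "\<not> (Im z = Im p \<and> Re z \<le> Re p)" if "z \<in> path_image E1" for z
      using that E1_img sing[OF p] by fastforce
    from has_contour_integral_inverse_left_slit[OF E1(1) this]
    have "((\<lambda>z. 1 / (z - p)) has_contour_integral (Ln (Complex c b - p) - Ln (Complex c a - p))) E1"
      by (simp add: E1)
    from has_contour_integral_join[OF this iq E1(1) q(1)]
    have int: "contour_integral (E1 +++ q) (\<lambda>z. 1 / (z - p)) =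
        Ln (Complex c b - p) - Ln (Complex c a - p) + (Ln (p - Complex c a) - Ln (p - Complex c b))"
      by (rule contour_integral_unique)
    have "Ln (- z) = Ln z - \<i> * pi" if "Im z > 0" for z
      by (subst Ln_minus) (use that in auto)
    from this[of "Complex c b - p"] this[of "p - Complex c a"] True
    have eqs: "Ln (p - Complex c b) = Ln (Complex c b - p) - \<i> * pi"
      "Ln (Complex c a - p) = Ln (p - Complex c a) - \<i> * pi"
      by (auto simp: inner_def)
    have "contour_integral (E1 +++ q) (\<lambda>z. 1 / (z - p)) = 2 * pi * \<i>"
      unfolding int eqs by (simp add: algebra_simps)
    then show ?thesis
      using True loop_sub p by (subst winding_number_valid_path[OF valid]) auto
  qed
  have "contour_integral (E1 +++ q) f = 2 * pi * \<i> * (\<Sum>p\<in>Q. winding_number (E1 +++ q) p * residue f p)"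
  proof (rule Residue_theorem[OF R(1) convex_connected[OF R(2)] Q f valid loop loop_sub])
    show "\<forall>z. z \<notin> R \<longrightarrow> winding_number (E1 +++ q) z = 0"
      using winding_number_zero_outside[OF valid_path_imp_path[OF valid] R(2) loop] loop_sub by blast
  qed
  also have "(\<Sum>p\<in>Q. winding_number (E1 +++ q) p * residue f p) = (\<Sum>p\<in>inner. residue f p)"
    using Q by (intro sum.mono_neutral_cong_right) (auto simp: wind inner_def)
  finally have res: "contour_integral (E1 +++ q) f = 2 * pi * \<i> * (\<Sum>p\<in>inner. residue f p)" .
  have f_X: "f holomorphic_on X" using f X_sub by (rule holomorphic_on_subset)
  have "open (R - Q)" using R(1) Q by (simp add: finite_imp_closed open_Diff)
  then have ci: "f contour_integrable_on g" if "valid_path g" "path_image g \<subseteq> R - Q" for g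
    using f that by (intro contour_integrable_holomorphic_simple)
  have "f contour_integrable_on E1" "f contour_integrable_on E2" "f contour_integrable_on P"
     "f contour_integrable_on E4"
    using E_R E_Q P(1,2) X_sub E1(1) by (auto intro!: ci simp: E2_def E4_def)
  then have "contour_integral (E1 +++ q) f =
     contour_integral E1 f + (contour_integral E2 f + (- contour_integral P f + contour_integral E4 f))"
    using P(1,3,4) E1 unfolding q_def
    by (simp add: E2_def E4_def contour_integral_reversepath contour_integrable_reversepath
        contour_integrable_joinI)
  moreover have "contour_integral E4 f = - contour_integral (linepath (Complex c a) (Complex (S a) a)) f"
    unfolding E4_def by (metis contour_integral_reversepath reversepath_linepath valid_path_linepath)
  ultimately have "contour_integral P f =
     contour_integral (linepath (Complex c a) (Complex c b)) f
      + contour_integral (linepath (Complex c b) (Complex (S b) b)) f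
      - contour_integral (linepath (Complex c a) (Complex (S a) a)) f
      - 2 * pi * \<i> * (\<Sum>p\<in>inner. residue f p)"
    using res by (simp add: E1_def E2_def algebra_simps)
  then show ?thesis using P(5)[OF f_X] by (simp add: inner_def)
qed

subsection \<open>Perron's integral\<close>

lemma integrable_inverse_one_plus_square: "integrable lborel (\<lambda>x::real. 1 / (1 + x\<^sup>2))"
proof (rule integrableI_bounded)
  have half: "(\<integral>\<^sup>+x. ennreal (1 / (1 + x\<^sup>2)) * indicator {0..} x \<partial>lborel) = ennreal (pi / 2 - arctan 0)"
    by (rule nn_integral_FTC_atLeast[OF _ _ _ tendsto_arctan_at_top])
       (auto simp: DERIV_arctan divide_inverse)
  have "(\<integral>\<^sup>+x. ennreal (1 / (1 + x\<^sup>2)) * indicator {..0} x \<partial>lborel)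
      = (\<integral>\<^sup>+x. ennreal (1 / (1 + x\<^sup>2)) * indicator {0..} x \<partial>lborel)"
    by (subst nn_integral_real_affine[where c = "-1" and t = 0]) (auto simp: indicator_def)
  with half have "(\<integral>\<^sup>+x. ennreal (1 / (1 + x\<^sup>2)) * indicator {0..} x
      + ennreal (1 / (1 + x\<^sup>2)) * indicator {..0} x \<partial>lborel) = ennreal pi"
    by (subst nn_integral_add) (auto simp flip: ennreal_plus)
  moreover have "(\<integral>\<^sup>+x. ennreal (norm (1 / (1 + x\<^sup>2 :: real))) \<partial>lborel)
     \<le> (\<integral>\<^sup>+x. ennreal (1 / (1 + x\<^sup>2)) * indicator {0..} x
      + ennreal (1 / (1 + x\<^sup>2)) * indicator {..0} x \<partial>lborel)"
    by (intro nn_integral_mono) (auto simp: indicator_def)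
  ultimately show "(\<integral>\<^sup>+x. ennreal (norm (1 / (1 + x\<^sup>2 :: real))) \<partial>lborel) < \<infinity>"
    by (simp add: order_le_less_trans)
qed auto

text \<open>The residue theorem delivers gauge integrals over bounded intervals. Dominated
  convergence, with the norm of the integrand as majorant, identifies their limit with the Lebesgue
  integral over the line.\<close>

lemma integral_exhaustion:
  fixes h :: "real \<Rightarrow> complex"
  assumes h: "integrable lebesgue h"
    and I: "\<forall>\<^sub>F n in sequentially. (h has_integral I n) {a n..b n}"
    and a: "filterlim a at_bot sequentially" and b: "filterlim b at_top sequentially"
  shows "I \<longlonglongrightarrow> integral\<^sup>L lebesgue h"
proof -
  have "(\<lambda>n. integral\<^sup>L lebesgue (\<lambda>t. indicator {a n..b n} t *\<^sub>R h t)) \<longlonglongrightarrow> integral\<^sup>L lebesgue h"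
  proof (rule integral_dominated_convergence[where w = "\<lambda>t. norm (h t)"])
    show "AE t in lebesgue. (\<lambda>n. indicator {a n..b n} t *\<^sub>R h t) \<longlonglongrightarrow> h t"
    proof (rule AE_I2)
      fix t
      have "\<forall>\<^sub>F n in sequentially. a n \<le> t" "\<forall>\<^sub>F n in sequentially. t \<le> b n"
        using a b by (auto simp: filterlim_at_bot filterlim_at_top)
      then have "\<forall>\<^sub>F n in sequentially. indicator {a n..b n} t *\<^sub>R h t = h t"
        by eventually_elim (auto simp: indicator_def)
      then show "(\<lambda>n. indicator {a n..b n} t *\<^sub>R h t) \<longlonglongrightarrow> h t"
        by (rule tendsto_eventually)
    qed
    show "(\<lambda>t. indicator {a n..b n} t *\<^sub>R h t) \<in> borel_measurable lebesgue" for n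
      using integrable_mult_indicator[OF _ h, of "{a n..b n}"] by (auto intro: borel_measurable_integrable)
  qed (use h in \<open>auto simp: indicator_def\<close>)
  moreover have "\<forall>\<^sub>F n in sequentially. integral\<^sup>L lebesgue (\<lambda>t. indicator {a n..b n} t *\<^sub>R h t) = I n"
    using I
  proof eventually_elim
    case (elim n)
    have "set_integrable lebesgue {a n..b n} h"
      unfolding set_integrable_def using h by (intro integrable_mult_indicator) auto
    from has_integral_set_lebesgue[OF this] elim show ?case
      unfolding set_lebesgue_integral_def by (rule has_integral_unique)
  qed
  ultimately show ?thesis
    by (rule Lim_transform_eventually)
qed

lemma screen_integrand_const: "screen_integrand (\<lambda>_. c) f = (\<lambda>t. f (Complex c t) * \<i>)"
  by (simp add: screen_integrand_def fun_eq_iff)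

lemma vertical_integral_has_integral:
  assumes "a \<le> b" and "open B" "convex B" "f holomorphic_on B" "\<And>t. t \<in> {a..b} \<Longrightarrow> Complex c t \<in> B"
  shows "((\<lambda>t. f (Complex c t) * \<i>) has_integral
      contour_integral (linepath (Complex c a) (Complex c b)) f) {a..b}"
  using screen_integrand_has_integral_convex[of 0 "\<lambda>_. c", OF _ assms]
  by (simp add: lipschitz_on_def screen_integrand_const)

lemma norm_contour_integral_linepath_le:
  assumes "f holomorphic_on X" "open X" "closed_segment u v \<subseteq> X"
    and "\<And>z. z \<in> closed_segment u v \<Longrightarrow> norm (f z) \<le> B" and "norm (v - u) \<le> l"
  shows "norm (contour_integral (linepath u v) f) \<le> B * l"
proof -
  have B: "B \<ge> 0" using assms(4)[of u] by (auto intro: order_trans[OF norm_ge_zero])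
  have "f contour_integrable_on linepath u v"
    using assms by (intro contour_integrable_holomorphic_simple) auto
  then have "norm (contour_integral (linepath u v) f) \<le> B * norm (v - u)"
    using B assms(4) by (intro contour_integral_bound_linepath) auto
  also have "\<dots> \<le> B * l" using assms(5) B by (rule mult_left_mono)
  finally show ?thesis .
qed

lemma norm_Complex_ge: "\<bar>t\<bar> \<le> norm (Complex x t - of_real k)" "\<bar>x - k\<bar> \<le> norm (Complex x t - of_real k)"
  using abs_Im_le_cmod[of "Complex x t - of_real k"] abs_Re_le_cmod[of "Complex x t - of_real k"] by simp_all

text \<open>With \<open>m\<close> the smaller distance of the line from the two points, each factor
  has modulus at least \<open>sqrt (m^2 + t^2)\<close>. This yields the integrable majorant of the
  Perron kernel.\<close>

lemma norm_Complex_mult_ge: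
  assumes "k < c" "d < c"
  obtains C where "C > 0"
    "\<And>t. 1 + t\<^sup>2 \<le> C * norm ((Complex c t - of_real k) * (Complex c t - of_real d))"
proof -
  define m where "m = min (c - k) (c - d)"
  have m: "m > 0" using assms by (simp add: m_def)
  show ?thesis
  proof (rule that[of "max 1 (1 / m\<^sup>2)"])
    fix t :: real
    have "sqrt (m\<^sup>2 + t\<^sup>2) \<le> norm (Complex c t - of_real e)" if "m \<le> c - e" for e
      using that m by (auto simp: cmod_def power_mono)
    from mult_mono[OF this[of k] this[of d]]
    have "m\<^sup>2 + t\<^sup>2 \<le> norm ((Complex c t - of_real k) * (Complex c t - of_real d))"
      by (simp add: m_def norm_mult)
    moreover have "1 + t\<^sup>2 \<le> max 1 (1 / m\<^sup>2) * (m\<^sup>2 + t\<^sup>2)"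
    proof -
      have "1 + t\<^sup>2 = (1 / m\<^sup>2) * m\<^sup>2 + 1 * t\<^sup>2" using m by simp
      also have "\<dots> \<le> max 1 (1 / m\<^sup>2) * m\<^sup>2 + max 1 (1 / m\<^sup>2) * t\<^sup>2"
        by (intro add_mono mult_right_mono) auto
      finally show ?thesis by (simp add: algebra_simps)
    qed
    ultimately show "1 + t\<^sup>2 \<le> max 1 (1 / m\<^sup>2) * norm ((Complex c t - of_real k) * (Complex c t - of_real d))"
      by (meson max.cobounded1 mult_left_mono order_trans zero_le_one)
  qed (simp add: less_max_iff_disj)
qed

text \<open>Two linear factors in the denominator instead of the single one of the classical kernel
  \<open>y powr s / s\<close>: the integral over a vertical line then converges absolutely.\<close>

definition perron_kernel :: "real \<Rightarrow> real \<Rightarrow> real \<Rightarrow> complex \<Rightarrow> complex" where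
  "perron_kernel y k d s = of_real y powr s / ((s - of_real k) * (s - of_real d))"

lemma holomorphic_perron_kernel:
  "y > 0 \<Longrightarrow> perron_kernel y k d holomorphic_on - {of_real k, of_real d}"
  unfolding perron_kernel_def by (auto intro!: holomorphic_intros simp: complex_nonpos_Reals_iff)

lemma residue_perron_kernel:
  assumes "y > 0" "k \<noteq> d"
  shows "residue (perron_kernel y k d) (of_real k) = of_real (y powr k / (k - d))"
    and "residue (perron_kernel y k d) (of_real d) = of_real (y powr d / (d - k))"
proof -
  have *: "residue (\<lambda>s. of_real y powr s / (s - of_real b) / (s - of_real a)) (of_real a)
        = of_real (y powr a / (a - b))" if "a \<noteq> b" for a b :: real
    using that assms
    by (subst residue_simple[where s = "- {of_real b}"])
       (auto intro!: holomorphic_intros simp: complex_nonpos_Reals_iff simp flip: powr_of_real)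
  show "residue (perron_kernel y k d) (of_real k) = of_real (y powr k / (k - d))"
    using *[OF assms(2)] by (simp add: perron_kernel_def[abs_def] mult.commute)
  show "residue (perron_kernel y k d) (of_real d) = of_real (y powr d / (d - k))"
    using *[OF assms(2)[symmetric]] by (simp add: perron_kernel_def[abs_def] mult.commute)
qed

text \<open>For \<open>y \<ge> 1\<close> the rectangle is closed to the left, where
  \<open>y powr s\<close> stays bounded and both poles are enclosed; for \<open>y < 1\<close> it is
  closed to the right, where there is no pole. At \<open>y = 1\<close> both cases give 0.\<close>

lemma perron_integral:
  assumes y: "y > 0" and k: "k < c" and d: "d < c" and kd: "k \<noteq> d"
  shows "integrable lebesgue (\<lambda>t. perron_kernel y k d (Complex c t))"
    and "integral\<^sup>L lebesgue (\<lambda>t. perron_kernel y k d (Complex c t))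
       = of_real (2 * pi * (if y \<ge> 1 then (y powr d - y powr k) / (d - k) else 0))"
proof -
  let ?f = "perron_kernel y k d"
  obtain C where C: "C > 0"
    "\<And>t. 1 + t\<^sup>2 \<le> C * norm ((Complex c t - of_real k) * (Complex c t - of_real d))"
    using norm_Complex_mult_ge[OF k d] by blast
  have cont: "continuous_on UNIV (\<lambda>t. ?f (Complex c t))"
  proof (rule continuous_on_compose2[OF holomorphic_on_imp_continuous_on[OF holomorphic_perron_kernel[OF y]]])
    show "continuous_on UNIV (Complex c)"
      unfolding Complex_eq by (intro continuous_intros)
    show "range (Complex c) \<subseteq> - {of_real k, of_real d}"
      using k d by (auto simp: complex_eq_iff)
  qed
  have "integrable lborel (\<lambda>t. ?f (Complex c t))"
  proof (rule Bochner_Integration.integrable_bound)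
    show "integrable lborel (\<lambda>t. (y powr c * C) * (1 / (1 + t\<^sup>2)))"
      by (intro integrable_mult_right integrable_inverse_one_plus_square)
    show "(\<lambda>t. ?f (Complex c t)) \<in> borel_measurable lborel"
      using cont by (simp add: borel_measurable_continuous_onI)
    have "norm (?f (Complex c t)) \<le> y powr c * C * (1 / (1 + t\<^sup>2))" for t
    proof -
      have pos: "norm ((Complex c t - of_real k) * (Complex c t - of_real d)) > 0"
        using k d by (simp add: complex_eq_iff[of "Complex c t"])
      have "norm (?f (Complex c t)) = y powr c * (1 / norm ((Complex c t - of_real k) * (Complex c t - of_real d)))"
        using y by (simp add: perron_kernel_def norm_divide norm_powr_real_powr)
      also have "\<dots> \<le> y powr c * (C * (1 / (1 + t\<^sup>2)))"
        using C(2)[of t] pos by (intro mult_left_mono) (auto simp: field_simps add_pos_nonneg)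
      finally show ?thesis by simp
    qed
    moreover have "0 \<le> y powr c * C * (1 / (1 + t\<^sup>2))" for t using C(1) by simp
    ultimately show "AE t in lborel. norm (?f (Complex c t)) \<le> norm (y powr c * C * (1 / (1 + t\<^sup>2)))"
      by (intro AE_I2) (metis abs_of_nonneg real_norm_def)
  qed
  then show int: "integrable lebesgue (\<lambda>t. ?f (Complex c t))"
    using integrable_completion[of "\<lambda>t. ?f (Complex c t)" lborel] by (simp add: borel_measurable_integrable)
  \<comment> \<open>\<open>T \<ge> 2 * K\<close> keeps every point with
    \<open>\<bar>Re z\<bar> = T\<close> or \<open>\<bar>Im z\<bar> = T\<close> at distance at least
    \<open>T / 2\<close> from both poles, whence the factor 4 in \<open>bound\<close>.\<close>
  define K where "K = \<bar>c\<bar> + \<bar>k\<bar> + \<bar>d\<bar> + 1"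
  define J where "J = (\<lambda>n::nat. contour_integral (linepath (Complex c (- real n)) (Complex c (real n))) ?f)"
  define J0 :: complex where "J0 = 2 * pi * \<i> * of_real (if y \<ge> 1 then (y powr d - y powr k) / (d - k) else 0)"
  have hol: "?f holomorphic_on - {of_real k, of_real d}"
    by (rule holomorphic_perron_kernel[OF y])
  have vert: "((\<lambda>t. ?f (Complex x t) * \<i>) has_integral
      contour_integral (linepath (Complex x a) (Complex x b)) ?f) {a..b}"
    if "x < min k d \<or> max k d < x" "a \<le> b" for x a b
    using that(1)
  proof
    assume x: "x < min k d"
    show ?thesis
      using x that(2) convex_halfspace_Re_lt[of "min k d"] open_halfspace_Re_lt[of "min k d"]
      by (intro vertical_integral_has_integral[where B = "{z. Re z < min k d}"] holomorphic_on_subset[OF hol]) auto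
  next
    assume x: "max k d < x"
    show ?thesis
      using x that(2) convex_halfspace_Re_gt[of "max k d"] open_halfspace_Re_gt[of "max k d"]
      by (intro vertical_integral_has_integral[where B = "{z. Re z > max k d}"] holomorphic_on_subset[OF hol]) auto
  qed
  have bound: "norm (?f z) \<le> 4 * y powr c / T\<^sup>2"
    if T: "T \<ge> 2 * K" and z: "\<bar>Im z\<bar> = T \<or> \<bar>Re z\<bar> = T" and yz: "y powr Re z \<le> y powr c" for z T
  proof -
    have T0: "T > 0" using T by (simp add: K_def)
    have *: "T / 2 \<le> norm (z - of_real e)" if "\<bar>e\<bar> \<le> K" for e
      using norm_Complex_ge[where t = "Im z" and x = "Re z" and k = e] z T that by (auto simp: complex_surj)
    have "(T / 2) * (T / 2) \<le> norm (z - of_real k) * norm (z - of_real d)"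
      using T0 by (intro mult_mono *) (auto simp: K_def)
    then have "y powr Re z / norm ((z - of_real k) * (z - of_real d)) \<le> y powr c / ((T / 2) * (T / 2))"
      using yz T0 by (intro frac_le) (auto simp: norm_mult)
    then show ?thesis using y by (simp add: perron_kernel_def norm_divide norm_powr_real_powr power2_eq_square mult_ac)
  qed
  \<comment> \<open>Three sides of length at most \<open>2 * T\<close>, on each of which the kernel
    is at most \<open>4 * y powr c / T^2\<close>, add up to the constant 24.\<close>
  have lim: "norm (J n - J0) \<le> 24 * y powr c / real n" if n: "real n \<ge> 2 * K" for n
  proof -
    define T where "T = real n"
    have T: "T \<ge> 2 * K" "T > 0" "T > \<bar>c\<bar>" "T > \<bar>k\<bar>" "T > \<bar>d\<bar>" using n by (auto simp: T_def K_def)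
    define \<sigma> where "\<sigma> = (if y \<ge> 1 then - T else T)"
    have y_le: "y powr x \<le> y powr c" if "if y \<ge> 1 then x \<le> c else c \<le> x" for x
      using that y by (auto split: if_splits intro: powr_mono powr_mono')
    have seg_im: "Im z = b \<and> \<bar>Re z\<bar> \<le> T \<and> y powr Re z \<le> y powr c" if "z \<in> closed_segment (Complex c b) (Complex \<sigma> b)" for z b
    proof -
      have "Im z = b" "Re z \<in> closed_segment c \<sigma>"
        using that by (simp_all add: closed_segment_same_Im)
      then show ?thesis using T y_le[of "Re z"]
        by (auto simp: \<sigma>_def closed_segment_eq_real_ivl split: if_splits)
    qed
    have seg_re: "Re z = x \<and> \<bar>Im z\<bar> \<le> T" if "z \<in> closed_segment (Complex x (- T)) (Complex x T)" for z x
    proof -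
      have "Re z = x" "Im z \<in> closed_segment (- T) T"
        using that by (simp_all add: closed_segment_same_Re)
      then show ?thesis using T(2) by (auto simp: closed_segment_eq_real_ivl)
    qed
    let ?B = "4 * y powr c / T\<^sup>2"
    let ?X = "- {complex_of_real k, complex_of_real d}"
    have side: "norm (contour_integral (linepath (Complex \<sigma> (- T)) (Complex \<sigma> T)) ?f) \<le> ?B * (2 * T)"
    proof (rule norm_contour_integral_linepath_le[OF hol])
      show "closed_segment (Complex \<sigma> (- T)) (Complex \<sigma> T) \<subseteq> ?X"
        using T by (auto simp: \<sigma>_def dest!: seg_re split: if_splits)
      show "norm (?f z) \<le> ?B" if "z \<in> closed_segment (Complex \<sigma> (- T)) (Complex \<sigma> T)" for z
        using seg_re[OF that] T by (intro bound y_le) (auto simp: \<sigma>_def)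
      show "norm (Complex \<sigma> T - Complex \<sigma> (- T)) \<le> 2 * T"
        using T cmod_le[of "Complex \<sigma> T - Complex \<sigma> (- T)"] by simp
    qed auto
    have edge: "norm (contour_integral (linepath (Complex c b) (Complex \<sigma> b)) ?f) \<le> ?B * (2 * T)"
      if "\<bar>b\<bar> = T" for b
    proof (rule norm_contour_integral_linepath_le[OF hol])
      show "closed_segment (Complex c b) (Complex \<sigma> b) \<subseteq> ?X"
        using T that by (auto dest!: seg_im)
      show "norm (?f z) \<le> ?B" if "z \<in> closed_segment (Complex c b) (Complex \<sigma> b)" for z
        using seg_im[OF that] T \<open>\<bar>b\<bar> = T\<close> by (intro bound) auto
      show "norm (Complex \<sigma> b - Complex c b) \<le> 2 * T"
        using T cmod_le[of "Complex \<sigma> b - Complex c b"] by (auto simp: \<sigma>_def split: if_splits)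
    qed auto
    have tri: "norm (a - b + c) \<le> norm a + norm b + norm c" for a b c :: complex
      by (meson norm_triangle_ineq norm_triangle_ineq4 add_right_mono order_trans)
    have "norm (J n - J0) \<le> norm (contour_integral (linepath (Complex \<sigma> (- T)) (Complex \<sigma> T)) ?f)
        + norm (contour_integral (linepath (Complex c T) (Complex \<sigma> T)) ?f)
        + norm (contour_integral (linepath (Complex c (- T)) (Complex \<sigma> (- T))) ?f)"
    proof (cases "y \<ge> 1")
      case True
      have set: "{p \<in> {complex_of_real k, complex_of_real d}. - T < Im p \<and> Im p < T \<and> \<sigma> < Re p}
          = {complex_of_real k, complex_of_real d}"
        using T True by (auto simp: \<sigma>_def)
      have "Re p < c \<and> Re p \<noteq> \<sigma> \<and> Im p \<noteq> - T \<and> Im p \<noteq> T" if "p \<in> {complex_of_real k, complex_of_real d}" for p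
        using that T k d True by (auto simp: \<sigma>_def)
      from screen_residue_theorem[of 0 "\<lambda>_. \<sigma>" "- T" T UNIV "{complex_of_real k, complex_of_real d}" ?f c,
          OF _ _ _ _ _ _ _ _ _ this]
      have "((\<lambda>t. ?f (Complex \<sigma> t) * \<i>) has_integral
         (contour_integral (linepath (Complex c (- T)) (Complex c T)) ?f
      + contour_integral (linepath (Complex c T) (Complex \<sigma> T)) ?f
      - contour_integral (linepath (Complex c (- T)) (Complex \<sigma> (- T))) ?f
      - 2 * pi * \<i> * (\<Sum>p\<in>{complex_of_real k, complex_of_real d}. residue ?f p))) {- T..T}"
        using T hol unfolding set screen_integrand_const by (simp add: lipschitz_on_def Compl_eq_Diff_UNIV)
      moreover have "2 * pi * \<i> * (\<Sum>p\<in>{complex_of_real k, complex_of_real d}. residue ?f p) = J0"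
      proof -
        have "y powr k / (k - d) + y powr d / (d - k) = (y powr d - y powr k) / (d - k)"
          using minus_divide_right[of "y powr k" "d - k"] by (simp add: diff_divide_distrib)
        moreover have "(\<Sum>p\<in>{complex_of_real k, complex_of_real d}. residue ?f p)
            = of_real (y powr k / (k - d) + y powr d / (d - k))"
          using kd by (simp add: residue_perron_kernel[OF y kd])
        ultimately show ?thesis using True by (simp only: J0_def if_True)
      qed
      moreover have "((\<lambda>t. ?f (Complex \<sigma> t) * \<i>) has_integral
          contour_integral (linepath (Complex \<sigma> (- T)) (Complex \<sigma> T)) ?f) {- T..T}"
        using T True by (intro vert) (auto simp: \<sigma>_def)
      ultimately have eq: "contour_integral (linepath (Complex \<sigma> (- T)) (Complex \<sigma> T)) ?f =
        contour_integral (linepath (Complex c (- T)) (Complex c T)) ?f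
      + contour_integral (linepath (Complex c T) (Complex \<sigma> T)) ?f
      - contour_integral (linepath (Complex c (- T)) (Complex \<sigma> (- T))) ?f - J0"
        by (metis has_integral_unique)
      have "J n - J0 = contour_integral (linepath (Complex \<sigma> (- T)) (Complex \<sigma> T)) ?f
         - contour_integral (linepath (Complex c T) (Complex \<sigma> T)) ?f
         + contour_integral (linepath (Complex c (- T)) (Complex \<sigma> (- T))) ?f"
        using eq by (simp add: J_def T_def)
      then show ?thesis using tri by simp
    next
      case False
      \<comment> \<open>The roles are exchanged here: the line \<open>Re = c\<close> acts as the
        screen and the far side \<open>Re = \<sigma>\<close> as the auxiliary vertical line. Both
        poles then lie to the left of the screen and no residue is collected.\<close>
      have set: "{p \<in> {complex_of_real k, complex_of_real d}. - T < Im p \<and> Im p < T \<and> c < Re p} = {}"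
        using k d by auto
      have rev: "contour_integral (linepath (Complex \<sigma> b) (Complex c b)) ?f
          = - contour_integral (linepath (Complex c b) (Complex \<sigma> b)) ?f" for b
        by (metis contour_integral_reversepath reversepath_linepath valid_path_linepath)
      have "Re p < \<sigma> \<and> Re p \<noteq> c \<and> Im p \<noteq> - T \<and> Im p \<noteq> T" if "p \<in> {complex_of_real k, complex_of_real d}" for p
        using that T k d False by (auto simp: \<sigma>_def)
      from screen_residue_theorem[of 0 "\<lambda>_. c" "- T" T UNIV "{complex_of_real k, complex_of_real d}" ?f \<sigma>,
          OF _ _ _ _ _ _ _ _ _ this]
      have "((\<lambda>t. ?f (Complex c t) * \<i>) has_integral
         (contour_integral (linepath (Complex \<sigma> (- T)) (Complex \<sigma> T)) ?f
      + contour_integral (linepath (Complex \<sigma> T) (Complex c T)) ?f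
      - contour_integral (linepath (Complex \<sigma> (- T)) (Complex c (- T))) ?f)) {- T..T}"
        using T hol unfolding set screen_integrand_const by (simp add: lipschitz_on_def Compl_eq_Diff_UNIV)
      moreover have "((\<lambda>t. ?f (Complex c t) * \<i>) has_integral J n) {- T..T}"
        using T k d unfolding J_def T_def by (intro vert) auto
      ultimately have eq: "J n = contour_integral (linepath (Complex \<sigma> (- T)) (Complex \<sigma> T)) ?f
      - contour_integral (linepath (Complex c T) (Complex \<sigma> T)) ?f
      + contour_integral (linepath (Complex c (- T)) (Complex \<sigma> (- T))) ?f"
        unfolding rev by (metis (no_types, lifting) diff_minus_eq_add has_integral_unique uminus_add_conv_diff add.commute)
      moreover have "J0 = 0" using False by (simp add: J0_def)
      ultimately show ?thesis using tri by simp
    qed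
    also have "\<dots> \<le> ?B * (2 * T) + ?B * (2 * T) + ?B * (2 * T)"
      using T by (intro add_mono side edge) auto
    also have "\<dots> = 24 * y powr c / T" using T(2) by (simp add: power2_eq_square)
    finally show ?thesis by (simp add: T_def)
  qed
  have "(\<lambda>n. J n - J0) \<longlonglongrightarrow> 0"
  proof (rule Lim_null_comparison)
    have "\<forall>\<^sub>F n in sequentially. real n \<ge> 2 * K" by (rule eventually_sequentiallyI[of "nat \<lceil>2 * K\<rceil>"]) linarith
    then show "\<forall>\<^sub>F n in sequentially. norm (J n - J0) \<le> 24 * y powr c / real n"
      by eventually_elim (rule lim)
    show "(\<lambda>n. 24 * y powr c / real n) \<longlonglongrightarrow> 0" by (rule lim_const_over_n)
  qed
  then have "J \<longlonglongrightarrow> J0" by (simp add: LIM_zero_iff)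
  moreover have "J \<longlonglongrightarrow> integral\<^sup>L lebesgue (\<lambda>t. ?f (Complex c t) * \<i>)"
  proof (rule integral_exhaustion)
    show "integrable lebesgue (\<lambda>t. ?f (Complex c t) * \<i>)" using int by simp
    show "\<forall>\<^sub>F n in sequentially. ((\<lambda>t. ?f (Complex c t) * \<i>) has_integral J n) {- real n..real n}"
      unfolding J_def using k d by (intro always_eventually allI vert) auto
    show "filterlim (\<lambda>n. - real n) at_bot sequentially"
      by (simp add: filterlim_uminus_at_bot filterlim_real_sequentially)
  qed (rule filterlim_real_sequentially)
  ultimately have "J0 = integral\<^sup>L lebesgue (\<lambda>t. ?f (Complex c t)) * \<i>"
    using LIMSEQ_unique by force
  then show "integral\<^sup>L lebesgue (\<lambda>t. ?f (Complex c t))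
       = of_real (2 * pi * (if y \<ge> 1 then (y powr d - y powr k) / (d - k) else 0))"
    by (simp add: J0_def complex_eq_iff)
qed

subsection \<open>Similarities and parallel volumes\<close>

text \<open>The restriction to ratios below 1 is dropped so that the identity, which belongs to the
  empty word, is included.\<close>

definition similarity :: "real \<Rightarrow> ('a::euclidean_space \<Rightarrow> 'a) \<Rightarrow> bool" where
  "similarity \<rho> f \<longleftrightarrow> 0 < \<rho> \<and> (\<forall>x y. dist (f x) (f y) = \<rho> * dist x y)"

lemma similarity_inj: "similarity \<rho> f \<Longrightarrow> inj f"
  unfolding similarity_def by (metis dist_eq_0_iff injI mult_eq_0_iff less_irrefl)

text \<open>Subtracting \<open>f 0\<close> leaves a map that fixes the origin and scales distances,
  hence a linear one; in finite dimension its injectivity gives surjectivity.\<close>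

lemma similarity_surj:
  assumes "similarity \<rho> f"
  shows "surj f"
proof -
  have "linear (\<lambda>x. f x - f 0)"
    using assms by (intro scaling_linear[where c = \<rho>]) (auto simp: similarity_def dist_norm)
  moreover have "inj (\<lambda>x. f x - f 0)"
    using similarity_inj[OF assms] by (auto simp: inj_def)
  ultimately have surj: "surj (\<lambda>x. f x - f 0)"
    by (rule linear_inj_imp_surj)
  have "y \<in> range f" for y
  proof -
    obtain x where "y - f 0 = f x - f 0" using surjD[OF surj] by blast
    then show ?thesis by simp
  qed
  then show ?thesis by auto
qed

lemma similarity_bij: "similarity \<rho> f \<Longrightarrow> bij f"
  by (simp add: bij_def similarity_inj similarity_surj)

lemma similarity_compose: "similarity \<rho> f \<Longrightarrow> similarity \<sigma> h \<Longrightarrow> similarity (\<rho> * \<sigma>) (f \<circ> h)"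
  by (simp add: similarity_def)

lemma similarity_image_ball: "similarity \<rho> f \<Longrightarrow> f ` ball x e = ball (f x) (\<rho> * e)"
proof -
  assume f: "similarity \<rho> f"
  have "dist (f x) (f y) < \<rho> * e \<longleftrightarrow> dist x y < e" for y
    using f by (simp add: similarity_def)
  then show ?thesis using surjD[OF similarity_surj[OF f]] by (fastforce simp: image_iff)
qed

lemma similarity_image_cball: "similarity \<rho> f \<Longrightarrow> f ` cball x e = cball (f x) (\<rho> * e)"
proof -
  assume f: "similarity \<rho> f"
  have "dist (f x) (f y) \<le> \<rho> * e \<longleftrightarrow> dist x y \<le> e" for y
    using f by (simp add: similarity_def)
  then show ?thesis using surjD[OF similarity_surj[OF f]] by (fastforce simp: image_iff)
qed

lemma similarity_open_image:
  assumes f: "similarity \<rho> f" and "open A"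
  shows "open (f ` A)"
  unfolding open_contains_ball
proof
  fix y assume "y \<in> f ` A"
  then obtain x where x: "x \<in> A" "y = f x" by blast
  then obtain e where "e > 0" "ball x e \<subseteq> A" using \<open>open A\<close> open_contains_ball by blast
  with x f show "\<exists>e>0. ball y e \<subseteq> f ` A"
    by (intro exI[of _ "\<rho> * e"]) (auto simp: similarity_def simp flip: similarity_image_ball[OF f])
qed

text \<open>By Vitali's covering theorem an open set is a countable disjoint union of closed balls
  up to a null set. Balls go to balls with scaled radius, for which the volume is explicit, and the
  Lipschitz image of the null set is null.\<close>

lemma emeasure_similarity_image:
  fixes A :: "'a::euclidean_space set"
  assumes f: "similarity \<rho> f" and A: "open A"
  shows "emeasure lborel (f ` A) = ennreal (\<rho> ^ DIM('a)) * emeasure lborel A"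
proof -
  define K where "K = {(x, e). 0 < e \<and> cball x e \<subseteq> A}"
  have K_pos: "0 < snd i" if "i \<in> K" for i
    using that by (auto simp: K_def)
  have K_fine: "\<exists>i. i \<in> K \<and> x \<in> cball (fst i) (snd i) \<and> snd i < d" if "x \<in> A" "0 < d" for x d
  proof -
    obtain e where "e > 0" "cball x e \<subseteq> A" using A \<open>x \<in> A\<close> open_contains_cball by blast
    then show ?thesis
      using \<open>0 < d\<close> by (intro exI[of _ "(x, min e (d / 2))"]) (auto simp: K_def)
  qed
  obtain C where C: "countable C" "C \<subseteq> K"
     "pairwise (\<lambda>i j. disjnt (cball (fst i) (snd i)) (cball (fst j) (snd j))) C"
     "negligible (A - (\<Union>i \<in> C. cball (fst i) (snd i)))"
  proof (rule Vitali_covering_theorem_cballs[of K snd A fst, OF K_pos K_fine])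
  qed
  define B :: "'a \<times> real \<Rightarrow> 'a set" where "B = (\<lambda>i. cball (fst i) (snd i))"
  define N where "N = A - (\<Union>i\<in>C. B i)"
  have rho: "\<rho> > 0" using f by (simp add: similarity_def)
  have A_eq: "A = (\<Union>i\<in>C. B i) \<union> N" 
  proof -
    have "B i \<subseteq> A" if "i \<in> C" for i
    proof -
      have "i \<in> K" using that C(2) by blast
      then show ?thesis unfolding K_def B_def by (cases i) simp
    qed
    then show ?thesis unfolding N_def by blast
  qed
  have N: "negligible N" using C(4) by (simp add: N_def B_def)
  have fN: "negligible (f ` N)"
  proof (rule negligible_locally_Lipschitz_image[OF order_refl N])
    fix x
    have "norm (f y - f x) \<le> \<rho> * norm (y - x)" for y
      using f by (simp add: similarity_def flip: dist_norm)
    then show "\<exists>T B. open T \<and> x \<in> T \<and> (\<forall>y\<in>N \<inter> T. norm (f y - f x) \<le> B * norm (y - x))"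
      by blast
  qed
  have disj: "disjoint_family_on B C"
    using C(3) by (auto simp: disjoint_family_on_def pairwise_def disjnt_def B_def)
  have disj': "disjoint_family_on (\<lambda>i. f ` B i) C"
    using disj unfolding disjoint_family_on_def
    by (metis image_Int[OF similarity_inj[OF f]] image_empty)
  have cballs: "emeasure lborel (f ` B i) = ennreal (\<rho> ^ DIM('a)) * emeasure lborel (B i)" if "i \<in> C" for i
  proof -
    have "snd i \<ge> 0" using that C(2) by (auto simp: K_def)
    then show ?thesis unfolding B_def similarity_image_cball[OF f]
      using rho by (simp add: emeasure_cball power_mult_distrib mult_ac flip: ennreal_mult)
  qed
  have drop: "emeasure lebesgue (X \<union> M) = emeasure lebesgue X" if "negligible M" "X \<in> sets lebesgue" for X M :: "'a set"
    using that by (intro emeasure_Un_null_set) (auto simp: negligible_iff_null_sets)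
  have fB: "f ` B i \<in> sets borel" for i unfolding B_def similarity_image_cball[OF f] by simp
  have m1: "(\<Union>i\<in>C. f ` B i) \<in> sets lborel"
    using C(1) fB by (intro sets.countable_UN') auto
  have m2: "(\<Union>i\<in>C. B i) \<in> sets lborel"
    using C(1) by (intro sets.countable_UN') (auto simp: B_def)
  have "f ` A = (\<Union>i\<in>C. f ` B i) \<union> f ` N"
    by (subst A_eq) (simp only: image_Un image_UN)
  moreover have "emeasure lborel (f ` A) = emeasure lebesgue (f ` A)"
    using similarity_open_image[OF f A] by simp
  ultimately have "emeasure lborel (f ` A) = emeasure lebesgue ((\<Union>i\<in>C. f ` B i) \<union> f ` N)"
    by simp
  also have "\<dots> = emeasure lebesgue (\<Union>i\<in>C. f ` B i)"
    using m1 by (intro drop fN) simp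
  also have "\<dots> = emeasure lborel (\<Union>i\<in>C. f ` B i)"
    using m1 by simp
  also have "\<dots> = (\<integral>\<^sup>+i. emeasure lborel (f ` B i) \<partial>count_space C)"
    using C(1) fB disj' by (intro emeasure_UN_countable) auto
  also have "\<dots> = (\<integral>\<^sup>+i. ennreal (\<rho> ^ DIM('a)) * emeasure lborel (B i) \<partial>count_space C)"
    by (intro nn_integral_cong) (simp add: cballs)
  also have "\<dots> = ennreal (\<rho> ^ DIM('a)) * (\<integral>\<^sup>+i. emeasure lborel (B i) \<partial>count_space C)"
    by (rule nn_integral_cmult) simp
  also have "(\<integral>\<^sup>+i. emeasure lborel (B i) \<partial>count_space C) = emeasure lborel (\<Union>i\<in>C. B i)"
    using C(1) disj by (intro emeasure_UN_countable[symmetric]) (auto simp: B_def)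
  also have "\<dots> = emeasure lebesgue (\<Union>i\<in>C. B i)"
    using m2 by simp
  also have "\<dots> = emeasure lebesgue A"
    using drop[OF N, of "\<Union>i\<in>C. B i"] m2 A_eq by simp
  also have "\<dots> = emeasure lborel A"
    using A by simp
  finally show ?thesis .
qed

text \<open>The distance to a closed nonempty set is attained. The case \<open>A = UNIV\<close> has
  to be excluded because \<open>infdist\<close> to the empty set is 0 by convention.\<close>

lemma inner_parallel_open:
  assumes "open A" "A \<noteq> UNIV"
  shows "inner_parallel A \<epsilon> = {x \<in> A. \<exists>y\<in>-A. dist x y \<le> \<epsilon>}"
proof -
  have "(\<exists>y\<in>-A. dist x y \<le> \<epsilon>) \<longleftrightarrow> infdist x (- A) \<le> \<epsilon>" for x
  proof
    assume "\<exists>y\<in>-A. dist x y \<le> \<epsilon>"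
    then show "infdist x (- A) \<le> \<epsilon>" using infdist_le2 by blast
  next
    assume "infdist x (- A) \<le> \<epsilon>"
    moreover have "closed (- A)" "- A \<noteq> {}" using assms by auto
    ultimately show "\<exists>y\<in>-A. dist x y \<le> \<epsilon>" using infdist_attains_inf[of "- A" x] by metis
  qed
  then show ?thesis by (auto simp: inner_parallel_def)
qed

lemma sets_inner_parallel: "open A \<Longrightarrow> inner_parallel A \<epsilon> \<in> sets borel"
proof -
  assume "open A"
  moreover have "inner_parallel A \<epsilon> = A \<inter> {x. infdist x (- A) \<le> \<epsilon>}"
    by (auto simp: inner_parallel_def)
  moreover have "closed {x. infdist x (- A) \<le> \<epsilon>}"
    by (intro closed_Collect_le continuous_intros)
  ultimately show ?thesis by (metis borel_closed borel_open sets.Int)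
qed

lemma similarity_image_inner_parallel:
  assumes f: "similarity \<rho> f" and A: "open A" "A \<noteq> UNIV"
  shows "f ` inner_parallel A \<epsilon> = inner_parallel (f ` A) (\<rho> * \<epsilon>)"
proof -
  have bij: "bij f" by (rule similarity_bij[OF f])
  have "f ` A \<noteq> UNIV" using A(2) bij by (metis bij_betw_def inj_image_eq_iff)
  then have "inner_parallel (f ` A) (\<rho> * \<epsilon>) = {x \<in> f ` A. \<exists>y\<in>f ` (- A). dist x y \<le> \<rho> * \<epsilon>}"
    using similarity_open_image[OF f A(1)] bij by (simp add: inner_parallel_open bij_image_Compl_eq)
  also have "\<dots> = f ` {x \<in> A. \<exists>y\<in>-A. dist (f x) (f y) \<le> \<rho> * \<epsilon>}"
    by blast
  also have "\<dots> = f ` {x \<in> A. \<exists>y\<in>-A. dist x y \<le> \<epsilon>}"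
    using f by (simp add: similarity_def)
  also have "\<dots> = f ` inner_parallel A \<epsilon>"
    using A by (simp add: inner_parallel_open)
  finally show ?thesis ..
qed

lemma measure_similarity_image:
  fixes A :: "'a::euclidean_space set"
  assumes "similarity \<rho> f" "open A"
  shows "measure lborel (f ` A) = \<rho> ^ DIM('a) * measure lborel A"
  using assms emeasure_similarity_image[OF assms]
  by (simp add: measure_def similarity_def enn2real_mult)

text \<open>The scaling law for volumes is available for open sets, and an inner parallel set is not
  open in general. It is therefore written as \<open>A - D\<close>, where the open set
  \<open>D\<close> consists of the points deeper than the given width.\<close>

lemma inner_volume_similarity_image:
  fixes A :: "'a::euclidean_space set"
  assumes f: "similarity \<rho> f" and A: "open A" "bounded A"
  shows "inner_volume (f ` A) \<epsilon> = \<rho> ^ DIM('a) * inner_volume A (\<epsilon> / \<rho>)"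
proof -
  have rho: "\<rho> > 0" using f by (simp add: similarity_def)
  have "A \<noteq> UNIV" using A(2) not_bounded_UNIV by metis
  have img: "inner_parallel (f ` A) \<epsilon> = f ` inner_parallel A (\<epsilon> / \<rho>)"
    using similarity_image_inner_parallel[OF f A(1) \<open>A \<noteq> UNIV\<close>, of "\<epsilon> / \<rho>"] rho by simp
  define D where "D = {x \<in> A. infdist x (- A) > \<epsilon> / \<rho>}"
  have "D = A \<inter> {x. infdist x (- A) > \<epsilon> / \<rho>}" by (auto simp: D_def)
  moreover have "open {x. infdist x (- A) > \<epsilon> / \<rho>}"
    by (intro open_Collect_less continuous_intros)
  ultimately have D: "open D" "D \<subseteq> A" using A(1) by auto
  have eq: "inner_parallel A (\<epsilon> / \<rho>) = A - D" by (auto simp: inner_parallel_def D_def)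
  have fin: "X \<in> fmeasurable lborel" if "open X" "bounded X" for X :: "'a set"
    using that emeasure_bounded_finite[of X] by (intro fmeasurableI) auto
  have "bounded (f ` A)"
  proof -
    obtain B where "A \<subseteq> ball 0 B" using bounded_subset_ballD[OF A(2)] by metis
    then have "f ` A \<subseteq> ball (f 0) (\<rho> * B)"
      unfolding similarity_image_ball[OF f, symmetric] by (rule image_mono)
    then show ?thesis by (rule bounded_subset[OF bounded_ball])
  qed
  have "inner_volume (f ` A) \<epsilon> = measure lborel (f ` A - f ` D)"
    unfolding inner_volume_def img eq by (simp add: image_set_diff similarity_inj[OF f])
  also have "\<dots> = measure lborel (f ` A) - measure lborel (f ` D)"
    using \<open>bounded (f ` A)\<close> D similarity_open_image[OF f] A(1)
    by (intro measurable_measure_Diff fin) (auto simp: image_mono)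
  also have "\<dots> = \<rho> ^ DIM('a) * (measure lborel A - measure lborel D)"
    using A(1) D(1) by (simp add: measure_similarity_image[OF f] algebra_simps)
  also have "measure lborel A - measure lborel D = measure lborel (A - D)"
    using A D by (intro measurable_measure_Diff[symmetric] fin) auto
  finally show ?thesis by (simp add: inner_volume_def eq)
qed

text \<open>A segment from a point of \<open>A j\<close> to a point outside \<open>A j\<close> meets
  the frontier of \<open>A j\<close>. A frontier point of one of the disjoint open sets lies in none
  of them, so leaving \<open>A j\<close> within distance \<open>\<epsilon>\<close> already means
  leaving the whole union within that distance.\<close>

lemma inner_parallel_disjoint_Union:
  assumes A: "\<And>j. open (A j)" "disjoint_family A" and bd: "bounded (\<Union>j. A j)"
  shows "inner_parallel (\<Union>j. A j) \<epsilon> = (\<Union>j. inner_parallel (A j) \<epsilon>)"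
proof -
  have ne: "(\<Union>j. A j) \<noteq> UNIV" using bd not_bounded_UNIV by metis
  then have ne': "A j \<noteq> UNIV" for j by blast
  have exit: "\<exists>z. z \<notin> (\<Union>j. A j) \<and> dist x z \<le> \<epsilon>" if x: "x \<in> A j" and y: "y \<notin> A j" "dist x y \<le> \<epsilon>" for x y j
  proof -
    have "closed_segment x y \<inter> frontier (A j) \<noteq> {}"
      using x y by (intro connected_Int_frontier) auto
    then obtain z where z: "z \<in> closed_segment x y" "z \<in> frontier (A j)" by blast
    have "z \<notin> A i" for i
    proof
      assume i: "z \<in> A i"
      have "z \<in> closure (A j)" "z \<notin> A j"
        using z(2) A(1)[of j] by (auto simp: frontier_def interior_open)
      then have "A i \<inter> A j \<noteq> {}" "i \<noteq> j"
        using i A(1)[of i] open_Int_closure_eq_empty[of "A i" "A j"] by auto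
      then show False using A(2) by (auto simp: disjoint_family_on_def)
    qed
    moreover have "dist x z \<le> dist x y" using z(1) by (metis dist_in_closed_segment dist_commute)
    ultimately show ?thesis using y(2) by fastforce
  qed
  have iff: "x \<in> inner_parallel (A j) \<epsilon> \<longleftrightarrow> x \<in> A j \<and> (\<exists>y. y \<notin> A j \<and> dist x y \<le> \<epsilon>)" for x j
    using A(1) ne' by (auto simp: inner_parallel_open)
  have iff_Union: "x \<in> inner_parallel (\<Union>j. A j) \<epsilon> \<longleftrightarrow>
      x \<in> (\<Union>j. A j) \<and> (\<exists>y. y \<notin> (\<Union>j. A j) \<and> dist x y \<le> \<epsilon>)" for x
    using inner_parallel_open[OF _ ne, of \<epsilon>] A(1) by blast
  show ?thesis
  proof (intro equalityI subsetI)
    fix x assume "x \<in> inner_parallel (\<Union>j. A j) \<epsilon>"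
    then show "x \<in> (\<Union>j. inner_parallel (A j) \<epsilon>)" unfolding iff_Union UN_iff iff by blast
  next
    fix x assume "x \<in> (\<Union>j. inner_parallel (A j) \<epsilon>)"
    then obtain j y where "x \<in> A j" "y \<notin> A j" "dist x y \<le> \<epsilon>" unfolding UN_iff iff by blast
    with exit[of x j y] show "x \<in> inner_parallel (\<Union>j. A j) \<epsilon>" unfolding iff_Union by blast
  qed
qed

lemma inner_volume_sums:
  assumes A: "\<And>j. open (A j)" "disjoint_family A" and bd: "bounded (\<Union>j. A j)"
  shows "(\<lambda>j::nat. inner_volume (A j) \<epsilon>) sums inner_volume (\<Union>j. A j) \<epsilon>"
  unfolding inner_volume_def inner_parallel_disjoint_Union[OF assms]
proof (rule measure_UNION)
  have "(\<Union>j. inner_parallel (A j) \<epsilon>) \<subseteq> (\<Union>j. A j)" by (auto simp: inner_parallel_def)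
  then have "bounded (\<Union>j. inner_parallel (A j) \<epsilon>)" using bd bounded_subset by blast
  then show "emeasure lborel (\<Union>j. inner_parallel (A j) \<epsilon>) \<noteq> \<infinity>"
    using emeasure_bounded_finite by (metis infinity_ennreal_def less_irrefl)
  show "disjoint_family (\<lambda>j. inner_parallel (A j) \<epsilon>)"
    using A(2) by (auto simp: disjoint_family_on_def inner_parallel_def)
qed (use A(1) in \<open>auto intro!: sets_inner_parallel\<close>)

text \<open>Boundedness makes the supremum a genuine one. A point at positive distance from the
  complement is the centre of a ball of that radius inside \<open>A\<close>, so no such distance
  exceeds the inradius.\<close>

lemma inradius:
  fixes A :: "'a::euclidean_space set"
  assumes "open A" "bounded A" "A \<noteq> {}"
  shows "inradius A > 0" and "\<And>\<epsilon>. inradius A \<le> \<epsilon> \<Longrightarrow> inner_parallel A \<epsilon> = A"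
proof -
  let ?R = "{\<rho>. 0 < \<rho> \<and> (\<exists>x. ball x \<rho> \<subseteq> A)}"
  obtain B where B: "A \<subseteq> cball 0 B"
    using bounded_subset_ballD[OF assms(2)] ball_subset_cball by (metis order_trans)
  have "\<rho> \<le> B" if "\<rho> \<in> ?R" for \<rho>
  proof -
    from that obtain x where "0 < \<rho>" "ball x \<rho> \<subseteq> A" by blast
    then have "0 < \<rho>" "ball x \<rho> \<subseteq> cball 0 B" using B by auto
    then show ?thesis using zero_le_dist[of x 0] unfolding ball_subset_cball_iff by linarith
  qed
  then have "bdd_above ?R" by (rule bdd_aboveI)
  then have le: "\<rho> \<le> inradius A" if "0 < \<rho>" "ball x \<rho> \<subseteq> A" for x \<rho>
    unfolding inradius_def using that by (intro cSup_upper) auto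
  obtain x e where "e > 0" "ball x e \<subseteq> A" using assms(1,3) by (meson ex_in_conv open_contains_ball)
  then show "inradius A > 0" using le by fastforce
  have ne: "A \<noteq> UNIV" using assms(2) not_bounded_UNIV by metis
  show "inner_parallel A \<epsilon> = A" if "inradius A \<le> \<epsilon>" for \<epsilon>
  proof -
    have "infdist x (- A) \<le> \<epsilon>" if x: "x \<in> A" for x
    proof (cases "infdist x (- A) > 0")
      case True
      have "ball x (infdist x (- A)) \<subseteq> A"
        using infdist_le[of _ "- A" x] by fastforce
      then have "infdist x (- A) \<le> inradius A" by (rule le[OF True])
      then show ?thesis using that \<open>inradius A \<le> \<epsilon>\<close> by simp
    next
      case False
      then show ?thesis using \<open>inradius A > 0\<close> \<open>inradius A \<le> \<epsilon>\<close> by linarith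
    qed
    then show ?thesis by (auto simp: inner_parallel_def)
  qed
qed

subsection \<open>Self-similar tilings\<close>

lemma similarity_id: "similarity 1 id"
  by (simp add: similarity_def)

lemma word_map_simps [simp]:
  "word_map \<Phi> [] = id" "word_map \<Phi> (n # v) = \<Phi> n \<circ> word_map \<Phi> v"
  by (simp_all add: word_map_def)

lemma word_ratio_simps [simp]:
  "word_ratio r [] = 1" "word_ratio r (n # v) = r n * word_ratio r v"
  by (simp_all add: word_ratio_def)

locale self_similar_tiling =
  fixes \<Phi> :: "nat \<Rightarrow> 'a::euclidean_space \<Rightarrow> 'a"
    and r :: "nat \<Rightarrow> real" and N :: nat
    and U G :: "'a set"
    and w :: "nat \<Rightarrow> nat list"
  assumes N: "N \<ge> 2"
    and contractive: "\<And>n. n \<in> {1..N} \<Longrightarrow> contractive_similarity (r n) (\<Phi> n)"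
    and feasible: "feasible_open_set N \<Phi> U"
    and components: "components (U - ifs_image N \<Phi> (closure U)) = {G}"
    and ordering: "word_ordering N r w"
begin

abbreviation "l \<equiv> fractal_string r w"

lemma r_pos: "n \<in> {1..N} \<Longrightarrow> 0 < r n" and r_less_1: "n \<in> {1..N} \<Longrightarrow> r n < 1"
  and similarity_\<Phi>: "n \<in> {1..N} \<Longrightarrow> similarity (r n) (\<Phi> n)"
  using contractive[of n] by (auto simp: contractive_similarity_def similarity_def)

lemma G_eq: "G = U - ifs_image N \<Phi> (closure U)"
  using components Union_components[of "U - ifs_image N \<Phi> (closure U)"] by simp

lemma bounded_U: "bounded U" and open_U: "open U"
  using feasible by (auto simp: feasible_open_set_def)

lemma G_subset_U: "G \<subseteq> U"
  using G_eq by blast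

lemma bounded_G: "bounded G"
  using bounded_U G_subset_U by (rule bounded_subset)

lemma open_G: "open G"
proof -
  have "compact (\<Phi> n ` closure U)" if "n \<in> {1..N}" for n
  proof (rule compact_continuous_image)
    have "(r n)-lipschitz_on (closure U) (\<Phi> n)"
      using contractive[OF that] by (auto simp: lipschitz_on_def contractive_similarity_def)
    then show "continuous_on (closure U) (\<Phi> n)" by (rule lipschitz_on_continuous_on)
    show "compact (closure U)" using bounded_U by (simp add: compact_closure)
  qed
  then have "closed (ifs_image N \<Phi> (closure U))"
    unfolding ifs_image_def by (intro closed_UN) (auto intro: compact_imp_closed)
  then show ?thesis unfolding G_eq using open_U by (rule open_Diff[rotated])
qed

lemma G_nonempty: "G \<noteq> {}"
  using components in_components_nonempty by blast

lemma measure_G_pos: "measure lborel G > 0"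
proof -
  have "emeasure lborel G \<noteq> 0"
  proof
    assume "emeasure lborel G = 0"
    then have "G \<in> null_sets lebesgue" using open_G by (intro null_sets_completionI) auto
    then show False using open_not_negligible[OF open_G G_nonempty] by (simp add: negligible_iff_null_sets)
  qed
  moreover have "emeasure lborel G < \<infinity>" by (rule emeasure_bounded_finite[OF bounded_G])
  ultimately show ?thesis
    by (simp add: measure_def enn2real_positive_iff zero_less_iff_neq_zero)
qed

lemma similarity_word_map: "v \<in> lists {1..N} \<Longrightarrow> similarity (word_ratio r v) (word_map \<Phi> v)"
proof (induction v)
  case (Cons n v)
  then have "similarity (r n) (\<Phi> n)" "similarity (word_ratio r v) (word_map \<Phi> v)"
    by (auto intro: similarity_\<Phi> simp del: atLeastAtMost_iff)
  then show ?case using similarity_compose by (simp only: word_map_simps word_ratio_simps)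
qed (simp add: similarity_id)

lemma word_ratio_pos: "v \<in> lists {1..N} \<Longrightarrow> 0 < word_ratio r v"
  using similarity_word_map by (auto simp: similarity_def)

lemma word_ratio_le_1: "v \<in> lists {1..N} \<Longrightarrow> word_ratio r v \<le> 1"
proof (induction v)
  case (Cons n v)
  then have "r n \<le> 1" "0 \<le> word_ratio r v" "word_ratio r v \<le> 1"
    using r_less_1[of n] word_ratio_pos[of v] by (auto intro: less_imp_le simp del: atLeastAtMost_iff)
  then show ?case by (simp add: mult_le_one)
qed simp

lemma word_map_subset: "v \<in> lists {1..N} \<Longrightarrow> word_map \<Phi> v ` U \<subseteq> U"
proof (induction v)
  case (Cons n v)
  then have "\<Phi> n ` word_map \<Phi> v ` U \<subseteq> \<Phi> n ` U" by (intro image_mono) auto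
  also have "\<dots> \<subseteq> U" using Cons feasible by (auto simp: feasible_open_set_def)
  finally show ?case by (simp add: image_comp)
qed simp

lemma word_map_Cons_subset:
  assumes "n # v \<in> lists {1..N}"
  shows "word_map \<Phi> (n # v) ` G \<subseteq> \<Phi> n ` U"
proof -
  have "word_map \<Phi> v ` G \<subseteq> U" using assms word_map_subset[of v] G_subset_U by auto
  then show ?thesis by (auto simp: image_subset_iff)
qed

lemma generator_disjoint:
  assumes "n # v \<in> lists {1..N}"
  shows "G \<inter> word_map \<Phi> (n # v) ` G = {}"
proof -
  have "n \<in> {1..N}" using assms by simp
  then have "\<Phi> n ` U \<subseteq> ifs_image N \<Phi> (closure U)"
    unfolding ifs_image_def using closure_subset[of U] by blast
  then show ?thesis using word_map_Cons_subset[OF assms] G_eq by blast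
qed

text \<open>A common first letter is stripped by injectivity; different first letters place the
  tiles in disjoint images of \<open>U\<close>; and a nonempty word against the empty one is settled
  because \<open>G\<close> omits all first-level images.\<close>

lemma tile_disjoint:
  "u \<in> lists {1..N} \<Longrightarrow> v \<in> lists {1..N} \<Longrightarrow> u \<noteq> v \<Longrightarrow> word_map \<Phi> u ` G \<inter> word_map \<Phi> v ` G = {}"
proof (induction u arbitrary: v)
  case Nil
  then obtain m v' where v: "v = m # v'" by (cases v) auto
  have "word_map \<Phi> [] ` G = G" by simp
  then show ?case using generator_disjoint[of m v'] Nil unfolding v by metis
next
  case (Cons n u)
  show ?case
  proof (cases v)
    case Nil
    then have "word_map \<Phi> v ` G = G" by simp
    then show ?thesis using generator_disjoint[OF Cons.prems(1)] by (metis Int_commute)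
  next
    case v: (Cons m v')
    show ?thesis
    proof (cases "n = m")
      case True
      then have "word_map \<Phi> u ` G \<inter> word_map \<Phi> v' ` G = {}"
        using Cons.prems v by (intro Cons.IH) auto
      moreover have "inj (\<Phi> n)"
        using Cons.prems(1) by (intro similarity_inj[OF similarity_\<Phi>]) (simp del: atLeastAtMost_iff)
      ultimately have "\<Phi> n ` word_map \<Phi> u ` G \<inter> \<Phi> n ` word_map \<Phi> v' ` G = {}"
        by (metis image_Int image_empty)
      then show ?thesis using True v by (simp add: image_comp)
    next
      case False
      have "n \<in> {1..N}" "m \<in> {1..N}" using Cons.prems v by auto
      then have "\<Phi> n ` U \<inter> \<Phi> m ` U = {}"
        using False feasible unfolding feasible_open_set_def by blast
      then show ?thesis
        using word_map_Cons_subset[OF Cons.prems(1)] word_map_Cons_subset[of m v'] Cons.prems(2)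
        unfolding v by blast
    qed
  qed
qed

lemma w_in_lists: "w j \<in> lists {1..N}" and inj_w: "inj w" and bij_w: "bij_betw w UNIV (lists {1..N})"
  using ordering by (auto simp: word_ordering_def bij_betw_def)

lemma l_pos: "0 < l j" and l_le_1: "l j \<le> 1"
  using word_ratio_pos[OF w_in_lists] word_ratio_le_1[OF w_in_lists] by (auto simp: fractal_string_def)

lemma open_tile: "open (tile \<Phi> w G j)"
  unfolding tile_def by (rule similarity_open_image[OF similarity_word_map[OF w_in_lists] open_G])

lemma disjoint_tiles: "disjoint_family (tile \<Phi> w G)"
  using tile_disjoint[OF w_in_lists w_in_lists] inj_w
  by (auto simp: disjoint_family_on_def tile_def inj_eq)

lemma bounded_tiles: "bounded (\<Union>j. tile \<Phi> w G j)"
proof (rule bounded_subset[OF bounded_U])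
  show "(\<Union>j. tile \<Phi> w G j) \<subseteq> U"
    using word_map_subset[OF w_in_lists] G_subset_U unfolding tile_def by blast
qed

lemma tiling_volume_sums:
  "(\<lambda>j. l j ^ DIM('a) * inner_volume G (\<epsilon> / l j)) sums tiling_volume \<Phi> w G \<epsilon>"
proof -
  have "inner_volume (tile \<Phi> w G j) \<epsilon> = l j ^ DIM('a) * inner_volume G (\<epsilon> / l j)" for j
    unfolding tile_def fractal_string_def
    by (rule inner_volume_similarity_image[OF similarity_word_map[OF w_in_lists] open_G bounded_G])
  then show ?thesis
    using inner_volume_sums[OF open_tile disjoint_tiles bounded_tiles, of \<epsilon>] by (simp add: tiling_volume_def)
qed

text \<open>The disjoint tiles lie in a bounded set, so their volumes have a finite sum, and
  \<open>G\<close> has positive volume. Convergence at the exponent \<open>DIM('a)\<close> is thus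
  obtained geometrically, without the equation that determines the abscissa.\<close>

lemma summable_l_dim: "summable (\<lambda>j. l j ^ DIM('a))"
proof -
  have "measure lborel (tile \<Phi> w G j) = l j ^ DIM('a) * measure lborel G" for j
    unfolding tile_def fractal_string_def
    by (rule measure_similarity_image[OF similarity_word_map[OF w_in_lists] open_G])
  moreover have "(\<lambda>j. measure lborel (tile \<Phi> w G j)) sums measure lborel (\<Union>j. tile \<Phi> w G j)"
    using open_tile disjoint_tiles emeasure_bounded_finite[OF bounded_tiles] by (intro measure_UNION) auto
  ultimately have "summable (\<lambda>j. l j ^ DIM('a) * measure lborel G)"
    by (simp add: sums_iff)
  from summable_divide[OF this, of "measure lborel G"] show ?thesis using measure_G_pos by simp
qed

lemma finite_l_ge: "e > 0 \<Longrightarrow> finite {j. l j \<ge> e}"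
proof -
  assume "e > 0"
  have "(\<lambda>j. l j ^ DIM('a)) \<longlonglongrightarrow> 0" by (rule summable_LIMSEQ_zero[OF summable_l_dim])
  moreover have "e ^ DIM('a) > 0" using \<open>e > 0\<close> by simp
  ultimately have "\<forall>\<^sub>F j in sequentially. l j ^ DIM('a) < e ^ DIM('a)" by (rule order_tendstoD)
  then have "\<forall>\<^sub>F j in sequentially. \<not> l j \<ge> e"
    by eventually_elim (use \<open>e > 0\<close> in \<open>auto dest: power_mono[of e _ "DIM('a)"]\<close>)
  then obtain M where "\<And>j. j \<ge> M \<Longrightarrow> \<not> l j \<ge> e" by (auto simp: eventually_sequentially)
  then have "{j. l j \<ge> e} \<subseteq> {..<M}" by (auto simp: not_le[symmetric])
  then show ?thesis by (rule finite_subset) simp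
qed

end

subsection \<open>The zeta function of a self-similar string\<close>

text \<open>The identity theorem, applied to the difference with its removable singularities
  removed, gives equality in a punctured neighbourhood of every point. The normalisation then fixes
  the values themselves: 0 at poles and the limit elsewhere.\<close>

lemma nicely_meromorphic_eqI:
  assumes f: "f nicely_meromorphic_on UNIV" and h: "h nicely_meromorphic_on UNIV"
    and X: "open X" "X \<noteq> {}" and eq: "\<And>z. z \<in> X \<Longrightarrow> f z = h z"
  shows "f = h"
proof -
  have mero: "(\<lambda>z. f z - h z) meromorphic_on UNIV"
    using f h by (auto simp: nicely_meromorphic_on_def intro!: meromorphic_intros)
  define D where "D = remove_sings (\<lambda>z. f z - h z)"
  have D: "D nicely_meromorphic_on UNIV"
    unfolding D_def by (rule remove_sings_nicely_meromorphic[OF mero])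
  obtain x where x: "x \<in> X" using X by blast
  have "\<forall>\<^sub>F z in at x. D z = 0"
  proof -
    have "\<forall>\<^sub>F z in at x. z \<in> X" using eventually_at_in_open'[OF X(1) x] .
    moreover have "D z = 0" if "z \<in> X" for z
    proof -
      have "\<forall>\<^sub>F y in at z. f y - h y = 0"
        using eventually_at_in_open'[OF X(1) that] by eventually_elim (simp add: eq)
      then show ?thesis unfolding D_def
        by (intro remove_sings_eqI tendsto_eventually)
    qed
    ultimately show ?thesis by (auto elim: eventually_mono)
  qed
  then have "\<exists>\<^sub>F z in at x. D z = 0" by (rule eventually_frequently[OF at_neq_bot])
  from frequently_eq_meromorphic_imp_constant[OF this D]
  have D0: "D z = 0" for z by auto
  have ev: "\<forall>\<^sub>F y in at z. f y = h y" for z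
  proof -
    have "isolated_singularity_at (\<lambda>z. f z - h z) z" "not_essential (\<lambda>z. f z - h z) z"
      using mero by (auto intro: meromorphic_on_isolated_singularity meromorphic_on_not_essential meromorphic_on_subset)
    then have "\<forall>\<^sub>F y in at z. D y = f y - h y"
      unfolding D_def by (intro eventually_remove_sings_eq_at)
    then show ?thesis by eventually_elim (simp add: D0)
  qed
  show ?thesis
  proof
    fix z
    have pole: "is_pole f z \<longleftrightarrow> is_pole h z" by (intro is_pole_cong ev refl)
    have lim: "(f \<longlongrightarrow> c) (at z) \<longleftrightarrow> (h \<longlongrightarrow> c) (at z)" for c by (intro tendsto_cong ev)
    have *: "f z = h z" if "is_pole f z"
      using f h that pole by (metis UNIV_I is_pole_zero_at_nicely_mero)
    show "f z = h z"
    proof (cases "is_pole f z")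
      case False
      then have "(f \<longlongrightarrow> f z) (at z)" "(h \<longlongrightarrow> h z) (at z)"
        using f h pole by (auto simp: nicely_meromorphic_on_def)
      then show ?thesis using lim LIM_unique by blast
    qed (use * in auto)
  qed
qed

text \<open>Resolves the definite description: any candidate is the extension as soon as the
  prescribed region contains a nonempty open set.\<close>

lemma meromorphic_extension_eqI:
  assumes "h nicely_meromorphic_on UNIV" and "\<And>s. s \<in> A \<Longrightarrow> h s = f s"
    and "open X" "X \<noteq> {}" "X \<subseteq> A"
  shows "meromorphic_extension f A = h"
  unfolding meromorphic_extension_def
proof (rule the_equality)
  fix k assume "k nicely_meromorphic_on UNIV \<and> (\<forall>s\<in>A. k s = f s)"
  then show "k = h" using assms by (intro nicely_meromorphic_eqI[of k h X]) auto
qed (use assms in auto)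

text \<open>The Dirichlet polynomial of the Moran equation \<open>ratio_sum N r s = 1\<close>; the
  solutions of this equation are the poles of the zeta function.\<close>

definition ratio_sum :: "nat \<Rightarrow> (nat \<Rightarrow> real) \<Rightarrow> complex \<Rightarrow> complex" where
  "ratio_sum N r s = (\<Sum>n\<in>{1..N}. of_real (r n) powr s)"

text \<open>A word is empty or a letter followed by a word, so the sum \<open>Z\<close> over all
  words satisfies \<open>Z = 1 + ratio_sum N r s * Z\<close>. Unordered summation frees the argument
  from the enumeration \<open>w\<close>, and absolute convergence justifies the passage.\<close>

lemma word_series_eq:
  assumes r: "\<And>n. n \<in> {1..N} \<Longrightarrow> 0 < r n" and w: "bij_betw w UNIV (lists {1..N})"
    and pos: "\<And>j. 0 < word_ratio r (w j)"
    and sm: "summable (\<lambda>j. word_ratio r (w j) powr Re s)"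
  shows "(\<Sum>j. of_real (word_ratio r (w j)) powr s) * (1 - ratio_sum N r s) = 1"
proof -
  define Z where "Z = (\<Sum>j. of_real (word_ratio r (w j)) powr s)"
  define f where "f = (\<lambda>v. complex_of_real (word_ratio r v) powr s)"
  have "summable (\<lambda>j. norm (f (w j)))"
  proof -
    have "norm (f (w j)) = word_ratio r (w j) powr Re s" for j
      using pos[of j] by (simp add: f_def norm_powr_real_powr)
    then show ?thesis using sm by simp
  qed
  moreover from this have "(\<lambda>j. f (w j)) sums Z"
    unfolding Z_def f_def by (intro summable_sums) (rule summable_norm_cancel)
  ultimately have "((\<lambda>j. f (w j)) has_sum Z) UNIV" by (rule norm_summable_imp_has_sum)
  then have Z: "(f has_sum Z) (lists {1..N})" using has_sum_reindex_bij_betw[OF w] by blast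
  have pos': "0 < word_ratio r v" if "v \<in> lists {1..N}" for v
    using that w pos unfolding bij_betw_def by (metis imageE)
  have cons: "(f has_sum (of_real (r n) powr s * Z)) ((#) n ` lists {1..N})" if n: "n \<in> {1..N}" for n
  proof (subst has_sum_reindex)
    have "f (n # v) = of_real (r n) powr s * f v" if "v \<in> lists {1..N}" for v
      using r[OF n] pos'[OF that] by (simp add: f_def powr_times_real less_imp_le)
    then have "((\<lambda>v. f (n # v)) has_sum (of_real (r n) powr s * Z)) (lists {1..N})
        \<longleftrightarrow> ((\<lambda>v. of_real (r n) powr s * f v) has_sum (of_real (r n) powr s * Z)) (lists {1..N})"
      by (intro has_sum_cong)
    then show "(f \<circ> (#) n has_sum (of_real (r n) powr s * Z)) (lists {1..N})"
      using has_sum_cmult_right[OF Z] by (simp add: o_def)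
  qed simp
  have "(f has_sum (\<Sum>n\<in>{1..N}. of_real (r n) powr s * Z)) (\<Union>n\<in>{1..N}. (#) n ` lists {1..N})"
    by (rule sum_has_sum) (use cons in auto)
  moreover have "(f has_sum 1) {[]}" using has_sum_finite[of "{[]}" f] by (simp add: f_def word_ratio_def)
  ultimately have "(f has_sum (1 + (\<Sum>n\<in>{1..N}. of_real (r n) powr s * Z))) ({[]} \<union> (\<Union>n\<in>{1..N}. (#) n ` lists {1..N}))"
    by (intro has_sum_Un_disjoint) auto
  moreover have "{[]} \<union> (\<Union>n\<in>{1..N}. (#) n ` lists {1..N}) = lists {1..N}"
  proof (intro equalityI subsetI)
    fix v assume "v \<in> lists {1..N}"
    then show "v \<in> {[]} \<union> (\<Union>n\<in>{1..N}. (#) n ` lists {1..N})" by (cases v) auto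
  qed auto
  ultimately have "Z = 1 + (\<Sum>n\<in>{1..N}. of_real (r n) powr s * Z)"
    using has_sum_unique[OF Z] by simp
  then have "Z = 1 + ratio_sum N r s * Z" by (simp add: ratio_sum_def sum_distrib_right)
  then show ?thesis unfolding Z_def[symmetric] by (simp add: algebra_simps)
qed

lemma holomorphic_ratio_sum:
  assumes "\<And>n. n \<in> {1..N} \<Longrightarrow> 0 < r n"
  shows "ratio_sum N r holomorphic_on X"
  unfolding ratio_sum_def by (intro holomorphic_intros)

text \<open>The reciprocal of an entire function; the convention \<open>inverse 0 = 0\<close>
  assigns to the poles exactly the value that the normalisation demands.\<close>

lemma geometric_zeta_nicely_meromorphic:
  assumes "\<And>n. n \<in> {1..N} \<Longrightarrow> 0 < r n"
  shows "(\<lambda>s. inverse (1 - ratio_sum N r s)) nicely_meromorphic_on UNIV"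
  using assms by (intro nicely_meromorphic_on_inverse analytic_on_imp_nicely_meromorphic_on)
    (auto simp: analytic_on_open intro!: holomorphic_intros holomorphic_ratio_sum)

lemma ratio_sum_0: "(\<And>n. n \<in> {1..N} \<Longrightarrow> 0 < r n) \<Longrightarrow> ratio_sum N r 0 = of_nat N"
proof -
  assume r: "\<And>n. n \<in> {1..N} \<Longrightarrow> 0 < r n"
  have "ratio_sum N r 0 = (\<Sum>n\<in>{1..N}. 1)"
    unfolding ratio_sum_def by (intro sum.cong refl) (use r in \<open>force simp del: atLeastAtMost_iff\<close>)
  then show ?thesis by simp
qed

text \<open>The value \<open>N \<ge> 2\<close> at 0 shows that the entire function
  \<open>ratio_sum N r\<close> is not constantly 1, so the points where it equals 1 are
  isolated.\<close>

lemma finite_ratio_sum_eq_1: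
  assumes "N \<ge> 2" "\<And>n. n \<in> {1..N} \<Longrightarrow> 0 < r n" "compact K"
  shows "finite {s \<in> K. ratio_sum N r s = 1}"
proof -
  have not_const: "\<not> (\<lambda>s. 1 - ratio_sum N r s) constant_on UNIV"
    if "ratio_sum N r z = 1" for z
  proof
    assume "(\<lambda>s. 1 - ratio_sum N r s) constant_on UNIV"
    then obtain c where "\<And>s. 1 - ratio_sum N r s = c" by (auto simp: constant_on_def)
    from this[of z] this[of 0] that have "of_nat N = (1::complex)" using ratio_sum_0[of N r] assms(2) by auto
    then show False using assms(1) by simp
  qed
  show ?thesis
  proof (cases "\<exists>z. ratio_sum N r z = 1")
    case True
    then have "finite {s \<in> K. 1 - ratio_sum N r s = 0}"
      using not_const assms by (intro holomorphic_compact_finite_zeros[where S = UNIV])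
        (auto intro!: holomorphic_intros holomorphic_ratio_sum)
    then show ?thesis by (auto elim: rev_finite_subset)
  qed auto
qed

lemma is_pole_inverse_ratio_sum_iff:
  assumes "N \<ge> 2" "\<And>n. n \<in> {1..N} \<Longrightarrow> 0 < r n"
  shows "is_pole (\<lambda>s. inverse (1 - ratio_sum N r s)) z \<longleftrightarrow> ratio_sum N r z = 1"
proof
  have hol: "(\<lambda>s. 1 - ratio_sum N r s) holomorphic_on UNIV"
    using assms(2) by (auto intro!: holomorphic_intros holomorphic_ratio_sum)
  have lim: "(\<lambda>s. 1 - ratio_sum N r s) \<midarrow>z\<rightarrow> 1 - ratio_sum N r z"
    using holomorphic_on_imp_continuous_on[OF hol] by (simp add: continuous_on_def)
  assume pole: "is_pole (\<lambda>s. inverse (1 - ratio_sum N r s)) z"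
  show "ratio_sum N r z = 1"
  proof (rule ccontr)
    assume "ratio_sum N r z \<noteq> 1"
    then have "(\<lambda>s. inverse (1 - ratio_sum N r s)) \<midarrow>z\<rightarrow> inverse (1 - ratio_sum N r z)"
      by (intro tendsto_inverse lim) auto
    then show False using pole
      by (meson at_neq_bot is_pole_def not_tendsto_and_filterlim_at_infinity)
  qed
next
  have hol: "(\<lambda>s. 1 - ratio_sum N r s) holomorphic_on UNIV"
    using assms(2) by (auto intro!: holomorphic_intros holomorphic_ratio_sum)
  have lim: "(\<lambda>s. 1 - ratio_sum N r s) \<midarrow>z\<rightarrow> 1 - ratio_sum N r z"
    using holomorphic_on_imp_continuous_on[OF hol] by (simp add: continuous_on_def)
  assume z: "ratio_sum N r z = 1"
  have "finite {s \<in> cball z 1. ratio_sum N r s = 1}"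
    using assms by (intro finite_ratio_sum_eq_1) auto
  then have "open (- ({s \<in> cball z 1. ratio_sum N r s = 1} - {z}))"
    by (intro open_Compl finite_imp_closed) simp
  then have "\<forall>\<^sub>F s in at z. s \<in> - ({s \<in> cball z 1. ratio_sum N r s = 1} - {z})"
    by (rule eventually_at_in_open') simp
  moreover have "\<forall>\<^sub>F s in at z. s \<in> ball z 1 - {z}"
    by (intro eventually_at_in_open) auto
  ultimately have ev: "\<forall>\<^sub>F s in at z. 1 - ratio_sum N r s \<noteq> 0"
    by eventually_elim auto
  then have "filterlim (\<lambda>s. 1 - ratio_sum N r s) (at 0) (at z)"
    using lim z by (simp add: filterlim_at)
  then show "is_pole (\<lambda>s. inverse (1 - ratio_sum N r s)) z"
    unfolding is_pole_def by (rule filterlim_compose[OF filterlim_inverse_at_infinity])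
qed

subsection \<open>The tubular zeta function\<close>

lemma residue_add_meromorphic:
  assumes "f meromorphic_on UNIV" "h meromorphic_on UNIV"
  shows "residue (\<lambda>s. f s + h s) z = residue f z + residue h z"
proof -
  have "isolated_singularity_at f z" "isolated_singularity_at h z"
    using assms by (auto intro: meromorphic_on_isolated_singularity meromorphic_on_subset)
  then obtain e1 e2 where "e1 > 0" "f analytic_on ball z e1 - {z}" "e2 > 0" "h analytic_on ball z e2 - {z}"
    unfolding isolated_singularity_at_def by blast
  then show ?thesis
    by (intro residue_add[of "ball z (min e1 e2)"])
       (auto intro!: analytic_imp_holomorphic elim: analytic_on_subset)
qed

lemma residue_sum_meromorphic:
  assumes "finite I" "\<And>i. i \<in> I \<Longrightarrow> f i meromorphic_on UNIV"
  shows "residue (\<lambda>s. \<Sum>i\<in>I. f i s) z = (\<Sum>i\<in>I. residue (f i) z)"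
  using assms
proof (induction rule: finite_induct)
  case (insert i I)
  then have "residue (\<lambda>s. f i s + (\<Sum>i\<in>I. f i s)) z = residue (f i) z + residue (\<lambda>s. \<Sum>i\<in>I. f i s) z"
    by (intro residue_add_meromorphic meromorphic_on_sum) auto
  then show ?case using insert by simp
qed (simp add: residue_const)

lemma entire_imp_meromorphic: "f holomorphic_on UNIV \<Longrightarrow> f meromorphic_on A"
  by (rule meromorphic_on_subset[OF analytic_on_imp_meromorphic_on subset_UNIV])
     (simp add: analytic_on_open)

section \<open>Convergence and poles of the geometric zeta function\<close>

context self_similar_tiling
begin

abbreviation "g \<equiv> inradius G"
abbreviation "D \<equiv> convergence_abscissa l"

lemma g_pos: "g > 0" and inner_volume_ge_g: "g \<le> \<epsilon> \<Longrightarrow> inner_volume G \<epsilon> = measure lborel G"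
  using inradius[OF open_G bounded_G G_nonempty] by (auto simp: inner_volume_def)

lemma summable_l_powr_dim: "summable (\<lambda>j. l j powr real DIM('a))"
  using summable_l_dim l_pos by (simp add: powr_realpow)

text \<open>For exponents at most 0 every term is at least 1. This bounds the set of admissible
  exponents from below, so that its infimum, the abscissa, is meaningful.\<close>

lemma summable_l_powr_pos:
  assumes "summable (\<lambda>j. l j powr \<sigma>)"
  shows "\<sigma> > 0"
proof (rule ccontr)
  assume "\<not> \<sigma> > 0"
  then have "1 \<le> l j powr \<sigma>" for j
    using powr_mono'[of \<sigma> 0 "l j"] l_pos[of j] l_le_1[of j] by simp
  moreover have "\<forall>\<^sub>F j in sequentially. l j powr \<sigma> < 1"
    using summable_LIMSEQ_zero[OF assms] by (rule order_tendstoD) simp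
  ultimately show False by (auto simp: eventually_sequentially not_less[symmetric])
qed

lemma D_le_d: "D \<le> real DIM('a)"
  unfolding convergence_abscissa_def
  by (rule cInf_lower) (use summable_l_powr_dim summable_l_powr_pos in \<open>auto intro!: bdd_belowI[of _ 0] less_imp_le\<close>)

lemma summable_l_powr:
  assumes "\<sigma> > D"
  shows "summable (\<lambda>j. l j powr \<sigma>)"
proof -
  obtain \<tau> where \<tau>: "summable (\<lambda>j. l j powr \<tau>)" "\<tau> < \<sigma>"
    using cInf_lessD[of "{\<sigma>. summable (\<lambda>j. l j powr \<sigma>)}" \<sigma>] assms summable_l_powr_dim
    unfolding convergence_abscissa_def by blast
  show ?thesis
  proof (rule summable_comparison_test'[OF \<tau>(1)])
    show "norm (l j powr \<sigma>) \<le> l j powr \<tau>" for j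
      using powr_mono'[of \<tau> \<sigma> "l j"] l_pos[of j] l_le_1[of j] \<tau>(2) by simp
  qed
qed

abbreviation "\<zeta> \<equiv> geometric_zeta l"

lemma zeta_series:
  assumes "summable (\<lambda>j. l j powr Re s)"
  shows "summable (\<lambda>j. of_real (l j) powr s :: complex)"
    and "(\<Sum>j. of_real (l j) powr s) * (1 - ratio_sum N r s) = 1"
proof -
  have "norm (of_real (l j) powr s :: complex) = l j powr Re s" for j
    using l_pos[of j] by (simp add: norm_powr_real_powr)
  then show "summable (\<lambda>j. of_real (l j) powr s :: complex)"
    using assms by (intro summable_norm_cancel[of "\<lambda>j. of_real (l j) powr s"]) simp
  show "(\<Sum>j. of_real (l j) powr s) * (1 - ratio_sum N r s) = 1"
    using word_series_eq[of N r w s, OF r_pos bij_w] l_pos assms by (simp add: fractal_string_def)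
qed

lemma zeta_eq: "\<zeta> = (\<lambda>s. inverse (1 - ratio_sum N r s))"
  unfolding geometric_zeta_def
proof (rule meromorphic_extension_eqI[where X = "{s. Re s > D}"])
  show "(\<lambda>s. inverse (1 - ratio_sum N r s)) nicely_meromorphic_on UNIV"
    by (rule geometric_zeta_nicely_meromorphic[OF r_pos])
  show "inverse (1 - ratio_sum N r s) = (\<Sum>j. of_real (l j) powr s)" if "s \<in> {s. Re s > D}" for s
    using zeta_series(2)[of s] summable_l_powr[of "Re s"] that
    by (metis inverse_unique mem_Collect_eq mult.commute)
  show "{s. Re s > D} \<noteq> {}" by (auto intro: exI[of _ "of_real (D + 1)"])
qed (auto simp: open_halfspace_Re_gt)

lemma zeta_sums:
  assumes "summable (\<lambda>j. l j powr Re s)"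
  shows "(\<lambda>j. of_real (l j) powr s) sums \<zeta> s"
proof -
  have "inverse (1 - ratio_sum N r s) = (\<Sum>j. of_real (l j) powr s)"
    using zeta_series(2)[OF assms] by (intro inverse_unique) (simp add: mult.commute)
  then show ?thesis
    using summable_sums[OF zeta_series(1)[OF assms]] by (simp add: zeta_eq)
qed

text \<open>\<open>D_le_d\<close> is not strict, so agreement with the series to the right of
  \<open>D\<close> is not enough here; convergence at the point \<open>DIM('a)\<close> itself, known
  from the tile volumes, is used instead.\<close>

lemma zeta_dim: "\<zeta> (of_nat DIM('a)) = of_real (\<Sum>j. l j ^ DIM('a))"
proof -
  have "(\<lambda>j. complex_of_real (l j) powr of_nat DIM('a)) sums \<zeta> (of_nat DIM('a))"
    by (rule zeta_sums) (simp add: summable_l_powr_dim)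
  moreover have "complex_of_real (l j) powr of_nat DIM('a) = of_real (l j ^ DIM('a))" for j
    using l_pos[of j] by (simp add: powr_nat)
  moreover have "(\<lambda>j. complex_of_real (l j ^ DIM('a))) sums of_real (\<Sum>j. l j ^ DIM('a))"
    using summable_l_dim by (intro sums_of_real summable_sums)
  ultimately show ?thesis by (simp add: sums_unique2)
qed

lemma is_pole_zeta_iff: "is_pole \<zeta> s \<longleftrightarrow> ratio_sum N r s = 1"
  unfolding zeta_eq by (rule is_pole_inverse_ratio_sum_iff[OF N r_pos])

text \<open>Where the series converges, its product with \<open>1 - ratio_sum N r s\<close> is 1; at
  a pole this product would be 0.\<close>

lemma Re_pole_zeta: "is_pole \<zeta> s \<Longrightarrow> Re s \<le> D"
proof (rule ccontr)
  assume pole: "is_pole \<zeta> s" and "\<not> Re s \<le> D"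
  then have "(\<Sum>j. of_real (l j) powr s) * (1 - ratio_sum N r s) = 1"
    by (intro zeta_series summable_l_powr) simp
  moreover have "ratio_sum N r s = 1" using pole by (simp only: is_pole_zeta_iff)
  ultimately show False by simp
qed

lemma zeta_meromorphic: "\<zeta> meromorphic_on A"
proof (rule meromorphic_on_subset[OF _ subset_UNIV])
  show "\<zeta> meromorphic_on UNIV"
    using geometric_zeta_nicely_meromorphic[OF r_pos] by (simp add: zeta_eq nicely_meromorphic_on_def)
qed

lemma zeta_holomorphic: "\<zeta> holomorphic_on {s. \<not> is_pole \<zeta> s}"
proof -
  have "{s. \<not> is_pole \<zeta> s} = {s. ratio_sum N r s \<noteq> 1}" by (simp add: is_pole_zeta_iff)
  then show ?thesis
    by (auto simp: zeta_eq intro!: holomorphic_intros holomorphic_ratio_sum r_pos)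
qed

lemma finite_zeta_poles: "compact K \<Longrightarrow> finite {s \<in> K. is_pole \<zeta> s}"
  unfolding is_pole_zeta_iff by (rule finite_ratio_sum_eq_1[OF N r_pos])

end

section \<open>Steiner-like coefficients and the tubular zeta function\<close>

locale tiling_expansion = self_similar_tiling \<Phi> r N U G w
  for \<Phi> :: "nat \<Rightarrow> 'a::euclidean_space \<Rightarrow> 'a" and r N U G w +
  fixes \<kappa> :: "nat \<Rightarrow> real \<Rightarrow> real"
  assumes steiner: "steiner_like G \<kappa>"
begin

text \<open>The tiles whose inradius \<open>l j * g\<close> is at least \<open>\<epsilon>\<close>.
  Every other tile coincides with its own inner parallel set.\<close>

definition big :: "real \<Rightarrow> nat set" where
  "big \<epsilon> = {j. \<epsilon> / l j \<le> g}"

lemma finite_big: "\<epsilon> > 0 \<Longrightarrow> finite (big \<epsilon>)"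
proof -
  assume "\<epsilon> > 0"
  then have "finite {j. l j \<ge> \<epsilon> / g}" using g_pos by (intro finite_l_ge) auto
  moreover have "big \<epsilon> = {j. l j \<ge> \<epsilon> / g}"
    using g_pos l_pos by (auto simp: big_def field_simps)
  ultimately show ?thesis by simp
qed

lemma inner_volume_steiner: "0 < \<epsilon> \<Longrightarrow> \<epsilon> \<le> g \<Longrightarrow> inner_volume G \<epsilon> = (\<Sum>k\<le>DIM('a). \<kappa> k \<epsilon> * \<epsilon> ^ (DIM('a) - k))"
  using steiner by (auto simp: steiner_like_def)

text \<open>At the inradius the inner parallel set is all of \<open>G\<close>. This relation among
  the constants \<open>\<kappa> k g\<close> removes the volume of \<open>G\<close> from the error
  integrand.\<close>

lemma measure_G: "measure lborel G = (\<Sum>k\<le>DIM('a). \<kappa> k g * g ^ (DIM('a) - k))"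
  using inner_volume_steiner[of g] inner_volume_ge_g[of g] g_pos by simp

abbreviation "E \<equiv> error_integrand G \<kappa> l"

text \<open>The coefficient functions deviate from their constant extension only on the finitely many
  tiles of inradius at least \<open>\<epsilon>\<close>. These tiles contribute to the tubular zeta function the
  summands below, which have simple poles at the integer dimensions.\<close>

definition correction_numerator :: "real \<Rightarrow> nat \<Rightarrow> complex \<Rightarrow> complex" where
  "correction_numerator \<epsilon> k s = of_real \<epsilon> powr (of_nat DIM('a) - s) * (\<Sum>j\<in>big \<epsilon>. of_real (l j) powr s *
     (of_real g powr (s - of_nat k) * of_real (\<kappa> k (\<epsilon> / l j) - \<kappa> k g)))"

definition correction :: "real \<Rightarrow> complex \<Rightarrow> complex" where
  "correction \<epsilon> s = (\<Sum>k\<le>DIM('a). correction_numerator \<epsilon> k s / (s - of_nat k))"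

lemma correction_numerator_holomorphic: "correction_numerator \<epsilon> k holomorphic_on X"
  unfolding correction_numerator_def by (intro holomorphic_intros)

lemma correction_term_meromorphic:
  "(\<lambda>s. correction_numerator \<epsilon> k s / (s - of_nat k)) meromorphic_on A"
  by (intro meromorphic_on_divide meromorphic_on_diff meromorphic_on_id meromorphic_on_const
      entire_imp_meromorphic correction_numerator_holomorphic)

lemma correction_meromorphic: "correction \<epsilon> meromorphic_on A"
  unfolding correction_def by (intro meromorphic_on_sum correction_term_meromorphic)

lemma correction_holomorphic: "correction \<epsilon> holomorphic_on - of_nat ` {..DIM('a)}"
  unfolding correction_def by (intro holomorphic_intros correction_numerator_holomorphic) auto

lemma residue_correction:
  "residue (correction \<epsilon>) z = (\<Sum>k\<le>DIM('a). if z = of_nat k then correction_numerator \<epsilon> k (of_nat k) else 0)"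
proof -
  have "residue (\<lambda>s. correction_numerator \<epsilon> k s / (s - of_nat k)) z
      = (if z = of_nat k then correction_numerator \<epsilon> k (of_nat k) else 0)" for k
  proof (cases "z = of_nat k")
    case True
    then show ?thesis
      using residue_simple[OF open_UNIV UNIV_I correction_numerator_holomorphic[of \<epsilon> k UNIV]] by simp
  next
    case False
    then have "residue (\<lambda>s. correction_numerator \<epsilon> k s / (s - of_nat k)) z = 0"
      by (intro residue_holo[of "- {of_nat k}"] holomorphic_intros correction_numerator_holomorphic) auto
    with False show ?thesis by simp
  qed
  then show ?thesis
    unfolding correction_def by (subst residue_sum_meromorphic) (auto intro: correction_term_meromorphic)
qed

lemma correction_numerator_at:
  assumes "\<epsilon> > 0" "k \<le> DIM('a)"
  shows "correction_numerator \<epsilon> k (of_nat k)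
    = of_real (\<Sum>j\<in>big \<epsilon>. \<epsilon> ^ (DIM('a) - k) * l j ^ k * (\<kappa> k (\<epsilon> / l j) - \<kappa> k g))"
proof -
  have nat_powr: "complex_of_real x powr of_nat n = of_real (x ^ n)" if "x > 0" for x n
    using that by (simp add: powr_nat)
  have "of_nat DIM('a) - of_nat k = (of_nat (DIM('a) - k) :: complex)"
    using assms by (simp add: of_nat_diff)
  then have \<epsilon>_powr: "complex_of_real \<epsilon> powr (of_nat DIM('a) - of_nat k) = of_real (\<epsilon> ^ (DIM('a) - k))"
    using nat_powr[OF assms(1)] by metis
  show ?thesis
    unfolding correction_numerator_def \<epsilon>_powr nat_powr[OF l_pos]
    using g_pos by (simp add: sum_distrib_left mult.assoc)
qed

lemma error_integrand_eq:
  "E \<epsilon> s = of_real \<epsilon> powr (of_nat DIM('a) - s) * \<zeta> s / (of_nat DIM('a) - s) *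
      (\<Sum>k<DIM('a). of_real g powr (s - of_nat k) / (s - of_nat k) * of_nat (DIM('a) - k) * of_real (\<kappa> k g))"
  unfolding error_integrand_def Let_def by (rule refl)

lemma error_integrand_meromorphic: "E \<epsilon> meromorphic_on A"
proof -
  have "(\<lambda>s. of_real \<epsilon> powr (of_nat DIM('a) - s) :: complex) meromorphic_on A"
    "(\<lambda>s. of_real g powr (s - of_nat k) :: complex) meromorphic_on A" for k
    by (intro entire_imp_meromorphic holomorphic_intros)+
  then show ?thesis
    by (subst error_integrand_eq[abs_def]) (intro meromorphic_intros zeta_meromorphic)
qed

lemma error_integrand_holomorphic: "E \<epsilon> holomorphic_on - ({s. is_pole \<zeta> s} \<union> of_nat ` {..DIM('a)})"
proof -
  let ?A = "- ({s. is_pole \<zeta> s} \<union> of_nat ` {..DIM('a)})"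
  have zeta: "\<zeta> holomorphic_on ?A"
    by (rule holomorphic_on_subset[OF zeta_holomorphic]) blast
  have ne: "s \<noteq> of_nat k" if "s \<in> ?A" "k \<le> DIM('a)" for s k
    using that by blast
  have "of_nat DIM('a) - s \<noteq> 0" "k < DIM('a) \<Longrightarrow> s - of_nat k \<noteq> 0" if "s \<in> ?A" for s k
    using ne[OF that, of "DIM('a)"] ne[OF that, of k] by auto
  then show ?thesis
    by (subst error_integrand_eq[abs_def]) (intro holomorphic_intros zeta; blast)
qed

text \<open>Expanding the volume of \<open>G\<close> by \<open>measure_G\<close> puts
  \<open>g powr (s - k)\<close> into both sums. What remains is the partial fraction identity
  \<open>1/(s-k) - 1/(s-d) = (d-k) / ((s-k) * (d-s))\<close>, in which \<open>k = d\<close> drops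
  out.\<close>

lemma error_integrand_quotient:
  fixes s :: complex
  assumes "s \<notin> of_nat ` {..DIM('a)}"
  shows "(\<Sum>k<DIM('a). of_real g powr (s - of_nat k) / (s - of_nat k) * of_nat (DIM('a) - k) * of_real (\<kappa> k g)) / (of_nat DIM('a) - s)
     = (\<Sum>k\<le>DIM('a). of_real g powr (s - of_nat k) / (s - of_nat k) * of_real (\<kappa> k g))
       - of_real g powr (s - of_nat DIM('a)) / (s - of_nat DIM('a)) * of_real (measure lborel G)"
proof -
  let ?g = "complex_of_real g"
  have ne: "s \<noteq> of_nat k" if "k \<le> DIM('a)" for k using assms that by auto
  have "?g powr (s - of_nat DIM('a)) * of_real (measure lborel G) = (\<Sum>k\<le>DIM('a). ?g powr (s - of_nat k) * of_real (\<kappa> k g))"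
  proof -
    have "?g powr (s - of_nat DIM('a)) * of_real (g ^ (DIM('a) - k)) = ?g powr (s - of_nat k)" if "k \<le> DIM('a)" for k
    proof -
      have "?g powr (s - of_nat DIM('a)) * ?g powr of_nat (DIM('a) - k) = ?g powr (s - of_nat k)"
        using that by (subst powr_add[symmetric]) (simp add: of_nat_diff)
      then show ?thesis using g_pos by (simp add: powr_nat)
    qed
    then show ?thesis
      by (auto simp: measure_G sum_distrib_left mult.left_commute intro!: sum.cong)
  qed
  then have "(\<Sum>k\<le>DIM('a). ?g powr (s - of_nat k) / (s - of_nat k) * of_real (\<kappa> k g))
       - ?g powr (s - of_nat DIM('a)) / (s - of_nat DIM('a)) * of_real (measure lborel G)
     = (\<Sum>k\<le>DIM('a). ?g powr (s - of_nat k) / (s - of_nat k) * of_real (\<kappa> k g)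
            - ?g powr (s - of_nat k) * of_real (\<kappa> k g) / (s - of_nat DIM('a)))"
    by (simp add: sum_subtractf sum_divide_distrib)
  also have "\<dots> = (\<Sum>k<DIM('a). ?g powr (s - of_nat k) / (s - of_nat k) * of_real (\<kappa> k g)
            - ?g powr (s - of_nat k) * of_real (\<kappa> k g) / (s - of_nat DIM('a)))"
    by (simp add: lessThan_Suc_atMost[symmetric])
  also have "\<dots> = (\<Sum>k<DIM('a). ?g powr (s - of_nat k) / (s - of_nat k) * of_nat (DIM('a) - k) * of_real (\<kappa> k g) / (of_nat DIM('a) - s))"
  proof (intro sum.cong refl)
    fix k assume "k \<in> {..<DIM('a)}"
    then have k: "s \<noteq> of_nat k" "s \<noteq> of_nat DIM('a)" "k \<le> DIM('a)" using ne by auto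
    then have "inverse (s - of_nat k) - inverse (s - of_nat DIM('a))
        = of_nat (DIM('a) - k) * (inverse (s - of_nat k) * inverse (of_nat DIM('a) - s))"
    proof -
      have "inverse (s - of_nat DIM('a)) = - inverse (of_nat DIM('a) - s)"
        by (metis inverse_minus_eq minus_diff_eq)
      moreover have "(s - of_nat k) - (s - of_nat DIM('a)) = of_nat (DIM('a) - k)"
        using k(3) by (simp add: of_nat_diff)
      ultimately show ?thesis
        using k inverse_diff_inverse[of "s - of_nat k" "s - of_nat DIM('a)"]
        by (simp add: divide_inverse mult_ac)
    qed
    then have "?g powr (s - of_nat k) * of_real (\<kappa> k g) * (inverse (s - of_nat k) - inverse (s - of_nat DIM('a)))
       = ?g powr (s - of_nat k) * of_real (\<kappa> k g) * (of_nat (DIM('a) - k) * (inverse (s - of_nat k) * inverse (of_nat DIM('a) - s)))"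
      by simp
    then show "?g powr (s - of_nat k) / (s - of_nat k) * of_real (\<kappa> k g)
            - ?g powr (s - of_nat k) * of_real (\<kappa> k g) / (s - of_nat DIM('a))
        = ?g powr (s - of_nat k) / (s - of_nat k) * of_nat (DIM('a) - k) * of_real (\<kappa> k g) / (of_nat DIM('a) - s)"
      by (simp only: divide_inverse right_diff_distrib mult_ac)
  qed
  finally show ?thesis by (simp add: sum_divide_distrib)
qed

text \<open>Each summand splits into the part with coefficients frozen at \<open>g\<close>, in which
  the tile enters only through \<open>l j powr s\<close> and which sums to \<zeta> times a fixed
  factor, and a deviation that is nonzero at most for tiles in
  \<open>big \<epsilon>\<close>.\<close>

lemma tubular_series:
  assumes "\<epsilon> > 0" "Re s > D" "s \<notin> of_nat ` {..DIM('a)}"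
  shows "of_real \<epsilon> powr (of_nat DIM('a) - s) *
          (\<Sum>j. of_real (l j) powr s *
            ((\<Sum>k\<le>DIM('a). of_real g powr (s - of_nat k) / (s - of_nat k) *
                of_real (extended_coefficient G \<kappa> k (\<epsilon> / l j)))
             - of_real g powr (s - of_nat DIM('a)) / (s - of_nat DIM('a)) * of_real (measure lborel G)))
       = E \<epsilon> s + correction \<epsilon> s"
proof -
  let ?g = "complex_of_real g"
  define m where "m = (\<Sum>k\<le>DIM('a). ?g powr (s - of_nat k) / (s - of_nat k) * of_real (\<kappa> k g))
       - ?g powr (s - of_nat DIM('a)) / (s - of_nat DIM('a)) * of_real (measure lborel G)"
  define c where "c = (\<lambda>j. of_real (l j) powr s *
     (\<Sum>k\<le>DIM('a). ?g powr (s - of_nat k) / (s - of_nat k) * of_real (\<kappa> k (\<epsilon> / l j) - \<kappa> k g)))"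
  have summand: "of_real (l j) powr s * ((\<Sum>k\<le>DIM('a). ?g powr (s - of_nat k) / (s - of_nat k) *
                of_real (extended_coefficient G \<kappa> k (\<epsilon> / l j)))
             - ?g powr (s - of_nat DIM('a)) / (s - of_nat DIM('a)) * of_real (measure lborel G))
      = of_real (l j) powr s * m + (if j \<in> big \<epsilon> then c j else 0)" for j
    by (simp add: m_def c_def big_def extended_coefficient_def algebra_simps sum_subtractf)
  have "(\<lambda>j. of_real (l j) powr s * m + (if j \<in> big \<epsilon> then c j else 0))
      sums (\<zeta> s * m + (\<Sum>j\<in>big \<epsilon>. c j))"
    by (intro sums_add sums_mult2 zeta_sums summable_l_powr sums_If_finite_set finite_big assms)
  then have "(\<Sum>j. of_real (l j) powr s * ((\<Sum>k\<le>DIM('a). ?g powr (s - of_nat k) / (s - of_nat k) *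
                of_real (extended_coefficient G \<kappa> k (\<epsilon> / l j)))
             - ?g powr (s - of_nat DIM('a)) / (s - of_nat DIM('a)) * of_real (measure lborel G)))
     = \<zeta> s * m + (\<Sum>j\<in>big \<epsilon>. c j)"
    unfolding summand by (rule sums_unique[symmetric])
  moreover have "of_real \<epsilon> powr (of_nat DIM('a) - s) * (\<zeta> s * m) = E \<epsilon> s"
    unfolding error_integrand_eq m_def error_integrand_quotient[OF assms(3), symmetric] by simp
  moreover have "of_real \<epsilon> powr (of_nat DIM('a) - s) * (\<Sum>j\<in>big \<epsilon>. c j) = correction \<epsilon> s"
    unfolding correction_def correction_numerator_def c_def sum_distrib_left sum_divide_distrib
    by (subst sum.swap) (simp add: mult_ac)
  ultimately show ?thesis by (simp only: distrib_left)
qed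

text \<open>\<open>E \<epsilon> + correction \<epsilon>\<close> is meromorphic on the plane and
  agrees with the series; \<open>remove_sings\<close> supplies the normalised values required of the
  extension.\<close>

lemma tubular_zeta_eq:
  assumes "\<epsilon> > 0"
  shows "tubular_zeta G \<kappa> l \<epsilon> = remove_sings (\<lambda>s. E \<epsilon> s + correction \<epsilon> s)"
  unfolding tubular_zeta_def Let_def
proof (rule meromorphic_extension_eqI[where X = "{s. Re s > D \<and> s \<notin> of_nat ` {..DIM('a)}}"])
  have "(\<lambda>s. E \<epsilon> s + correction \<epsilon> s) meromorphic_on UNIV"
    by (intro meromorphic_intros error_integrand_meromorphic correction_meromorphic)
  then show "remove_sings (\<lambda>s. E \<epsilon> s + correction \<epsilon> s) nicely_meromorphic_on UNIV"
    by (rule remove_sings_nicely_meromorphic)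
  have "open ({s. Re s > D} - of_nat ` {..DIM('a)})"
    by (intro open_Diff open_halfspace_Re_gt finite_imp_closed) auto
  then show op: "open {s. Re s > D \<and> s \<notin> of_nat ` {..DIM('a)}}"
    by (simp add: set_diff_eq)
  have "of_real (\<bar>D\<bar> + real DIM('a) + 1) \<in> {s. Re s > D \<and> s \<notin> of_nat ` {..DIM('a)}}"
    by (auto simp: complex_eq_iff)
  then show "{s. Re s > D \<and> s \<notin> of_nat ` {..DIM('a)}} \<noteq> {}" by blast
  fix s assume s: "s \<in> {s. Re s > D \<and> s \<notin> of_nat ` {..DIM('a)}}"
  have "(\<lambda>s. E \<epsilon> s + correction \<epsilon> s) holomorphic_on {s. Re s > D \<and> s \<notin> of_nat ` {..DIM('a)}}"
    using Re_pole_zeta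
    by (intro holomorphic_intros holomorphic_on_subset[OF error_integrand_holomorphic]
        holomorphic_on_subset[OF correction_holomorphic]) force+
  then have "(\<lambda>s. E \<epsilon> s + correction \<epsilon> s) analytic_on {s}"
    using op s by (metis analytic_on_open analytic_on_subset empty_subsetI insert_subset)
  then show "remove_sings (\<lambda>s. E \<epsilon> s + correction \<epsilon> s) s = of_real \<epsilon> powr (of_nat DIM('a) - s) *
          (\<Sum>j. of_real (l j) powr s *
            ((\<Sum>k\<le>DIM('a). of_real g powr (s - of_nat k) / (s - of_nat k) *
                of_real (extended_coefficient G \<kappa> k (\<epsilon> / l j)))
             - of_real g powr (s - of_nat DIM('a)) / (s - of_nat DIM('a)) * of_real (measure lborel G)))"
    using s tubular_series[OF assms, of s] by simp
qed auto

lemma residue_tubular_zeta: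
  assumes "\<epsilon> > 0"
  shows "residue (tubular_zeta G \<kappa> l \<epsilon>) z = residue (E \<epsilon>) z + residue (correction \<epsilon>) z"
proof -
  have "(\<lambda>s. E \<epsilon> s + correction \<epsilon> s) meromorphic_on UNIV"
    by (intro meromorphic_intros error_integrand_meromorphic correction_meromorphic)
  then have "isolated_singularity_at (\<lambda>s. E \<epsilon> s + correction \<epsilon> s) z"
    by (auto intro: meromorphic_on_isolated_singularity meromorphic_on_subset)
  then show ?thesis
    unfolding tubular_zeta_eq[OF assms] residue_remove_sings
    by (simp add: residue_add_meromorphic error_integrand_meromorphic correction_meromorphic)
qed

end

subsection \<open>The vertical line integral\<close>

lemma powr_of_real_exp: "x > 0 \<Longrightarrow> complex_of_real x powr s = exp (s * of_real (ln x))"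
  by (simp add: powr_def Ln_of_real)

lemma norm_perron_kernel:
  assumes "y > 0"
  shows "norm (perron_kernel y k d s) = y powr Re s * norm (perron_kernel 1 k d s)"
  using assms by (simp add: perron_kernel_def norm_divide norm_powr_real_powr)

context tiling_expansion
begin

text \<open>The tile and the width enter the kernel only through the ratio
  \<open>g * l j / \<epsilon>\<close> of the inradius of the tile to the width. It is at least 1
  exactly for the tiles in \<open>big \<epsilon>\<close>.\<close>

lemma perron_kernel_term:
  assumes "\<epsilon> > 0" "k < DIM('a)"
  shows "of_real (l j) powr s * (of_real \<epsilon> powr (of_nat DIM('a) - s) / (of_nat DIM('a) - s) *
      (of_real g powr (s - of_nat k) / (s - of_nat k) * of_nat (DIM('a) - k) * of_real (\<kappa> k g)))
    = of_real (- (\<epsilon> ^ DIM('a) / g ^ k * real (DIM('a) - k) * \<kappa> k g))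
      * perron_kernel (g * l j / \<epsilon>) (real k) (real DIM('a)) s"
proof -
  have pos: "\<epsilon> > 0" "g > 0" "l j > 0" using assms g_pos l_pos by auto
  have "complex_of_real (\<epsilon> ^ DIM('a)) = exp (of_nat DIM('a) * of_real (ln \<epsilon>))"
    "complex_of_real (g ^ k) = exp (of_nat k * of_real (ln g))"
    using pos by (simp_all add: exp_of_nat_mult exp_of_real)
  moreover have "of_real (g * l j / \<epsilon>) powr s = exp (s * (of_real (ln g) + of_real (ln (l j)) - of_real (ln \<epsilon>)))"
    using pos by (subst powr_of_real_exp) (simp_all add: ln_div ln_mult)
  ultimately have "of_real (l j) powr s * (of_real \<epsilon> powr (of_nat DIM('a) - s) * of_real g powr (s - of_nat k))
     = complex_of_real (\<epsilon> ^ DIM('a)) / of_real (g ^ k) * of_real (g * l j / \<epsilon>) powr s"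
    unfolding powr_of_real_exp[OF pos(1)] powr_of_real_exp[OF pos(2)] powr_of_real_exp[OF pos(3)]
    by (simp only:) (simp add: algebra_simps flip: exp_add exp_diff)
  then have "of_real (l j) powr s * (of_real \<epsilon> powr (of_nat DIM('a) - s) * of_real g powr (s - of_nat k))
       * (of_nat (DIM('a) - k) * of_real (\<kappa> k g) * (inverse (of_nat DIM('a) - s) * inverse (s - of_nat k)))
     = complex_of_real (\<epsilon> ^ DIM('a)) / of_real (g ^ k) * of_real (g * l j / \<epsilon>) powr s
       * (of_nat (DIM('a) - k) * of_real (\<kappa> k g) * (inverse (of_nat DIM('a) - s) * inverse (s - of_nat k)))"
    by simp
  moreover have "inverse (of_nat DIM('a) - s) = - inverse (s - of_nat DIM('a))"
    by (metis inverse_minus_eq minus_diff_eq)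
  ultimately show ?thesis
    by (simp add: perron_kernel_def divide_inverse mult_ac)
qed

text \<open>Summation and integration are exchanged, which needs \<open>c > D\<close>. Perron's
  integral vanishes for ratios below 1, so the infinite series collapses to the finite sum over
  \<open>big \<epsilon>\<close>.\<close>

lemma error_integrand_line_integral:
  assumes \<epsilon>: "\<epsilon> > 0" and c: "c > real DIM('a)"
  shows "integrable lebesgue (\<lambda>t. E \<epsilon> (Complex c t))"
    and "integral\<^sup>L lebesgue (\<lambda>t. E \<epsilon> (Complex c t)) = of_real (2 * pi *
      (\<Sum>j\<in>big \<epsilon>. \<Sum>k<DIM('a). \<kappa> k g * (\<epsilon> ^ (DIM('a) - k) * l j ^ k - g ^ (DIM('a) - k) * l j ^ DIM('a))))"
proof -
  define C where "C = (\<lambda>k. - (\<epsilon> ^ DIM('a) / g ^ k * real (DIM('a) - k) * \<kappa> k g))"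
  define y where "y = (\<lambda>j. g * l j / \<epsilon>)"
  define h where "h = (\<lambda>j t. \<Sum>k<DIM('a). of_real (C k) * perron_kernel (y j) (real k) (real DIM('a)) (Complex c t))"
  \<comment> \<open>On a fixed vertical line the modulus of the kernel depends on its ratio only
    through the factor \<open>y powr c\<close>, so one function of \<open>t\<close>, times a
    summable sequence, dominates all terms.\<close>
  define W where "W = (\<lambda>t. \<Sum>k<DIM('a). \<bar>C k\<bar> * norm (perron_kernel 1 (real k) (real DIM('a)) (Complex c t)))"
  have y: "y j > 0" for j using \<epsilon> g_pos l_pos by (simp add: y_def)
  have sm: "summable (\<lambda>j. l j powr c)" using c D_le_d by (intro summable_l_powr) linarith
  have "y j powr c = (g / \<epsilon>) powr c * l j powr c" for j
    using \<epsilon> g_pos l_pos[of j] by (simp add: y_def powr_mult[symmetric])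
  then have sm_y: "summable (\<lambda>j. y j powr c)" using sm by (simp add: summable_mult)
  have h_sums: "(\<lambda>j. h j t) sums E \<epsilon> (Complex c t)" for t
  proof -
    define s where "s = Complex c t"
    define X where "X = of_real \<epsilon> powr (of_nat DIM('a) - s) / (of_nat DIM('a) - s) *
      (\<Sum>k<DIM('a). of_real g powr (s - of_nat k) / (s - of_nat k) * of_nat (DIM('a) - k) * of_real (\<kappa> k g))"
    have "of_real (l j) powr s * X = h j t" for j
      unfolding X_def h_def sum_distrib_left
      by (intro sum.cong refl) (simp only: perron_kernel_term[OF \<epsilon>] lessThan_iff C_def y_def s_def)
    moreover have "(\<lambda>j. of_real (l j) powr s * X) sums (\<zeta> s * X)"
      using sm by (intro sums_mult2 zeta_sums) (simp add: s_def)
    moreover have "\<zeta> s * X = E \<epsilon> s" by (simp add: error_integrand_eq X_def)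
    ultimately show ?thesis by (simp add: s_def)
  qed
  have int_k: "integrable lebesgue (\<lambda>t. perron_kernel z (real k) (real DIM('a)) (Complex c t))" if "k < DIM('a)" "z > 0" for k z
    using that c by (intro perron_integral) auto
  have int_h: "integrable lebesgue (h j)" for j
    unfolding h_def using y by (intro Bochner_Integration.integrable_sum integrable_mult_right int_k) auto
  have int_W: "integrable lebesgue W"
    unfolding W_def by (intro Bochner_Integration.integrable_sum integrable_mult_right integrable_norm int_k) auto
  have W_nonneg: "0 \<le> W t" for t unfolding W_def by (intro sum_nonneg) auto
  have h_le: "norm (h j t) \<le> y j powr c * W t" for j t
  proof -
    have "norm (h j t) \<le> (\<Sum>k<DIM('a). norm (of_real (C k) * perron_kernel (y j) (real k) (real DIM('a)) (Complex c t)))"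
      unfolding h_def by (rule norm_sum)
    also have "\<dots> = y j powr c * W t"
      unfolding W_def sum_distrib_left
      by (intro sum.cong refl) (simp add: norm_mult norm_perron_kernel[OF y, of j _ _ "Complex c t"])
    finally show ?thesis .
  qed
  have AE: "AE t in lebesgue. summable (\<lambda>j. norm (h j t))"
  proof (rule AE_I2)
    show "summable (\<lambda>j. norm (h j t))" for t
      by (rule summable_comparison_test'[OF summable_mult2[OF sm_y, of "W t"]]) (simp add: h_le)
  qed
  have sm_int: "summable (\<lambda>j. \<integral>t. norm (h j t) \<partial>lebesgue)"
  proof (rule summable_comparison_test'[OF summable_mult2[OF sm_y, of "integral\<^sup>L lebesgue W"]])
    fix j
    have "(\<integral>t. norm (h j t) \<partial>lebesgue) \<le> (\<integral>t. y j powr c * W t \<partial>lebesgue)"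
      by (intro integral_mono integrable_norm int_h integrable_mult_right int_W h_le)
    then show "norm (\<integral>t. norm (h j t) \<partial>lebesgue) \<le> y j powr c * integral\<^sup>L lebesgue W"
      by (simp add: abs_of_nonneg integral_nonneg)
  qed
  have E_eq: "(\<lambda>t. \<Sum>j. h j t) = (\<lambda>t. E \<epsilon> (Complex c t))"
    using h_sums by (simp add: sums_iff fun_eq_iff)
  show "integrable lebesgue (\<lambda>t. E \<epsilon> (Complex c t))"
    using integrable_suminf[OF int_h AE sm_int] unfolding E_eq .
  define v where "v = (\<lambda>j. 2 * pi * (\<Sum>k<DIM('a). \<kappa> k g * (\<epsilon> ^ (DIM('a) - k) * l j ^ k - g ^ (DIM('a) - k) * l j ^ DIM('a))))"
  have int_eq: "integral\<^sup>L lebesgue (h j) = of_real (if j \<in> big \<epsilon> then v j else 0)" for j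
  proof -
    have big_iff: "j \<in> big \<epsilon> \<longleftrightarrow> y j \<ge> 1"
      using \<epsilon> l_pos[of j] g_pos by (simp add: big_def y_def field_simps)
    have "integral\<^sup>L lebesgue (h j) = (\<Sum>k<DIM('a). of_real (C k) *
        of_real (2 * pi * (if y j \<ge> 1 then (y j powr real DIM('a) - y j powr real k) / (real DIM('a) - real k) else 0)))"
      unfolding h_def using y[of j] c
      by (subst Bochner_Integration.integral_sum) (auto intro!: sum.cong integrable_mult_right int_k simp: perron_integral(2))
    also have "\<dots> = of_real (\<Sum>k<DIM('a). C k *
        (2 * pi * (if y j \<ge> 1 then (y j powr real DIM('a) - y j powr real k) / (real DIM('a) - real k) else 0)))"
      by simp
    also have "(\<Sum>k<DIM('a). C k *
        (2 * pi * (if y j \<ge> 1 then (y j powr real DIM('a) - y j powr real k) / (real DIM('a) - real k) else 0)))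
       = (if j \<in> big \<epsilon> then v j else 0)"
    proof (cases "j \<in> big \<epsilon>")
      case True
      have "C k * (2 * pi * ((y j powr real DIM('a) - y j powr real k) / (real DIM('a) - real k)))
        = 2 * pi * (\<kappa> k g * (\<epsilon> ^ (DIM('a) - k) * l j ^ k - g ^ (DIM('a) - k) * l j ^ DIM('a)))" if k: "k < DIM('a)" for k
      proof -
        have ne: "real (DIM('a) - k) = real DIM('a) - real k" "real DIM('a) - real k \<noteq> 0" using k by auto
        have split: "x ^ DIM('a) = x ^ k * x ^ (DIM('a) - k)" for x :: real
          using k by (simp flip: power_add)
        have "C k * (2 * pi * ((y j powr real DIM('a) - y j powr real k) / (real DIM('a) - real k)))
          = 2 * pi * (\<kappa> k g * (\<epsilon> ^ DIM('a) / g ^ k * (y j ^ k - y j ^ DIM('a))))"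
        proof -
          have "- (a * x * b) * (2 * pi * ((u - v) / x)) = 2 * pi * (b * (a * (v - u)))" if "x \<noteq> 0" for a b u v x :: real
            using that by (simp add: divide_simps) (simp add: algebra_simps)
          from this[OF ne(2)] show ?thesis
            unfolding C_def ne(1) using y[of j] by (simp only: powr_realpow)
        qed
        also have "\<epsilon> ^ DIM('a) / g ^ k * (y j ^ k - y j ^ DIM('a))
            = \<epsilon> ^ (DIM('a) - k) * l j ^ k - g ^ (DIM('a) - k) * l j ^ DIM('a)"
        proof -
          have "\<epsilon> ^ DIM('a) / g ^ k * y j ^ k = \<epsilon> ^ (DIM('a) - k) * l j ^ k"
            using \<epsilon> g_pos by (simp add: split[of \<epsilon>] y_def power_mult_distrib power_divide)
          moreover have "\<epsilon> ^ DIM('a) / g ^ k * y j ^ DIM('a) = g ^ (DIM('a) - k) * l j ^ DIM('a)"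
            using \<epsilon> g_pos by (simp add: split[of g] y_def power_mult_distrib power_divide)
          ultimately show ?thesis by (simp add: right_diff_distrib)
        qed
        finally show ?thesis .
      qed
      then show ?thesis using True big_iff by (simp add: v_def sum_distrib_left)
    qed (use big_iff in simp)
    finally show ?thesis .
  qed
  have "(\<lambda>j. integral\<^sup>L lebesgue (h j)) sums integral\<^sup>L lebesgue (\<lambda>t. E \<epsilon> (Complex c t))"
    using sums_integral[OF int_h AE sm_int] unfolding E_eq .
  moreover have "(\<lambda>j. integral\<^sup>L lebesgue (h j)) sums of_real (\<Sum>j\<in>big \<epsilon>. v j)"
    unfolding int_eq by (intro sums_of_real sums_If_finite_set finite_big \<epsilon>)
  ultimately have "integral\<^sup>L lebesgue (\<lambda>t. E \<epsilon> (Complex c t)) = of_real (\<Sum>j\<in>big \<epsilon>. v j)"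
    by (rule sums_unique2)
  then show "integral\<^sup>L lebesgue (\<lambda>t. E \<epsilon> (Complex c t)) = of_real (2 * pi *
      (\<Sum>j\<in>big \<epsilon>. \<Sum>k<DIM('a). \<kappa> k g * (\<epsilon> ^ (DIM('a) - k) * l j ^ k - g ^ (DIM('a) - k) * l j ^ DIM('a))))"
    by (simp only: v_def sum_distrib_left)
qed

end

subsection \<open>Shifting the contour to the screen\<close>

text \<open>A power is monotone in its exponent, in a direction that depends on whether the base
  exceeds 1; the sum of both endpoint values covers either case.\<close>

lemma powr_le_sum_endpoints:
  fixes x :: real
  assumes "x > 0" "a \<le> p" "p \<le> b"
  shows "x powr p \<le> x powr a + x powr b"
proof (cases "x \<ge> 1")
  case True
  then have "x powr p \<le> x powr b" using assms by (intro powr_mono) auto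
  then show ?thesis using powr_ge_zero[of x a] by linarith
next
  case False
  then have "x powr p \<le> x powr a" using assms by (intro powr_mono') auto
  then show ?thesis using powr_ge_zero[of x b] by linarith
qed

text \<open>The bound at the point itself says nothing, since a normalised function takes the value
  0 at its poles; the contradiction comes from a nearby point on the same horizontal line.\<close>

lemma bounded_on_horizontal_not_pole:
  assumes "\<And>\<alpha>. norm (f (Complex \<alpha> h)) \<le> C"
  shows "\<not> is_pole f (Complex \<alpha> h)"
proof
  assume "is_pole f (Complex \<alpha> h)"
  then have "filterlim (\<lambda>s. norm (f s)) at_top (at (Complex \<alpha> h))"
    unfolding is_pole_def by (simp add: filterlim_at_infinity_conv_norm_at_top)
  then have "\<forall>\<^sub>F s in at (Complex \<alpha> h). norm (f s) > C"
    by (simp add: filterlim_at_top_dense)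
  then obtain e where e: "e > 0" "\<And>s. s \<noteq> Complex \<alpha> h \<Longrightarrow> dist s (Complex \<alpha> h) < e \<Longrightarrow> norm (f s) > C"
    unfolding eventually_at by auto
  have "dist (Complex (\<alpha> + e / 2) h) (Complex \<alpha> h) < e"
    using e(1) by (simp add: dist_norm complex_diff cmod_def)
  with e(2)[of "Complex (\<alpha> + e / 2) h"] e(1) assms[of "\<alpha> + e / 2"] show False by simp
qed

context tiling_expansion
begin

lemma open_regular: "open (- ({s. is_pole \<zeta> s} \<union> of_nat ` {..DIM('a)}))"
proof -
  have "continuous_on UNIV (ratio_sum N r)"
    by (intro holomorphic_on_imp_continuous_on holomorphic_ratio_sum r_pos)
  then have "closed {s. ratio_sum N r s = 1}"
    by (intro closed_Collect_eq continuous_intros)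
  then have "closed {s. is_pole \<zeta> s}" by (simp add: is_pole_zeta_iff)
  moreover have "closed (complex_of_nat ` {..DIM('a)})" by (intro finite_imp_closed) simp
  ultimately show ?thesis by (intro open_Compl closed_Un)
qed

text \<open>In a vertical strip the powers are bounded by their values on its two edges. One factor
  \<open>1 / \<bar>Im s\<bar>\<close> comes from \<open>d - s\<close>, the other from each
  \<open>s - k\<close>.\<close>

lemma error_integrand_horizontal_bound:
  assumes \<epsilon>: "\<epsilon> > 0"
  obtains K where "\<And>s. - B \<le> Re s \<Longrightarrow> Re s \<le> c \<Longrightarrow> Im s \<noteq> 0 \<Longrightarrow> norm (\<zeta> s) \<le> C \<Longrightarrow>
    norm (E \<epsilon> s) \<le> K / (Im s)\<^sup>2"
proof -
  define P where "P = \<epsilon> powr (real DIM('a) - c) + \<epsilon> powr (real DIM('a) + B)"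
  define Q where "Q = (\<Sum>k<DIM('a). (g powr (- B - real k) + g powr (c - real k)) * real (DIM('a) - k) * \<bar>\<kappa> k g\<bar>)"
  show ?thesis
  proof (rule that[of "P * C * Q"])
    fix s assume s: "- B \<le> Re s" "Re s \<le> c" "Im s \<noteq> 0" "norm (\<zeta> s) \<le> C"
    have im: "\<bar>Im s\<bar> \<le> norm (s - of_nat k)" "\<bar>Im s\<bar> \<le> norm (of_nat k - s)" for k
      using abs_Im_le_cmod[of "s - of_nat k"] by (simp_all add: norm_minus_commute)
    have C: "0 \<le> C" using s(4) norm_ge_zero order_trans by blast
    have P: "norm (complex_of_real \<epsilon> powr (of_nat DIM('a) - s)) \<le> P"
      using powr_le_sum_endpoints[OF \<epsilon>, of "real DIM('a) - c" "real DIM('a) - Re s" "real DIM('a) + B"] s \<epsilon>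
      by (simp add: norm_powr_real_powr P_def)
    have P0: "0 \<le> P" using P norm_ge_zero order_trans by blast
    have "norm (\<Sum>k<DIM('a). of_real g powr (s - of_nat k) / (s - of_nat k) * of_nat (DIM('a) - k) * of_real (\<kappa> k g))
      \<le> (\<Sum>k<DIM('a). (g powr (- B - real k) + g powr (c - real k)) * real (DIM('a) - k) * \<bar>\<kappa> k g\<bar> / \<bar>Im s\<bar>)"
    proof (rule sum_norm_le)
      fix k
      have "norm (of_real g powr (s - of_nat k) :: complex) \<le> g powr (- B - real k) + g powr (c - real k)"
        using powr_le_sum_endpoints[OF g_pos, of "- B - real k" "Re s - real k" "c - real k"] s g_pos
        by (simp add: norm_powr_real_powr)
      then have "norm (of_real g powr (s - of_nat k)) / norm (s - of_nat k)
          \<le> (g powr (- B - real k) + g powr (c - real k)) / \<bar>Im s\<bar>"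
        using im(1)[of k] s(3) by (intro frac_le) auto
      from mult_right_mono[OF this, of "real (DIM('a) - k) * \<bar>\<kappa> k g\<bar>"]
      show "norm (of_real g powr (s - of_nat k) / (s - of_nat k) * of_nat (DIM('a) - k) * of_real (\<kappa> k g))
        \<le> (g powr (- B - real k) + g powr (c - real k)) * real (DIM('a) - k) * \<bar>\<kappa> k g\<bar> / \<bar>Im s\<bar>"
        by (simp add: norm_mult norm_divide mult.assoc del: of_nat_diff)
    qed
    also have "\<dots> = Q / \<bar>Im s\<bar>" by (simp add: Q_def sum_divide_distrib)
    finally have Q: "norm (\<Sum>k<DIM('a). of_real g powr (s - of_nat k) / (s - of_nat k) * of_nat (DIM('a) - k) * of_real (\<kappa> k g))
      \<le> Q / \<bar>Im s\<bar>" .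
    have "norm (of_real \<epsilon> powr (of_nat DIM('a) - s) * \<zeta> s) \<le> P * C"
      using P P0 s(4) by (simp add: norm_mult mult_mono)
    then have "norm (of_real \<epsilon> powr (of_nat DIM('a) - s) * \<zeta> s) / norm (of_nat DIM('a) - s) \<le> (P * C) / \<bar>Im s\<bar>"
      using im(2)[of "DIM('a)"] s(3) P0 C by (intro frac_le) auto
    from mult_mono[OF this Q] show "norm (E \<epsilon> s) \<le> P * C * Q / (Im s)\<^sup>2"
      using P0 C s(3) by (simp add: error_integrand_eq norm_mult norm_divide power2_eq_square del: of_nat_diff)
  qed
qed

theorem error_integrand_dimension_sums:
  assumes \<epsilon>: "\<epsilon> > 0" and scr: "screen l S" and S0: "S 0 \<notin> real ` {0..DIM('a)}"
    and heights: "languid_heights \<zeta> T" and int: "screen_integrable S (E \<epsilon>)"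
  shows "dimension_sums T (tiling_dimensions DIM('a) l (window S)) (residue (E \<epsilon>))
    (of_real (\<Sum>j\<in>big \<epsilon>. \<Sum>k<DIM('a). \<kappa> k g * (\<epsilon> ^ (DIM('a) - k) * l j ^ k - g ^ (DIM('a) - k) * l j ^ DIM('a)))
      - 1 / (2 * of_real pi * \<i>) * screen_integral S (E \<epsilon>))"
proof -
  \<comment> \<open>Any abscissa beyond \<open>DIM('a)\<close> serves: all poles of
    \<open>E \<epsilon>\<close> have real part at most \<open>DIM('a)\<close>, and the value of the
    line integral does not depend on the choice.\<close>
  define c where "c = real DIM('a) + 1"
  have c: "c > real DIM('a)" by (simp add: c_def)
  obtain B where B: "\<And>t. \<bar>S t\<bar> \<le> B"
    using scr unfolding screen_def bounded_iff by auto
  obtain L where L: "L-lipschitz_on UNIV S" using scr by (auto simp: screen_def)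
  have S_le: "S t \<le> D" and S_pole: "\<not> is_pole \<zeta> (Complex (S t) t)" for t
    using scr by (auto simp: screen_def)
  have S_less_c: "S t < c" for t using S_le[of t] D_le_d c by linarith
  obtain C where C: "\<And>n \<alpha>. norm (\<zeta> (Complex \<alpha> (T n))) \<le> C"
    using heights by (auto simp: languid_heights_def)
  have T_pole: "\<not> is_pole \<zeta> (Complex \<alpha> (T n))" for \<alpha> n
    by (rule bounded_on_horizontal_not_pole[where C = C]) (rule C)
  obtain K where K: "\<And>s. - B \<le> Re s \<Longrightarrow> Re s \<le> c \<Longrightarrow> Im s \<noteq> 0 \<Longrightarrow> norm (\<zeta> s) \<le> C \<Longrightarrow>
      norm (E \<epsilon> s) \<le> K / (Im s)\<^sup>2"
    using error_integrand_horizontal_bound[OF \<epsilon>] by metis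
  define X where "X = - ({s. is_pole \<zeta> s} \<union> complex_of_nat ` {..DIM('a)})"
  have X: "open X" "E \<epsilon> holomorphic_on X"
    unfolding X_def by (rule open_regular, rule error_integrand_holomorphic)
  define edge where "edge = (\<lambda>m. contour_integral (linepath (Complex c (T m)) (Complex (S (T m)) (T m))) (E \<epsilon>))"
  have edge_le: "norm (edge m) \<le> K / (T m)\<^sup>2 * (c + B)" if "T m \<noteq> 0" for m
    unfolding edge_def
  proof (rule norm_contour_integral_linepath_le[OF X(2,1)])
    have seg: "Im z = T m" "- B \<le> Re z" "Re z \<le> c" if "z \<in> closed_segment (Complex c (T m)) (Complex (S (T m)) (T m))" for z
      using that S_less_c[of "T m"] B[of "T m"]
      by (auto simp: closed_segment_same_Im closed_segment_eq_real_ivl split: if_splits)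
    show "closed_segment (Complex c (T m)) (Complex (S (T m)) (T m)) \<subseteq> X"
    proof
      fix z assume z: "z \<in> closed_segment (Complex c (T m)) (Complex (S (T m)) (T m))"
      then have "\<not> is_pole \<zeta> z" using T_pole[of "Re z" m] seg[OF z] by (metis complex_surj)
      moreover have "z \<notin> complex_of_nat ` {..DIM('a)}" using seg[OF z] that by auto
      ultimately show "z \<in> X" by (simp add: X_def)
    qed
    fix z assume z: "z \<in> closed_segment (Complex c (T m)) (Complex (S (T m)) (T m))"
    have "norm (\<zeta> z) \<le> C" using C[of "Re z" m] seg(1)[OF z] by (metis complex_surj)
    then show "norm (E \<epsilon> z) \<le> K / (T m)\<^sup>2"
      using K[of z] seg[OF z] that by simp
  next
    show "norm (Complex (S (T m)) (T m) - Complex c (T m)) \<le> c + B"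
      using S_less_c[of "T m"] B[of "T m"] by (simp add: complex_diff cmod_def)
  qed
  define a where "a = (\<lambda>n. T (- int n))"
  define b where "b = (\<lambda>n. T (int n))"
  have a_lim: "filterlim a at_bot sequentially" and b_lim: "filterlim b at_top sequentially"
    using heights by (simp_all add: languid_heights_def a_def b_def)
  have a_neg: "a n < 0" and b_pos: "0 < b n" if "n \<ge> 1" for n
    using heights that unfolding languid_heights_def a_def b_def by auto
  have to_0: "(\<lambda>n. edge (m n)) \<longlonglongrightarrow> 0" if lim: "filterlim (\<lambda>n. \<bar>T (m n)\<bar>) at_top sequentially" for m
  proof (rule Lim_null_comparison)
    have "\<forall>\<^sub>F n in sequentially. \<bar>T (m n)\<bar> > 0"
      using lim unfolding filterlim_at_top_dense by blast
    then show "\<forall>\<^sub>F n in sequentially. norm (edge (m n)) \<le> K / (T (m n))\<^sup>2 * (c + B)"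
      by eventually_elim (rule edge_le, simp)
    have "filterlim (\<lambda>n. \<bar>T (m n)\<bar>\<^sup>2) at_top sequentially"
      by (rule filterlim_pow_at_top[OF _ lim]) simp
    then have "((\<lambda>n. K / (T (m n))\<^sup>2) \<longlongrightarrow> 0) sequentially"
      by (intro tendsto_divide_0[OF tendsto_const] filterlim_at_top_imp_at_infinity) simp
    then show "(\<lambda>n. K / (T (m n))\<^sup>2 * (c + B)) \<longlonglongrightarrow> 0"
      by (rule tendsto_mult_left_zero)
  qed
  have edge_a: "(\<lambda>n. edge (- int n)) \<longlonglongrightarrow> 0"
  proof (rule to_0)
    have "filterlim (\<lambda>n. - a n) at_top sequentially" using a_lim by (simp add: filterlim_uminus_at_bot)
    then show "filterlim (\<lambda>n. \<bar>T (- int n)\<bar>) at_top sequentially"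
      by (rule filterlim_at_top_mono) (auto simp: a_def intro!: always_eventually)
  qed
  have edge_b: "(\<lambda>n. edge (int n)) \<longlonglongrightarrow> 0"
    by (intro to_0 filterlim_at_top_mono[OF b_lim]) (auto simp: b_def intro!: always_eventually)
  define V where "V = (\<lambda>n. contour_integral (linepath (Complex c (a n)) (Complex c (b n))) (E \<epsilon>))"
  have V_int: "((\<lambda>t. E \<epsilon> (Complex c t) * \<i>) has_integral V n) {a n..b n}" if "n \<ge> 1" for n
    unfolding V_def
  proof (rule vertical_integral_has_integral[where B = "{s. Re s > real DIM('a)}"])
    show "a n \<le> b n" using a_neg[OF that] b_pos[OF that] by linarith
    show "E \<epsilon> holomorphic_on {s. Re s > real DIM('a)}"
      using Re_pole_zeta D_le_d by (intro holomorphic_on_subset[OF error_integrand_holomorphic]) force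
  qed (use c in \<open>auto simp: open_halfspace_Re_gt convex_halfspace_Re_gt\<close>)
  have V_lim: "V \<longlonglongrightarrow> integral\<^sup>L lebesgue (\<lambda>t. E \<epsilon> (Complex c t) * \<i>)"
    using error_integrand_line_integral(1)[OF \<epsilon> c] V_int
    by (intro integral_exhaustion[OF _ _ a_lim b_lim] eventually_sequentiallyI[of 1]) auto
  define dims where "dims = (\<lambda>n. {\<omega> \<in> tiling_dimensions DIM('a) l (window S). a n < Im \<omega> \<and> Im \<omega> < b n})"
  define I where "I = (\<lambda>n. V n + edge (int n) - edge (- int n) - 2 * pi * \<i> * (\<Sum>\<omega>\<in>dims n. residue (E \<epsilon>) \<omega>))"
  have I_int: "(screen_integrand S (E \<epsilon>) has_integral I n) {a n..b n}" if n: "n \<ge> 1" for n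
  proof -
    define lo where "lo = Complex (- B - 1) (a n - 1)"
    define hi where "hi = Complex (c + 1) (b n + 1)"
    \<comment> \<open>The residue theorem needs a finite singular set, while \<zeta> may have
      infinitely many poles; compactness leaves finitely many in the box. The margin of 1 in
      \<open>lo\<close> and \<open>hi\<close> makes the open box contain the contour.\<close>
    define Q where "Q = {s \<in> cbox lo hi. is_pole \<zeta> s} \<union> complex_of_nat ` {..DIM('a)}"
    have ab: "a n < 0" "0 < b n" using a_neg[OF n] b_pos[OF n] .
    have in_box: "s \<in> box lo hi \<longleftrightarrow> - B - 1 < Re s \<and> Re s < c + 1 \<and> a n - 1 < Im s \<and> Im s < b n + 1" for s
      by (auto simp: lo_def hi_def in_box_complex_iff)
    have in_cbox: "s \<in> cbox lo hi \<longleftrightarrow> - B - 1 \<le> Re s \<and> Re s \<le> c + 1 \<and> a n - 1 \<le> Im s \<and> Im s \<le> b n + 1" for s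
      by (auto simp: lo_def hi_def in_cbox_complex_iff)
    have sing: "Re p < c \<and> Re p \<noteq> S (Im p) \<and> Im p \<noteq> a n \<and> Im p \<noteq> b n" if p: "p \<in> Q" for p
    proof (cases "is_pole \<zeta> p")
      case True
      have "Re p < c" using Re_pole_zeta[OF True] D_le_d c by linarith
      moreover have "Re p \<noteq> S (Im p)" using True S_pole[of "Im p"] by (metis complex_surj)
      moreover have "Im p \<noteq> T m" for m using True T_pole[of "Re p" m] by (metis complex_surj)
      ultimately show ?thesis by (simp add: a_def b_def)
    next
      case False
      then obtain k where "k \<le> DIM('a)" "p = of_nat k" using p by (auto simp: Q_def)
      moreover from this have "S 0 \<noteq> real k" using S0 by auto
      ultimately show ?thesis using ab c by auto
    qed
    \<comment> \<open>The window includes the screen, whereas the residue theorem counts only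
      singularities strictly to its right. The two sets agree because \<open>sing\<close> excludes
      singularities on the screen.\<close>
    have dims_eq: "{p \<in> Q. a n < Im p \<and> Im p < b n \<and> S (Im p) < Re p} = dims n"
    proof (intro equalityI subsetI)
      fix p assume p: "p \<in> {p \<in> Q. a n < Im p \<and> Im p < b n \<and> S (Im p) < Re p}"
      then show "p \<in> dims n"
        by (auto simp: Q_def dims_def tiling_dimensions_def string_dimensions_def window_def)
    next
      fix p assume p: "p \<in> dims n"
      then have wn: "S (Im p) \<le> Re p" "a n < Im p" "Im p < b n" and p': "is_pole \<zeta> p \<or> p \<in> complex_of_nat ` {..DIM('a)}"
        by (auto simp: dims_def tiling_dimensions_def string_dimensions_def window_def)
      have "p \<in> Q"
      proof (cases "is_pole \<zeta> p")
        case True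
        have "Re p < c" using Re_pole_zeta[OF True] D_le_d c by linarith
        then show ?thesis using True wn B[of "Im p"] by (auto simp: Q_def in_cbox)
      qed (use p' in \<open>auto simp: Q_def\<close>)
      then show "p \<in> {p \<in> Q. a n < Im p \<and> Im p < b n \<and> S (Im p) < Re p}"
        using wn sing[of p] by auto
    qed
    have box_in_cbox: "s \<in> cbox lo hi" if "s \<in> box lo hi" for s
      using that box_subset_cbox by blast
    have "(screen_integrand S (E \<epsilon>) has_integral
     (contour_integral (linepath (Complex c (a n)) (Complex c (b n))) (E \<epsilon>)
      + contour_integral (linepath (Complex c (b n)) (Complex (S (b n)) (b n))) (E \<epsilon>)
      - contour_integral (linepath (Complex c (a n)) (Complex (S (a n)) (a n))) (E \<epsilon>)
      - 2 * pi * \<i> * (\<Sum>p\<in>{p \<in> Q. a n < Im p \<and> Im p < b n \<and> S (Im p) < Re p}. residue (E \<epsilon>) p))) {a n..b n}"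
    proof (rule screen_residue_theorem[OF L, where R = "box lo hi"])
      show "finite Q" unfolding Q_def using finite_zeta_poles[OF compact_cbox] by simp
      show "E \<epsilon> holomorphic_on box lo hi - Q"
        using box_in_cbox by (intro holomorphic_on_subset[OF error_integrand_holomorphic]) (auto simp: Q_def)
      show "Complex (S t) t \<in> box lo hi" if "t \<in> {a n..b n}" for t
        using that B[of t] S_less_c[of t] by (auto simp: in_box)
      have "0 \<le> B" using B[of 0] by linarith
      then show "Complex c (a n) \<in> box lo hi" "Complex c (b n) \<in> box lo hi"
        using ab c by (auto simp: in_box)
    qed (use ab sing in \<open>auto simp: open_box convex_box\<close>)
    then show ?thesis unfolding dims_eq by (simp add: I_def V_def edge_def a_def b_def)
  qed
  have "I \<longlonglongrightarrow> screen_integral S (E \<epsilon>)"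
    unfolding screen_integral_def using int I_int
    by (intro integral_exhaustion[OF _ _ a_lim b_lim] eventually_sequentiallyI[of 1]) (auto simp: screen_integrable_def)
  then have "(\<lambda>n. 1 / (2 * pi * \<i>) * (V n + edge (int n) - edge (- int n) - I n))
    \<longlonglongrightarrow> 1 / (2 * pi * \<i>) * (integral\<^sup>L lebesgue (\<lambda>t. E \<epsilon> (Complex c t) * \<i>) + 0 - 0 - screen_integral S (E \<epsilon>))"
    by (intro tendsto_intros V_lim edge_a edge_b)
  moreover have "1 / (2 * pi * \<i>) * (V n + edge (int n) - edge (- int n) - I n) = (\<Sum>\<omega>\<in>dims n. residue (E \<epsilon>) \<omega>)" for n
    by (simp add: I_def)
  moreover have "1 / (2 * pi * \<i>) * (integral\<^sup>L lebesgue (\<lambda>t. E \<epsilon> (Complex c t) * \<i>) + 0 - 0 - screen_integral S (E \<epsilon>))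
     = of_real (\<Sum>j\<in>big \<epsilon>. \<Sum>k<DIM('a). \<kappa> k g * (\<epsilon> ^ (DIM('a) - k) * l j ^ k - g ^ (DIM('a) - k) * l j ^ DIM('a)))
      - 1 / (2 * of_real pi * \<i>) * screen_integral S (E \<epsilon>)"
  proof -
    have "integral\<^sup>L lebesgue (\<lambda>t. E \<epsilon> (Complex c t) * \<i>) = integral\<^sup>L lebesgue (\<lambda>t. E \<epsilon> (Complex c t)) * \<i>"
      by (rule integral_mult_left_zero)
    then show ?thesis
      unfolding error_integrand_line_integral(2)[OF \<epsilon> c] by (simp add: right_diff_distrib)
  qed
  ultimately show ?thesis
    by (simp add: dimension_sums_def dims_def a_def b_def)
qed

end

subsection \<open>The tube formula\<close>

context tiling_expansion
begin

text \<open>The bounded screen confines the visible poles of a horizontal strip to a compact box, so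
  the truncated sums over dimensions are genuine finite sums.\<close>

lemma finite_dimensions:
  assumes "screen l S"
  shows "finite {\<omega> \<in> tiling_dimensions DIM('a) l (window S). a < Im \<omega> \<and> Im \<omega> < b}"
proof -
  obtain B where B: "\<And>t. \<bar>S t\<bar> \<le> B"
    using assms unfolding screen_def bounded_iff by auto
  have "\<omega> \<in> {s \<in> cbox (Complex (- B) a) (Complex D b). is_pole \<zeta> s} \<union> of_nat ` {..DIM('a)}"
    if "\<omega> \<in> tiling_dimensions DIM('a) l (window S)" "a < Im \<omega>" "Im \<omega> < b" for \<omega>
  proof (cases "is_pole \<zeta> \<omega>")
    case True
    have "S (Im \<omega>) \<le> Re \<omega>"
      using that(1) by (auto simp: tiling_dimensions_def string_dimensions_def window_def)
    then show ?thesis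
      using True that(2,3) Re_pole_zeta[OF True] B[of "Im \<omega>"] by (auto simp: in_cbox_complex_iff)
  next
    case False
    then show ?thesis using that(1) by (auto simp: tiling_dimensions_def string_dimensions_def)
  qed
  then have "{\<omega> \<in> tiling_dimensions DIM('a) l (window S). a < Im \<omega> \<and> Im \<omega> < b}
    \<subseteq> {s \<in> cbox (Complex (- B) a) (Complex D b). is_pole \<zeta> s} \<union> of_nat ` {..DIM('a)}"
    by blast
  then show ?thesis
    by (rule finite_subset) (use finite_zeta_poles[OF compact_cbox] in simp)
qed

lemma correction_numerator_eq_0:
  assumes "\<epsilon> > 0" "\<And>x. x \<in> {0<..g} \<Longrightarrow> \<kappa> k x = \<kappa> k g"
  shows "correction_numerator \<epsilon> k s = 0"
proof -
  have "\<kappa> k (\<epsilon> / l j) = \<kappa> k g" if "j \<in> big \<epsilon>" for j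
    using that assms(1) l_pos[of j] by (intro assms(2)) (simp add: big_def)
  then show ?thesis by (simp add: correction_numerator_def)
qed

text \<open>The hypothesis \<open>visible\<close> treats both versions of the tube formula at once:
  either the dimension \<open>k\<close> lies in the window, or the coefficient
  \<open>\<kappa> k\<close> is constant and its residue vanishes. As \<open>a < 0 < b\<close>,
  truncation loses no integer dimension.\<close>

lemma correction_dimension_sum:
  assumes \<epsilon>: "\<epsilon> > 0" and scr: "screen l S" and ab: "a < 0" "0 < b"
    and visible: "\<And>k. k \<le> DIM('a) \<Longrightarrow> S 0 \<le> real k \<or> (\<forall>x\<in>{0<..g}. \<kappa> k x = \<kappa> k g)"
  shows "(\<Sum>\<omega>\<in>{\<omega> \<in> tiling_dimensions DIM('a) l (window S). a < Im \<omega> \<and> Im \<omega> < b}. residue (correction \<epsilon>) \<omega>)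
    = (\<Sum>k\<le>DIM('a). correction_numerator \<epsilon> k (of_nat k))"
proof -
  let ?W = "{\<omega> \<in> tiling_dimensions DIM('a) l (window S). a < Im \<omega> \<and> Im \<omega> < b}"
  have "(\<Sum>\<omega>\<in>?W. residue (correction \<epsilon>) \<omega>)
    = (\<Sum>k\<le>DIM('a). \<Sum>\<omega>\<in>?W. if \<omega> = of_nat k then correction_numerator \<epsilon> k (of_nat k) else 0)"
    unfolding residue_correction by (rule sum.swap)
  also have "\<dots> = (\<Sum>k\<le>DIM('a). correction_numerator \<epsilon> k (of_nat k))"
  proof (rule sum.cong[OF refl])
    fix k assume k: "k \<in> {..DIM('a)}"
    have sum_eq: "(\<Sum>\<omega>\<in>?W. if \<omega> = of_nat k then correction_numerator \<epsilon> k (of_nat k) else 0)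
        = (if of_nat k \<in> ?W then correction_numerator \<epsilon> k (of_nat k) else 0)"
      by (rule sum.delta[OF finite_dimensions[OF scr]])
    have in_W: "of_nat k \<in> ?W" if "S 0 \<le> real k"
    proof -
      have "complex_of_nat k \<in> of_nat ` {0..DIM('a)}" using k by (intro imageI) simp
      then show ?thesis using that ab by (simp add: tiling_dimensions_def window_def)
    qed
    have zero: "correction_numerator \<epsilon> k (of_nat k) = 0" if "\<not> S 0 \<le> real k"
    proof (rule correction_numerator_eq_0[OF \<epsilon>])
      have "k \<le> DIM('a)" using k by simp
      then show "\<kappa> k x = \<kappa> k g" if "x \<in> {0<..g}" for x
        using visible[of k] that \<open>\<not> S 0 \<le> real k\<close> by blast
    qed
    show "(\<Sum>\<omega>\<in>?W. if \<omega> = of_nat k then correction_numerator \<epsilon> k (of_nat k) else 0)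
        = correction_numerator \<epsilon> k (of_nat k)"
    proof (cases "S 0 \<le> real k")
      case True
      then show ?thesis unfolding sum_eq by (rule if_P[OF in_W])
    next
      case False
      show ?thesis by (simp only: zero[OF False] if_cancel sum.neutral_const)
    qed
  qed
  finally show ?thesis .
qed

text \<open>The defect \<open>\<delta> j\<close> of a tile against its full volume vanishes off
  \<open>big \<epsilon>\<close>. On \<open>big \<epsilon>\<close> the Steiner formula minus
  \<open>measure_G\<close> separates into a part with frozen coefficients, where
  \<open>k = d\<close> cancels, and the deviation of the coefficients.\<close>

lemma tiling_volume_eq:
  assumes \<epsilon>: "\<epsilon> > 0"
  shows "tiling_volume \<Phi> w G \<epsilon> = measure lborel G * (\<Sum>j. l j ^ DIM('a))
    + (\<Sum>j\<in>big \<epsilon>. \<Sum>k<DIM('a). \<kappa> k g * (\<epsilon> ^ (DIM('a) - k) * l j ^ k - g ^ (DIM('a) - k) * l j ^ DIM('a)))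
    + (\<Sum>k\<le>DIM('a). \<Sum>j\<in>big \<epsilon>. \<epsilon> ^ (DIM('a) - k) * l j ^ k * (\<kappa> k (\<epsilon> / l j) - \<kappa> k g))"
proof -
  define \<delta> where "\<delta> = (\<lambda>j. l j ^ DIM('a) * inner_volume G (\<epsilon> / l j) - measure lborel G * l j ^ DIM('a))"
  have "\<delta> j = 0" if "j \<notin> big \<epsilon>" for j
    using that inner_volume_ge_g[of "\<epsilon> / l j"] by (simp add: \<delta>_def big_def)
  then have "(\<lambda>j. l j ^ DIM('a) * inner_volume G (\<epsilon> / l j))
      = (\<lambda>j. measure lborel G * l j ^ DIM('a) + (if j \<in> big \<epsilon> then \<delta> j else 0))"
    by (auto simp: \<delta>_def fun_eq_iff)
  moreover have "(\<lambda>j. measure lborel G * l j ^ DIM('a) + (if j \<in> big \<epsilon> then \<delta> j else 0))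
      sums (measure lborel G * (\<Sum>j. l j ^ DIM('a)) + (\<Sum>j\<in>big \<epsilon>. \<delta> j))"
    by (intro sums_add sums_mult summable_sums summable_l_dim sums_If_finite_set finite_big \<epsilon>)
  ultimately have vol: "tiling_volume \<Phi> w G \<epsilon> = measure lborel G * (\<Sum>j. l j ^ DIM('a)) + (\<Sum>j\<in>big \<epsilon>. \<delta> j)"
    using tiling_volume_sums[of \<epsilon>] by (simp add: sums_unique2)
  have "\<delta> j = (\<Sum>k<DIM('a). \<kappa> k g * (\<epsilon> ^ (DIM('a) - k) * l j ^ k - g ^ (DIM('a) - k) * l j ^ DIM('a)))
      + (\<Sum>k\<le>DIM('a). \<epsilon> ^ (DIM('a) - k) * l j ^ k * (\<kappa> k (\<epsilon> / l j) - \<kappa> k g))" if j: "j \<in> big \<epsilon>" for j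
  proof -
    have lj: "l j > 0" by (rule l_pos)
    have "l j ^ DIM('a) * inner_volume G (\<epsilon> / l j) = (\<Sum>k\<le>DIM('a). \<epsilon> ^ (DIM('a) - k) * l j ^ k * \<kappa> k (\<epsilon> / l j))"
    proof -
      have summand: "l j ^ DIM('a) * (\<kappa> k (\<epsilon> / l j) * (\<epsilon> / l j) ^ (DIM('a) - k)) = \<epsilon> ^ (DIM('a) - k) * l j ^ k * \<kappa> k (\<epsilon> / l j)"
        if "k \<le> DIM('a)" for k
      proof -
        have "l j ^ DIM('a) = l j ^ k * l j ^ (DIM('a) - k)" using that by (simp flip: power_add)
        then show ?thesis using lj by (simp add: power_divide)
      qed
      have "inner_volume G (\<epsilon> / l j) = (\<Sum>k\<le>DIM('a). \<kappa> k (\<epsilon> / l j) * (\<epsilon> / l j) ^ (DIM('a) - k))"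
        using j \<epsilon> lj by (intro inner_volume_steiner) (auto simp: big_def)
      then show ?thesis unfolding sum_distrib_left by (simp only: sum_distrib_left) (intro sum.cong refl summand, simp)
    qed
    moreover have "measure lborel G * l j ^ DIM('a) = (\<Sum>k\<le>DIM('a). \<kappa> k g * (g ^ (DIM('a) - k) * l j ^ DIM('a)))"
      by (simp add: measure_G sum_distrib_right mult.assoc)
    moreover have "(\<Sum>k<DIM('a). \<kappa> k g * (\<epsilon> ^ (DIM('a) - k) * l j ^ k - g ^ (DIM('a) - k) * l j ^ DIM('a)))
       = (\<Sum>k\<le>DIM('a). \<kappa> k g * (\<epsilon> ^ (DIM('a) - k) * l j ^ k - g ^ (DIM('a) - k) * l j ^ DIM('a)))"
      by (simp add: lessThan_Suc_atMost[symmetric])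
    moreover have "(\<Sum>k\<le>DIM('a). \<epsilon> ^ (DIM('a) - k) * l j ^ k * \<kappa> k (\<epsilon> / l j))
        - (\<Sum>k\<le>DIM('a). \<kappa> k g * (g ^ (DIM('a) - k) * l j ^ DIM('a)))
      = (\<Sum>k\<le>DIM('a). \<kappa> k g * (\<epsilon> ^ (DIM('a) - k) * l j ^ k - g ^ (DIM('a) - k) * l j ^ DIM('a)))
        + (\<Sum>k\<le>DIM('a). \<epsilon> ^ (DIM('a) - k) * l j ^ k * (\<kappa> k (\<epsilon> / l j) - \<kappa> k g))"
      unfolding sum.distrib[symmetric] sum_subtractf[symmetric]
      by (intro sum.cong refl) (simp add: algebra_simps)
    ultimately show ?thesis by (simp only: \<delta>_def)
  qed
  then have "(\<Sum>j\<in>big \<epsilon>. \<delta> j)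
    = (\<Sum>j\<in>big \<epsilon>. \<Sum>k<DIM('a). \<kappa> k g * (\<epsilon> ^ (DIM('a) - k) * l j ^ k - g ^ (DIM('a) - k) * l j ^ DIM('a)))
      + (\<Sum>j\<in>big \<epsilon>. \<Sum>k\<le>DIM('a). \<epsilon> ^ (DIM('a) - k) * l j ^ k * (\<kappa> k (\<epsilon> / l j) - \<kappa> k g))"
    unfolding sum.distrib[symmetric] by (intro sum.cong refl)
  also have "(\<Sum>j\<in>big \<epsilon>. \<Sum>k\<le>DIM('a). \<epsilon> ^ (DIM('a) - k) * l j ^ k * (\<kappa> k (\<epsilon> / l j) - \<kappa> k g))
    = (\<Sum>k\<le>DIM('a). \<Sum>j\<in>big \<epsilon>. \<epsilon> ^ (DIM('a) - k) * l j ^ k * (\<kappa> k (\<epsilon> / l j) - \<kappa> k g))"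
    by (rule sum.swap)
  finally show ?thesis by (simp only: vol add.assoc)
qed

lemma tube_formula:
  assumes \<epsilon>: "\<epsilon> > 0" and scr: "screen l S" and S0: "S 0 \<notin> real ` {0..DIM('a)}"
    and heights: "languid_heights \<zeta> T" and int: "screen_integrable S (E \<epsilon>)"
    and visible: "\<And>k. k \<le> DIM('a) \<Longrightarrow> S 0 \<le> real k \<or> (\<forall>x\<in>{0<..g}. \<kappa> k x = \<kappa> k g)"
  obtains v where "dimension_sums T (tiling_dimensions DIM('a) l (window S)) (residue (tubular_zeta G \<kappa> l \<epsilon>)) v"
    "complex_of_real (tiling_volume \<Phi> w G \<epsilon>) =
      v + of_real (measure lborel G) * \<zeta> (of_nat DIM('a)) + error_term G \<kappa> l S \<epsilon>"
proof -
  define A where "A = (\<Sum>k\<le>DIM('a). correction_numerator \<epsilon> k (of_nat k))"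
  define H where "H = complex_of_real (\<Sum>j\<in>big \<epsilon>. \<Sum>k<DIM('a).
     \<kappa> k g * (\<epsilon> ^ (DIM('a) - k) * l j ^ k - g ^ (DIM('a) - k) * l j ^ DIM('a)))"
  define Om where "Om = (\<lambda>n. {\<omega> \<in> tiling_dimensions DIM('a) l (window S). T (- int n) < Im \<omega> \<and> Im \<omega> < T (int n)})"
  have lim: "(\<lambda>n. (\<Sum>\<omega>\<in>Om n. residue (E \<epsilon>) \<omega>) + A) \<longlonglongrightarrow> H - error_term G \<kappa> l S \<epsilon> + A"
    using error_integrand_dimension_sums[OF \<epsilon> scr S0 heights int]
    unfolding dimension_sums_def error_term_def H_def Om_def by (intro tendsto_add tendsto_const)
  \<comment> \<open>For \<open>n = 0\<close> both truncation heights are \<open>T 0\<close> and the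
    sum is empty; the signs of the heights are known only from \<open>n = 1\<close> on.\<close>
  have "(\<Sum>\<omega>\<in>Om n. residue (tubular_zeta G \<kappa> l \<epsilon>) \<omega>) = (\<Sum>\<omega>\<in>Om n. residue (E \<epsilon>) \<omega>) + A" if "n \<ge> 1" for n
  proof -
    have "T (- int n) < 0" "0 < T (int n)"
      using heights that unfolding languid_heights_def by auto
    from correction_dimension_sum[OF \<epsilon> scr this visible]
    have "(\<Sum>\<omega>\<in>Om n. residue (correction \<epsilon>) \<omega>) = A" by (simp add: Om_def A_def)
    then show ?thesis by (simp add: residue_tubular_zeta[OF \<epsilon>] sum.distrib)
  qed
  then have "\<forall>\<^sub>F n in sequentially. (\<Sum>\<omega>\<in>Om n. residue (E \<epsilon>) \<omega>) + A = (\<Sum>\<omega>\<in>Om n. residue (tubular_zeta G \<kappa> l \<epsilon>) \<omega>)"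
    by (intro eventually_sequentiallyI[of 1]) simp
  from Lim_transform_eventually[OF lim this]
  have "dimension_sums T (tiling_dimensions DIM('a) l (window S)) (residue (tubular_zeta G \<kappa> l \<epsilon>))
      (H - error_term G \<kappa> l S \<epsilon> + A)"
    unfolding dimension_sums_def Om_def .
  moreover have "A = of_real (\<Sum>k\<le>DIM('a). \<Sum>j\<in>big \<epsilon>. \<epsilon> ^ (DIM('a) - k) * l j ^ k * (\<kappa> k (\<epsilon> / l j) - \<kappa> k g))"
    unfolding A_def of_real_sum[of _ "{..DIM('a)}"]
    by (intro sum.cong refl correction_numerator_at[OF \<epsilon>]) simp
  then have "complex_of_real (tiling_volume \<Phi> w G \<epsilon>) =
      (H - error_term G \<kappa> l S \<epsilon> + A) + of_real (measure lborel G) * \<zeta> (of_nat DIM('a)) + error_term G \<kappa> l S \<epsilon>"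
    unfolding tiling_volume_eq[OF \<epsilon>] zeta_dim H_def by (simp only: of_real_add of_real_mult) simp
  ultimately show ?thesis by (rule that)
qed

section \<open>Size of the error term, and monophase generators\<close>

lemma norm_error_integrand:
  assumes "\<epsilon> > 0"
  shows "norm (E \<epsilon> s) = \<epsilon> powr (real DIM('a) - Re s) * norm (E 1 s)"
proof -
  define Y where "Y = \<zeta> s / (of_nat DIM('a) - s) *
      (\<Sum>k<DIM('a). of_real g powr (s - of_nat k) / (s - of_nat k) * of_nat (DIM('a) - k) * of_real (\<kappa> k g))"
  have "E x s = of_real x powr (of_nat DIM('a) - s) * Y" for x
    by (simp add: error_integrand_eq Y_def)
  then show ?thesis using assms by (simp add: norm_mult norm_powr_real_powr)
qed

text \<open>The width enters the integrand only through \<open>\<epsilon> powr (d - s)\<close>, so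
  the single integral at \<open>\<epsilon> = 1\<close> controls all others. For
  \<open>\<epsilon> < 1\<close> the power decreases in its exponent, and replacing
  \<open>S t\<close> by the supremum gives an upper bound.\<close>

lemma error_term_bigo:
  assumes scr: "screen l S" and int: "\<And>\<epsilon>. \<epsilon> > 0 \<Longrightarrow> screen_integrable S (E \<epsilon>)"
  shows "(\<lambda>\<epsilon>. norm (error_term G \<kappa> l S \<epsilon>)) \<in> O[at_right 0](\<lambda>\<epsilon>. \<epsilon> powr (real DIM('a) - (SUP t. S t)))"
proof (rule bigoI)
  let ?I = "integral\<^sup>L lebesgue (\<lambda>t. norm (screen_integrand S (E 1) t))"
  have S_le: "S t \<le> (SUP t. S t)" for t
    using scr unfolding screen_def by (intro cSUP_upper bounded_imp_bdd_above) auto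
  have int1: "integrable lebesgue (screen_integrand S (E 1))"
    using int[of 1] by (simp add: screen_integrable_def)
  have "norm (error_term G \<kappa> l S \<epsilon>) \<le> (?I / (2 * pi)) * norm (\<epsilon> powr (real DIM('a) - (SUP t. S t)))"
    if \<epsilon>: "0 < \<epsilon>" "\<epsilon> < 1" for \<epsilon>
  proof -
    have "norm (screen_integral S (E \<epsilon>)) \<le> integral\<^sup>L lebesgue (\<lambda>t. norm (screen_integrand S (E \<epsilon>) t))"
      unfolding screen_integral_def by (rule integral_norm_bound)
    also have "\<dots> \<le> integral\<^sup>L lebesgue (\<lambda>t. \<epsilon> powr (real DIM('a) - (SUP t. S t)) * norm (screen_integrand S (E 1) t))"
    proof (intro integral_mono integrable_mult_right integrable_norm int1)
      show "integrable lebesgue (screen_integrand S (E \<epsilon>))"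
        using int[OF \<epsilon>(1)] by (simp add: screen_integrable_def)
      fix t
      have "\<epsilon> powr (real DIM('a) - S t) \<le> \<epsilon> powr (real DIM('a) - (SUP t. S t))"
        using \<epsilon> S_le[of t] by (intro powr_mono') auto
      then show "norm (screen_integrand S (E \<epsilon>) t)
          \<le> \<epsilon> powr (real DIM('a) - (SUP t. S t)) * norm (screen_integrand S (E 1) t)"
        using norm_error_integrand[OF \<epsilon>(1), of "Complex (S t) t"]
        by (simp add: screen_integrand_def norm_mult mult.assoc[symmetric] mult_right_mono)
    qed
    also have "\<dots> = \<epsilon> powr (real DIM('a) - (SUP t. S t)) * ?I" by simp
    finally show ?thesis
      by (simp add: error_term_def norm_mult norm_divide field_simps)
  qed
  then show "\<forall>\<^sub>F \<epsilon> in at_right 0. norm (norm (error_term G \<kappa> l S \<epsilon>))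
      \<le> (?I / (2 * pi)) * norm (\<epsilon> powr (real DIM('a) - (SUP t. S t)))"
    unfolding eventually_at_right_field by (intro exI[of _ 1]) auto
qed

text \<open>Constant coefficients annihilate the correction, so the tubular zeta function is
  \<open>E \<epsilon>\<close> with its removable singularities filled in. The screen avoids the
  poles of \<zeta> and the integers, so on it both functions coincide pointwise.\<close>

lemma error_term_monophase:
  assumes \<epsilon>: "\<epsilon> > 0" and scr: "screen l S" and S0: "S 0 \<notin> real ` {0..DIM('a)}"
    and const: "\<And>k x. k \<le> DIM('a) \<Longrightarrow> x \<in> {0<..g} \<Longrightarrow> \<kappa> k x = \<kappa> k g"
  shows "error_term G \<kappa> l S \<epsilon> = 1 / (2 * of_real pi * \<i>) * screen_integral S (tubular_zeta G \<kappa> l \<epsilon>)"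
proof -
  have "correction \<epsilon> s = 0" for s
    using correction_numerator_eq_0[OF \<epsilon> const] by (simp add: correction_def)
  then have tub: "tubular_zeta G \<kappa> l \<epsilon> = remove_sings (E \<epsilon>)"
    by (simp add: tubular_zeta_eq[OF \<epsilon>])
  have "tubular_zeta G \<kappa> l \<epsilon> (Complex (S t) t) = E \<epsilon> (Complex (S t) t)" for t
  proof -
    let ?X = "- ({s. is_pole \<zeta> s} \<union> complex_of_nat ` {..DIM('a)})"
    have "Complex (S t) t \<noteq> of_nat k" if "k \<le> DIM('a)" for k
    proof
      assume "Complex (S t) t = of_nat k"
      then have "t = 0" and "S t = real k" by (auto simp: complex_eq_iff)
      then have "S 0 = real k" by simp
      then show False using S0 that by auto
    qed
    moreover have "\<not> is_pole \<zeta> (Complex (S t) t)" using scr unfolding screen_def by blast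
    ultimately have "Complex (S t) t \<in> ?X" by blast
    moreover have "E \<epsilon> analytic_on ?X"
      by (rule iffD2[OF analytic_on_open[OF open_regular] error_integrand_holomorphic])
    ultimately have "E \<epsilon> analytic_on {Complex (S t) t}"
      by (rule bspec[OF iffD1[OF analytic_on_analytic_at], rotated])
    then show ?thesis by (simp add: tub)
  qed
  then have "screen_integrand S (tubular_zeta G \<kappa> l \<epsilon>) = screen_integrand S (E \<epsilon>)"
    by (simp add: screen_integrand_def fun_eq_iff)
  then show ?thesis by (simp add: error_term_def screen_integral_def)
qed

end

theorem theorem5p12:
  fixes \<Phi> :: "nat \<Rightarrow> 'a::euclidean_space \<Rightarrow> 'a"
    and r :: "nat \<Rightarrow> real" and N :: nat
    and U G :: "'a set"
    and w :: "nat \<Rightarrow> nat list"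
    and \<kappa> :: "nat \<Rightarrow> real \<Rightarrow> real"
    and S :: "real \<Rightarrow> real" and T :: "int \<Rightarrow> real"
  defines "l \<equiv> fractal_string r w"
  assumes "N \<ge> 2"
    and "\<And>n. n \<in> {1..N} \<Longrightarrow> contractive_similarity (r n) (\<Phi> n)"
    and "nontriviality_condition N \<Phi>"
    and "feasible_open_set N \<Phi> U"
    and generator: "components (U - ifs_image N \<Phi> (closure U)) = {G}"
    and "word_ordering N r w"
    and "steiner_like G \<kappa>"
    and "screen l S"
    and "languid_heights (geometric_zeta l) T"
    and integral_exists: "\<And>\<epsilon>. \<epsilon> > 0 \<Longrightarrow> screen_integrable S (error_integrand G \<kappa> l \<epsilon>)"
  shows
    "(S 0 < 0 \<longrightarrow>
       (\<forall>\<epsilon>>0. \<exists>v. dimension_sums T (tiling_dimensions DIM('a) l (window S))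
                     (residue (tubular_zeta G \<kappa> l \<epsilon>)) v \<and>
          complex_of_real (tiling_volume \<Phi> w G \<epsilon>) =
            v + of_real (measure lborel G) * geometric_zeta l (of_nat DIM('a))
              + error_term G \<kappa> l S \<epsilon>) \<and>
       (\<lambda>\<epsilon>. norm (error_term G \<kappa> l S \<epsilon>))
          \<in> O[at_right 0](\<lambda>\<epsilon>. \<epsilon> powr (real DIM('a) - (SUP t. S t)))) \<and>
     (monophase G \<and> constant_coefficients G \<kappa> \<and> S 0 \<notin> real ` {0..DIM('a)} \<longrightarrow>
       (\<forall>\<epsilon>>0. \<exists>v. dimension_sums T (tiling_dimensions DIM('a) l (window S))
                     (residue (tubular_zeta G \<kappa> l \<epsilon>)) v \<and>
          complex_of_real (tiling_volume \<Phi> w G \<epsilon>) =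
            v + of_real (measure lborel G) * geometric_zeta l (of_nat DIM('a))
              + error_term G \<kappa> l S \<epsilon>) \<and>
       (\<lambda>\<epsilon>. norm (error_term G \<kappa> l S \<epsilon>))
          \<in> O[at_right 0](\<lambda>\<epsilon>. \<epsilon> powr (real DIM('a) - (SUP t. S t))) \<and>
       (\<forall>\<epsilon>>0. error_term G \<kappa> l S \<epsilon> =
          1 / (2 * of_real pi * \<i>) * screen_integral S (tubular_zeta G \<kappa> l \<epsilon>)))"
proof -
  interpret tiling_expansion \<Phi> r N U G w \<kappa>
    by unfold_locales fact+
  note facts = \<open>screen l S\<close>[unfolded l_def] \<open>languid_heights (geometric_zeta l) T\<close>[unfolded l_def]
    integral_exists[unfolded l_def]
  have formula: "\<exists>v. dimension_sums T (tiling_dimensions DIM('a) l (window S))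
                     (residue (tubular_zeta G \<kappa> l \<epsilon>)) v \<and>
          complex_of_real (tiling_volume \<Phi> w G \<epsilon>) =
            v + of_real (measure lborel G) * geometric_zeta l (of_nat DIM('a))
              + error_term G \<kappa> l S \<epsilon>"
    if "\<epsilon> > 0" "S 0 \<notin> real ` {0..DIM('a)}"
      "\<And>k. k \<le> DIM('a) \<Longrightarrow> S 0 \<le> real k \<or> (\<forall>x\<in>{0<..inradius G}. \<kappa> k x = \<kappa> k (inradius G))" for \<epsilon>
    unfolding l_def
  proof (rule tube_formula[OF that(1) facts(1) that(2) facts(2) facts(3)[OF that(1)] that(3)], assumption)
    fix v
    assume "dimension_sums T (tiling_dimensions DIM('a) (fractal_string r w) (window S))
        (residue (tubular_zeta G \<kappa> (fractal_string r w) \<epsilon>)) v"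
      and "complex_of_real (tiling_volume \<Phi> w G \<epsilon>) = v + of_real (measure lborel G)
        * geometric_zeta (fractal_string r w) (of_nat DIM('a)) + error_term G \<kappa> (fractal_string r w) S \<epsilon>"
    then show "\<exists>v. dimension_sums T (tiling_dimensions DIM('a) (fractal_string r w) (window S))
        (residue (tubular_zeta G \<kappa> (fractal_string r w) \<epsilon>)) v \<and>
      complex_of_real (tiling_volume \<Phi> w G \<epsilon>) = v + of_real (measure lborel G)
        * geometric_zeta (fractal_string r w) (of_nat DIM('a)) + error_term G \<kappa> (fractal_string r w) S \<epsilon>"
      by (intro exI[of _ v] conjI)
  qed
  have bigo: "(\<lambda>\<epsilon>. norm (error_term G \<kappa> l S \<epsilon>))
      \<in> O[at_right 0](\<lambda>\<epsilon>. \<epsilon> powr (real DIM('a) - (SUP t. S t)))"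
    unfolding l_def by (rule error_term_bigo[OF facts(1,3)])
  show ?thesis
  proof (intro conjI impI allI bigo)
    fix \<epsilon> :: real assume S0: "S 0 < 0" and \<epsilon>: "\<epsilon> > 0"
    have "S 0 < real k" for k using S0 of_nat_0_le_iff[of k] by (rule order_less_le_trans)
    then have "S 0 \<notin> real ` {0..DIM('a)}" "S 0 \<le> real k" for k
      by (force, simp add: less_imp_le)
    then show "\<exists>v. dimension_sums T (tiling_dimensions DIM('a) l (window S))
                     (residue (tubular_zeta G \<kappa> l \<epsilon>)) v \<and>
          complex_of_real (tiling_volume \<Phi> w G \<epsilon>) =
            v + of_real (measure lborel G) * geometric_zeta l (of_nat DIM('a))
              + error_term G \<kappa> l S \<epsilon>"
      by (intro formula[OF \<epsilon>] disjI1)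
  next
    fix \<epsilon> :: real
    assume mono: "monophase G \<and> constant_coefficients G \<kappa> \<and> S 0 \<notin> real ` {0..DIM('a)}" and \<epsilon>: "\<epsilon> > 0"
    have const: "\<kappa> k x = \<kappa> k (inradius G)" if "k \<le> DIM('a)" "x \<in> {0<..inradius G}" for k x
      using mono that unfolding constant_coefficients_def by blast
    have S0: "S 0 \<notin> real ` {0..DIM('a)}" using mono by blast
    show "\<exists>v. dimension_sums T (tiling_dimensions DIM('a) l (window S))
                     (residue (tubular_zeta G \<kappa> l \<epsilon>)) v \<and>
          complex_of_real (tiling_volume \<Phi> w G \<epsilon>) =
            v + of_real (measure lborel G) * geometric_zeta l (of_nat DIM('a))
              + error_term G \<kappa> l S \<epsilon>"
      by (intro formula[OF \<epsilon> S0] disjI2 ballI const)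
    show "error_term G \<kappa> l S \<epsilon> =
          1 / (2 * of_real pi * \<i>) * screen_integral S (tubular_zeta G \<kappa> l \<epsilon>)"
      unfolding l_def by (rule error_term_monophase[OF \<epsilon> facts(1) S0 const])
  qed
qed

end
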